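(* Let $p$ be a probability density on $\mathbb{R}^d$ such that $\ln p$ is $C^1$, $\nabla\ln p$ is $L$-Lipschitz with $L\ge1$, and $p$ satisfies a log-Sobolev inequality with constant $C_{\mathrm{LS}}\ge1$. Let $s:\mathbb{R}^d\to\mathbb{R}^d$ satisfy, for some $\varepsilon_1\le\sqrt{\frac{1}{48C_{\mathrm{LS}}}}$, $\sup_{x\in\mathbb{R}^d}\|\nabla\ln p(x)-s(x)\|\le\varepsilon_1.$ Let $N\in\mathbb{N}_0$ and $0<h\le\frac{1}{4392\,dC_{\mathrm{LS}}L^2}$. Let $q_{nh}$ be the law of the $n$th iterate of Langevin Monte Carlo with step size $h$ and score estimate $s$, started from $q_0$. Then for every $k$, $$\chi^2(q_{(k+1)h}\|p)\le\exp\Big(-\frac{h}{4C_{\mathrm{LS}}}\Big)\chi^2(q_{kh}\|p)+170\,dL^2h^2+5\varepsilon_1^2h,$$ and $$\chi^2(q_{Nh}\|p)\le\exp\Big(-\frac{Nh}{4C_{\mathrm{LS}}}\Big)\chi^2(q_0\|p)+680\,dL^2hC_{\mathrm{LS}}+20\varepsilon_1^2C_{\mathrm{LS}}\le\exp\Big(-\frac{Nh}{4C_{\mathrm{LS}}}\Big)\chi^2(q_0\|p)+1.$$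
   Context: Langevin Monte Carlo with score estimate $s$ and step size $h$: $x_{(k+1)h}=x_{kh}+h\,s(x_{kh})+\sqrt{2h}\,\xi_{kh}$, $\xi_{kh}\sim N(0,I_d)$ i.i.d. independent of $x_0\sim q_0$. Log-Sobolev inequality with constant $C$: $\mathrm{KL}(q\|p)\le\frac C2\mathbb{E}_q\|\nabla\ln(q/p)\|^2$ for all $q$. $\chi^2(q\|p)=\int q^2/p-1$. *)

theory Defs
  imports "HOL-Probability.Probability"
begin

definition gauss_density :: "'a::euclidean_space \<Rightarrow> real \<Rightarrow> 'a \<Rightarrow> real" where
  "gauss_density m v y =
     (1 / (2 * pi * v)) powr (real DIM('a) / 2) * exp (- (norm (y - m))\<^sup>2 / (2 * v))"

text \<open>One LMC step from x: law of x + h s(x) + sqrt(2h) xi, xi ~ N(0,I), i.e. N(x + h s(x), 2h I).\<close>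
definition lmc_kernel :: "('a::euclidean_space \<Rightarrow> 'a) \<Rightarrow> real \<Rightarrow> 'a \<Rightarrow> 'a measure" where
  "lmc_kernel s h x = density lborel (\<lambda>y. ennreal (gauss_density (x + h *\<^sub>R s x) (2 * h) y))"

primrec lmc_law :: "'a measure \<Rightarrow> ('a::euclidean_space \<Rightarrow> 'a) \<Rightarrow> real \<Rightarrow> nat \<Rightarrow> 'a measure" where
  "lmc_law q0 s h 0 = q0"
| "lmc_law q0 s h (Suc n) = bind (lmc_law q0 s h n) (lmc_kernel s h)"

definition chi_sq :: "'a::euclidean_space measure \<Rightarrow> ('a \<Rightarrow> real) \<Rightarrow> ennreal" where
  "chi_sq q p =
     (if absolutely_continuous lborel q
      then (\<integral>\<^sup>+ x. (RN_deriv lborel q x)\<^sup>2 / ennreal (p x) \<partial>lborel) - 1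
      else \<infinity>)"

definition prob_density :: "('a::euclidean_space \<Rightarrow> real) \<Rightarrow> bool" where
  "prob_density p \<longleftrightarrow> p \<in> borel_measurable borel \<and> (\<forall>x. 0 \<le> p x)
     \<and> integrable lborel p \<and> (\<integral>x. p x \<partial>lborel) = 1"

text \<open>Log-Sobolev inequality with constant C for the positive density p with
  score gp = grad ln p: KL(q||p) \<le> C/2 E_q |grad ln (q/p)|^2 for every positive probability
  density q with differentiable ln q (gradient gq). KL is finite whenever the right side is.\<close>
definition log_sobolev :: "real \<Rightarrow> ('a::euclidean_space \<Rightarrow> real) \<Rightarrow> ('a \<Rightarrow> 'a) \<Rightarrow> bool" where
  "log_sobolev C p gp \<longleftrightarrow>
     (\<forall>q gq. prob_density q \<and> (\<forall>x. 0 < q x) \<and> (\<forall>x. GDERIV (\<lambda>y. ln (q y)) x :> gq x)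
       \<and> (\<integral>\<^sup>+ x. ennreal (q x * (norm (gq x - gp x))\<^sup>2) \<partial>lborel) < \<infinity>
       \<longrightarrow> integrable lborel (\<lambda>x. q x * ln (q x / p x))
           \<and> (\<integral>x. q x * ln (q x / p x) \<partial>lborel)
               \<le> C / 2 * (\<integral>x. q x * (norm (gq x - gp x))\<^sup>2 \<partial>lborel))"

end

theory Submission
  imports Defs
begin

text \<open>
  Interpolate one step by the law of \<open>X + t s(X) + sqrt (2 t) \<xi>\<close>, and let \<open>\<psi> t\<close> be its density
  relative to \<open>p\<close>, with energy \<open>F = E_p \<psi>^2\<close> and dissipation \<open>D = E_p |grad \<psi>|^2\<close>. The
  Fokker--Planck equation gives \<open>F' = - 2 D + 2 E[grad \<psi>(X_t) \<bullet> (s(X) - grad ln p (X_t))]\<close>, so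
  Young's inequality leaves the error \<open>E[\<psi>(X_t) |s(X) - grad ln p (X_t)|^2]\<close>. By the Lipschitz bound
  it is controlled by \<open>\<epsilon>^2 F\<close> and by \<open>L^2\<close> times the weighted second moment of the Gaussian
  increment. Gaussian integration by parts bounds that moment by \<open>4 t d F + 4 t^2 D\<close>, and no change
  of measure is needed. Hence \<open>F' \<le> - 0.99 D + (2.5 \<epsilon>^2 + 30 L^2 t d) F\<close>. The log-Sobolev inequality
  enters only through the Poincare inequality \<open>F - 1 \<le> C D\<close>, and Gronwall's argument finishes the
  step. All integrals converge when the initial law has bounded support; the general case follows by
  truncating it. The error obtained for one step is smaller than the stated one, which is what makes
  the geometric series over the steps fit the stated constants, since \<open>1 / (1 - exp (- x))\<close> exceeds
  \<open>1 / x\<close>.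
\<close>

subsection \<open>Differentiation under the integral\<close>

lemma tendsto_integral_at:
  fixes f :: "'x::first_countable_topology \<Rightarrow> 'b \<Rightarrow> 'c::{banach, second_countable_topology}"
  assumes l_meas: "l \<in> borel_measurable M"
    and f_meas: "\<forall>\<^sub>F v in at a within S. f v \<in> borel_measurable M"
    and lim: "AE x in M. ((\<lambda>v. f v x) \<longlongrightarrow> l x) (at a within S)"
    and bound: "\<forall>\<^sub>F v in at a within S. AE x in M. norm (f v x) \<le> w x"
    and w_int: "integrable M w"
  shows "((\<lambda>v. \<integral>x. f v x \<partial>M) \<longlongrightarrow> (\<integral>x. l x \<partial>M)) (at a within S)"
  unfolding tendsto_at_iff_sequentially
proof (intro allI impI)
  fix X :: "nat \<Rightarrow> 'x" assume X_lim: "\<forall>i. X i \<in> S - {a}" "X \<longlonglongrightarrow> a"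
  hence "filterlim X (at a within S) sequentially"
    by (auto simp: filterlim_at)
  hence "\<forall>\<^sub>F i in sequentially. f (X i) \<in> borel_measurable M \<and> (AE x in M. norm (f (X i) x) \<le> w x)"
    using eventually_conj[OF f_meas bound] by (rule eventually_compose_filterlim[rotated])
  then obtain n where tail:
      "\<And>i. i \<ge> n \<Longrightarrow> f (X i) \<in> borel_measurable M \<and> (AE x in M. norm (f (X i) x) \<le> w x)"
    unfolding eventually_sequentially by blast
  have "(\<lambda>i. \<integral>x. f (X (i + n)) x \<partial>M) \<longlonglongrightarrow> (\<integral>x. l x \<partial>M)"
  proof (rule integral_dominated_convergence[OF l_meas _ w_int])
    show "AE x in M. (\<lambda>i. f (X (i + n)) x) \<longlonglongrightarrow> l x"
      using lim
    proof eventually_elim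
      case (elim x)
      thus ?case using X_lim unfolding tendsto_at_iff_sequentially comp_def
        by (intro LIMSEQ_ignore_initial_segment[of "\<lambda>i. f (X i) x"]) blast
    qed
  qed (use tail in auto)
  thus "((\<lambda>v. \<integral>x. f v x \<partial>M) \<circ> X) \<longlonglongrightarrow> (\<integral>x. l x \<partial>M)"
    unfolding comp_def by (rule LIMSEQ_offset)
qed

lemma GDERIV_iff_tendsto:
  "GDERIV f a :> d \<longleftrightarrow> ((\<lambda>v. (f (a + v) - f a - v \<bullet> d) / norm v) \<longlongrightarrow> 0) (at 0)"
proof -
  have "((\<lambda>v. \<bar>f (a + v) - f a - v \<bullet> d\<bar> / norm v) \<longlongrightarrow> 0) (at 0)
      \<longleftrightarrow> ((\<lambda>v. \<bar>(f (a + v) - f a - v \<bullet> d) / norm v\<bar>) \<longlongrightarrow> 0) (at 0)"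
    by simp
  thus ?thesis
    unfolding gderiv_def has_derivative_at tendsto_rabs_zero_iff
    by (simp add: bounded_linear_inner_left)
qed

lemma GDERIV_bounded_imp_lipschitz:
  assumes "convex S" and der: "\<And>u. u \<in> S \<Longrightarrow> GDERIV f u :> g u"
    and g_le: "\<And>u. u \<in> S \<Longrightarrow> norm (g u) \<le> B" and "x \<in> S" "y \<in> S"
  shows "\<bar>f y - f x\<bar> \<le> B * norm (y - x)"
  unfolding real_norm_def[symmetric]
proof (rule differentiable_bound[where f'="\<lambda>u h. h \<bullet> g u"])
  fix u assume u_in: "u \<in> S"
  show "(f has_derivative (\<lambda>h. h \<bullet> g u)) (at u within S)"
    using der[OF u_in] unfolding gderiv_def by (rule has_derivative_at_withinI)
  show "onorm (\<lambda>h. h \<bullet> g u) \<le> B"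
  proof (rule onorm_bound)
    show "0 \<le> B" using g_le[OF u_in] norm_ge_zero order_trans by blast
    show "norm (h \<bullet> g u) \<le> B * norm h" for h
      using Cauchy_Schwarz_ineq2[of h "g u"] mult_left_mono[OF g_le[OF u_in] norm_ge_zero[of h]]
      by (simp add: mult.commute)
  qed
qed fact+

lemma GDERIV_remainder_le:
  assumes e_pos: "0 < e"
    and der: "\<And>u. u \<in> ball a e \<Longrightarrow> GDERIV f u :> g u"
    and g_le: "\<And>u. u \<in> ball a e \<Longrightarrow> norm (g u) \<le> B"
    and near: "a + v \<in> ball a e"
  shows "\<bar>f (a + v) - f a - v \<bullet> g a\<bar> \<le> 2 * B * norm v"
proof -
  have center: "a \<in> ball a e" using e_pos by simp
  have "\<bar>f (a + v) - f a\<bar> \<le> B * norm v"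
    using GDERIV_bounded_imp_lipschitz[OF convex_ball der g_le center near] by simp
  moreover have "\<bar>v \<bullet> g a\<bar> \<le> B * norm v"
    using Cauchy_Schwarz_ineq2[of v "g a"] mult_left_mono[OF g_le[OF center] norm_ge_zero[of v]]
    by (simp add: mult.commute)
  ultimately show ?thesis by linarith
qed

lemma GDERIV_integral:
  fixes f :: "'a::euclidean_space \<Rightarrow> 'b \<Rightarrow> real"
  assumes e_pos: "0 < e"
    and f_int: "\<And>y. y \<in> ball a e \<Longrightarrow> integrable M (f y)"
    and der: "\<And>x y. x \<in> space M \<Longrightarrow> y \<in> ball a e \<Longrightarrow> GDERIV (\<lambda>y. f y x) y :> g y x"
    and g_meas: "g a \<in> borel_measurable M"
    and g_le: "\<And>x y. x \<in> space M \<Longrightarrow> y \<in> ball a e \<Longrightarrow> norm (g y x) \<le> w x"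
    and w_int: "integrable M w"
  shows "GDERIV (\<lambda>y. \<integral>x. f y x \<partial>M) a :> (\<integral>x. g a x \<partial>M)"
proof -
  define rem where "rem v x = (f (a + v) x - f a x - v \<bullet> g a x) / norm v" for v x
  have center: "a \<in> ball a e" using e_pos by simp
  have near: "\<forall>\<^sub>F v in at 0. a + v \<in> ball a e"
    using eventually_at_ball[OF e_pos, of 0] by eventually_elim (simp add: dist_norm)
  have g_int: "integrable M (g a)"
    by (rule Bochner_Integration.integrable_bound[OF w_int g_meas])
       (use g_le[OF _ center] in \<open>auto intro: order_trans[OF _ abs_ge_self]\<close>)
  have rem_int: "integrable M (rem v)" if "a + v \<in> ball a e" for v
    unfolding rem_def using that center f_int g_int by simp
  have rem_le: "norm (rem v x) \<le> 2 * w x" if "x \<in> space M" "a + v \<in> ball a e" for v x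
    using GDERIV_remainder_le[OF e_pos der g_le, where v=v] that
      order_trans[OF norm_ge_zero g_le[OF _ center], of x]
    by (cases "v = 0") (auto simp: rem_def pos_divide_le_eq)
  have "((\<lambda>v. \<integral>x. rem v x \<partial>M) \<longlongrightarrow> (\<integral>x. 0 \<partial>M)) (at 0)"
  proof (rule tendsto_integral_at)
    show "\<forall>\<^sub>F v in at 0. rem v \<in> borel_measurable M"
      using near by eventually_elim (use rem_int in auto)
    show "AE x in M. ((\<lambda>v. rem v x) \<longlongrightarrow> 0) (at 0)"
      using der[OF _ center] unfolding rem_def by (auto simp: GDERIV_iff_tendsto)
    show "\<forall>\<^sub>F v in at 0. AE x in M. norm (rem v x) \<le> 2 * w x"
      using near by eventually_elim (use rem_le in auto)
  qed (use w_int in auto)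
  moreover have "\<forall>\<^sub>F v in at 0. (\<integral>x. rem v x \<partial>M)
      = ((\<integral>x. f (a + v) x \<partial>M) - (\<integral>x. f a x \<partial>M) - v \<bullet> (\<integral>x. g a x \<partial>M)) / norm v"
    using near by eventually_elim (simp add: rem_def f_int[OF center] f_int g_int)
  ultimately show ?thesis
    unfolding GDERIV_iff_tendsto by (simp cong: filterlim_cong)
qed

subsection \<open>Integrals over Euclidean space\<close>

lemma nn_integral_lborel_affine:
  fixes f :: "'a::euclidean_space \<Rightarrow> ennreal"
  assumes [measurable]: "f \<in> borel_measurable borel" and c_nonzero: "c \<noteq> 0"
  shows "(\<integral>\<^sup>+x. f x \<partial>lborel) = ennreal (\<bar>c\<bar> ^ DIM('a)) * (\<integral>\<^sup>+x. f (t + c *\<^sub>R x) \<partial>lborel)"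
proof -
  have "(\<integral>\<^sup>+x. f x \<partial>lborel)
      = (\<integral>\<^sup>+x. f x \<partial>density (distr lborel borel (\<lambda>x. t + c *\<^sub>R x)) (\<lambda>_. \<bar>c\<bar> ^ DIM('a)))"
    by (subst lborel_affine[OF c_nonzero]) (rule refl)
  thus ?thesis
    by (simp add: nn_integral_density nn_integral_distr nn_integral_cmult)
qed

lemma nn_integral_lborel_translation:
  fixes f :: "'a::euclidean_space \<Rightarrow> ennreal"
  assumes "f \<in> borel_measurable borel"
  shows "(\<integral>\<^sup>+y. f (y - x) \<partial>lborel) = (\<integral>\<^sup>+y. f y \<partial>lborel)"
  using nn_integral_lborel_affine[OF assms, of 1 "- x"] by simp

lemma integrable_lborel_affine:
  fixes f :: "'a::euclidean_space \<Rightarrow> 'b::{banach, second_countable_topology}"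
  assumes f_int: "integrable lborel f" and c_nonzero: "c \<noteq> 0"
  shows "integrable lborel (\<lambda>x. f (t + c *\<^sub>R x))"
proof -
  have [measurable]: "f \<in> borel_measurable borel" using f_int by auto
  have "ennreal (\<bar>c\<bar> ^ DIM('a)) * (\<integral>\<^sup>+x. norm (f (t + c *\<^sub>R x)) \<partial>lborel) < \<infinity>"
    using f_int nn_integral_lborel_affine[OF _ c_nonzero, of "\<lambda>x. norm (f x)" t]
    by (simp add: integrable_iff_bounded)
  thus ?thesis
    using c_nonzero by (auto simp: integrable_iff_bounded ennreal_mult_less_top)
qed

lemma integral_lborel_affine:
  fixes f :: "'a::euclidean_space \<Rightarrow> 'b::{banach, second_countable_topology}"
  assumes [measurable]: "f \<in> borel_measurable borel" and c_nonzero: "c \<noteq> 0"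
  shows "(\<integral>x. f x \<partial>lborel) = \<bar>c\<bar> ^ DIM('a) *\<^sub>R (\<integral>x. f (t + c *\<^sub>R x) \<partial>lborel)"
proof -
  have "(\<integral>x. f x \<partial>lborel)
      = (\<integral>x. f x \<partial>density (distr lborel borel (\<lambda>x. t + c *\<^sub>R x)) (\<lambda>_. \<bar>c\<bar> ^ DIM('a)))"
    by (subst lborel_affine[OF c_nonzero]) (rule refl)
  thus ?thesis
    by (simp add: integral_density integral_distr)
qed

lemma nn_integral_mult_power2_le:
  fixes f k :: "'a \<Rightarrow> ennreal"
  assumes [measurable]: "f \<in> borel_measurable M" "k \<in> borel_measurable M"
  shows "(\<integral>\<^sup>+x. f x * k x \<partial>M)\<^sup>2 \<le> (\<integral>\<^sup>+x. k x \<partial>M) * (\<integral>\<^sup>+x. (f x)\<^sup>2 * k x \<partial>M)"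
proof -
  have integral_density: "(\<integral>\<^sup>+x. g x \<partial>density M k) = (\<integral>\<^sup>+x. g x * k x \<partial>M)"
    if "g \<in> borel_measurable M" for g
    using that by (simp add: nn_integral_density mult.commute)
  have "(\<integral>\<^sup>+x. f x * 1 \<partial>density M k)\<^sup>2 \<le> (\<integral>\<^sup>+x. (f x)\<^sup>2 \<partial>density M k) * (\<integral>\<^sup>+x. 1\<^sup>2 \<partial>density M k)"
    by (rule Cauchy_Schwarz_nn_integral) auto
  thus ?thesis
    unfolding mult_1_right power_one
    by (subst (asm) (1 2 3) integral_density) (auto simp: mult.commute)
qed

lemma nn_integral_Schur_test:
  fixes f :: "'a \<Rightarrow> ennreal" and k :: "'a \<Rightarrow> 'b \<Rightarrow> ennreal"
  assumes "sigma_finite_measure M" "sigma_finite_measure N"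
    and [measurable]: "f \<in> borel_measurable M" "u \<in> borel_measurable M" "w \<in> borel_measurable N"
    and k_meas [measurable]: "case_prod k \<in> borel_measurable (M \<Otimes>\<^sub>M N)"
    and row_le: "\<And>y. y \<in> space N \<Longrightarrow> (\<integral>\<^sup>+x. k x y \<partial>M) \<le> A"
    and column_le: "\<And>x. x \<in> space M \<Longrightarrow> (\<integral>\<^sup>+y. k x y * w y \<partial>N) \<le> B * u x"
  shows "(\<integral>\<^sup>+y. (\<integral>\<^sup>+x. f x * k x y \<partial>M)\<^sup>2 * w y \<partial>N) \<le> A * B * (\<integral>\<^sup>+x. (f x)\<^sup>2 * u x \<partial>M)"
proof -
  interpret M: sigma_finite_measure M by fact
  interpret N: sigma_finite_measure N by fact
  interpret pair_sigma_finite M N ..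
  have "(\<integral>\<^sup>+y. (\<integral>\<^sup>+x. f x * k x y \<partial>M)\<^sup>2 * w y \<partial>N) \<le> (\<integral>\<^sup>+y. A * (\<integral>\<^sup>+x. (f x)\<^sup>2 * (k x y * w y) \<partial>M) \<partial>N)"
  proof (rule nn_integral_mono)
    fix y assume y_in: "y \<in> space N"
    note [measurable] = measurable_compose[OF measurable_Pair2'[OF y_in] k_meas, simplified]
    have "(\<integral>\<^sup>+x. f x * k x y \<partial>M)\<^sup>2 \<le> (\<integral>\<^sup>+x. k x y \<partial>M) * (\<integral>\<^sup>+x. (f x)\<^sup>2 * k x y \<partial>M)"
      by (rule nn_integral_mult_power2_le) measurable
    also have "\<dots> \<le> A * (\<integral>\<^sup>+x. (f x)\<^sup>2 * k x y \<partial>M)"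
      by (intro mult_right_mono row_le y_in) simp
    finally have "(\<integral>\<^sup>+x. f x * k x y \<partial>M)\<^sup>2 * w y \<le> A * (\<integral>\<^sup>+x. (f x)\<^sup>2 * k x y \<partial>M) * w y"
      by (rule mult_right_mono) simp
    thus "(\<integral>\<^sup>+x. f x * k x y \<partial>M)\<^sup>2 * w y \<le> A * (\<integral>\<^sup>+x. (f x)\<^sup>2 * (k x y * w y) \<partial>M)"
      by (simp add: nn_integral_multc mult.assoc[symmetric])
  qed
  also have "\<dots> = A * (\<integral>\<^sup>+x. \<integral>\<^sup>+y. (f x)\<^sup>2 * (k x y * w y) \<partial>N \<partial>M)"
    by (subst nn_integral_cmult, measurable, subst Fubini', measurable)
  also have "\<dots> \<le> A * (\<integral>\<^sup>+x. (f x)\<^sup>2 * (B * u x) \<partial>M)"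
  proof (intro mult_left_mono nn_integral_mono)
    fix x assume x_in: "x \<in> space M"
    note [measurable] = measurable_compose[OF measurable_Pair1'[OF x_in] k_meas, simplified]
    show "(\<integral>\<^sup>+y. (f x)\<^sup>2 * (k x y * w y) \<partial>N) \<le> (f x)\<^sup>2 * (B * u x)"
      by (subst nn_integral_cmult) (auto intro: mult_left_mono column_le[OF x_in])
  qed simp
  also have "\<dots> = A * B * (\<integral>\<^sup>+x. (f x)\<^sup>2 * u x \<partial>M)"
    by (simp add: mult.left_commute[of _ B] nn_integral_cmult mult.assoc)
  finally show ?thesis .
qed

subsection \<open>Elementary inequalities\<close>

lemma power2_add_le: "(a + b)\<^sup>2 \<le> 2 * a\<^sup>2 + 2 * b\<^sup>2" for a b :: real
  using sum_squares_bound[of a b] by (simp add: power2_sum)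

lemma norm_add_power2_le:
  fixes a b :: "'a::real_normed_vector"
  shows "(norm (a + b))\<^sup>2 \<le> 2 * (norm a)\<^sup>2 + 2 * (norm b)\<^sup>2"
  using power_mono[OF norm_triangle_ineq norm_ge_zero, of a b 2] power2_add_le[of "norm a" "norm b"]
  by linarith

lemma inner_le_weighted_squares:
  fixes a b :: "'a::real_inner"
  assumes "0 < c"
  shows "2 * (a \<bullet> b) \<le> c * (norm a)\<^sup>2 + (1 / c) * (norm b)\<^sup>2"
proof -
  have "0 \<le> (1 / c) * (norm (c *\<^sub>R a - b))\<^sup>2" using assms by simp
  also have "(norm (c *\<^sub>R a - b))\<^sup>2 = c\<^sup>2 * (norm a)\<^sup>2 - 2 * c * (a \<bullet> b) + (norm b)\<^sup>2"
    unfolding power2_norm_eq_inner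
    by (simp add: inner_diff_left inner_diff_right inner_commute power2_eq_square)
  finally show ?thesis using assms by (simp add: field_simps power2_eq_square)
qed

lemma gronwall_exp_decay:
  fixes u u' :: "real \<Rightarrow> real"
  assumes a_le_b: "a \<le> b" and "0 \<le> c" "0 \<le> K"
    and der: "\<And>t. t \<in> {a..b} \<Longrightarrow> (u has_real_derivative u' t) (at t)"
    and u_rate_le: "\<And>t. t \<in> {a..b} \<Longrightarrow> u' t \<le> - c * u t + K"
  shows "u b \<le> exp (- c * (b - a)) * u a + K * (b - a)"
proof -
  define v where "v t = exp (- c * (b - t)) * u t - K * t" for t
  have "v b \<le> v a"
  proof (rule DERIV_nonpos_imp_nonincreasing[OF a_le_b])
    fix t assume "a \<le> t" "t \<le> b"
    hence t_in: "t \<in> {a..b}" by simp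
    have "(v has_real_derivative exp (- c * (b - t)) * (c * u t + u' t) - K) (at t)"
      unfolding v_def by (rule derivative_eq_intros der[OF t_in] refl)+ (simp add: algebra_simps)
    moreover have "exp (- c * (b - t)) * (c * u t + u' t) \<le> exp (- c * (b - t)) * K"
      using u_rate_le[OF t_in] by (intro mult_left_mono) auto
    moreover have "exp (- c * (b - t)) * K \<le> 1 * K"
      using t_in \<open>0 \<le> c\<close> \<open>0 \<le> K\<close> by (intro mult_right_mono) auto
    ultimately show "\<exists>D. (v has_real_derivative D) (at t) \<and> D \<le> 0"
      by (intro exI conjI) (assumption, linarith)
  qed
  thus ?thesis by (simp add: v_def algebra_simps)
qed

lemma entropy_ge_cubic:
  fixes u :: real
  assumes u_pos: "0 < u"
  shows "(u - 1)\<^sup>2 / 2 - (u - 1) ^ 3 / 6 \<le> u * ln u - u + 1"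
proof -
  define g :: "real \<Rightarrow> real" where "g u = ln u - (u - 1) + (u - 1)\<^sup>2 / 2" for u
  define f :: "real \<Rightarrow> real" where "f u = u * ln u - u + 1 - (u - 1)\<^sup>2 / 2 + (u - 1) ^ 3 / 6" for u
  have g_der: "(g has_real_derivative (x - 1)\<^sup>2 / x) (at x)" if "0 < x" for x
    unfolding g_def using that by (auto intro!: derivative_eq_intros simp: field_simps power2_eq_square)
  have f_der: "(f has_real_derivative g x) (at x)" if "0 < x" for x
    unfolding f_def g_def using that
    by (auto intro!: derivative_eq_intros simp: field_simps power2_eq_square)
  have g_mono: "g x \<le> g y" if "0 < x" "x \<le> y" for x y
  proof (rule DERIV_nonneg_imp_nondecreasing[OF that(2)])
    fix z assume "x \<le> z"
    thus "\<exists>D. (g has_real_derivative D) (at z) \<and> 0 \<le> D"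
      using g_der[of z] that(1) by (intro exI[of _ "(z - 1)\<^sup>2 / z"]) auto
  qed
  have g_at_one: "g 1 = 0" by (simp add: g_def)
  have g_nonneg: "0 \<le> g x" if "1 \<le> x" for x using g_mono[OF _ that] g_at_one by simp
  have g_nonpos: "g x \<le> 0" if "0 < x" "x \<le> 1" for x using g_mono[OF that] g_at_one by simp
  have "f 1 \<le> f u"
  proof (cases "1 \<le> u")
    case True
    show ?thesis
      by (rule DERIV_nonneg_imp_nondecreasing[OF True])
         (meson True f_der g_nonneg less_le_trans zero_less_one)
  next
    case False
    hence "u \<le> 1" by simp
    thus ?thesis
      by (rule DERIV_nonpos_imp_nonincreasing)
         (meson f_der g_nonpos less_le_trans u_pos)
  qed
  thus ?thesis by (simp add: f_def)
qed

subsection \<open>Gaussian densities\<close>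

lemma gauss_density_nonneg: "0 \<le> gauss_density m v y"
  by (simp add: gauss_density_def)

lemma gauss_density_pos: "0 < v \<Longrightarrow> 0 < gauss_density m v y"
  by (simp add: gauss_density_def)

lemma gauss_density_eq_centered: "gauss_density m v y = gauss_density 0 v (y - m)"
  by (simp add: gauss_density_def)

lemma borel_measurable_gauss_density [measurable (raw)]:
  fixes m y :: "'b \<Rightarrow> 'a::euclidean_space"
  assumes [measurable]: "m \<in> borel_measurable M" "v \<in> borel_measurable M" "y \<in> borel_measurable M"
  shows "(\<lambda>x. gauss_density (m x) (v x) (y x)) \<in> borel_measurable M"
  unfolding gauss_density_def by measurable

lemma gauss_density_eq_prod:
  fixes m :: "'a::euclidean_space"
  assumes v_pos: "0 < v"
  shows "gauss_density m v y = (\<Prod>b\<in>Basis. normal_density (m \<bullet> b) (sqrt v) (y \<bullet> b))"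
proof -
  have "(norm (y - m))\<^sup>2 = (\<Sum>b\<in>Basis. (y \<bullet> b - m \<bullet> b)\<^sup>2)"
    by (subst power2_norm_eq_inner, subst euclidean_inner) (simp add: power2_eq_square inner_diff_left)
  moreover have "(1 / (2 * pi * v)) powr (real DIM('a) / 2) = (1 / sqrt (2 * pi * v)) ^ DIM('a)"
    using v_pos by (simp add: powr_half_sqrt_powr powr_realpow real_sqrt_power real_sqrt_divide)
  ultimately show ?thesis
    using v_pos unfolding gauss_density_def normal_density_def
    by (simp add: prod.distrib exp_sum[symmetric] sum_divide_distrib sum_negf[symmetric]
        power_one_over prod_dividef)
qed

lemma nn_integral_gauss_density:
  fixes m :: "'a::euclidean_space"
  assumes v_pos: "0 < v"
  shows "(\<integral>\<^sup>+y. gauss_density m v y \<partial>lborel) = 1"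
proof -
  have "(\<integral>\<^sup>+y. gauss_density m v y \<partial>lborel)
      = (\<integral>\<^sup>+y. (\<Prod>b\<in>Basis. ennreal (normal_density (m \<bullet> b) (sqrt v) (y \<bullet> b))) \<partial>lborel)"
    by (simp add: gauss_density_eq_prod[OF v_pos] prod_ennreal)
  also have "\<dots> = (\<Prod>b\<in>(Basis::'a set). (\<integral>\<^sup>+x. normal_density (m \<bullet> b) (sqrt v) x \<partial>lborel))"
    by (rule nn_integral_lborel_prod) auto
  also have "\<dots> = 1"
    using v_pos by (simp add: nn_integral_eq_integral)
  finally show ?thesis .
qed

lemma integral_gauss_density:
  assumes "0 < v"
  shows "integrable lborel (gauss_density m v)" "(\<integral>y. gauss_density m v y \<partial>lborel) = 1"
proof -
  have "has_bochner_integral lborel (gauss_density m v) 1"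
    using nn_integral_gauss_density[OF assms, of m]
    by (intro has_bochner_integral_nn_integral) (simp_all add: gauss_density_nonneg)
  thus "integrable lborel (gauss_density m v)" "(\<integral>y. gauss_density m v y \<partial>lborel) = 1"
    by (simp_all add: has_bochner_integral_iff)
qed

lemma gauss_density_mult_exp:
  fixes w :: "'a::euclidean_space"
  assumes v_pos: "0 < v" and a_less: "2 * v * a < 1"
  shows "gauss_density 0 v w * exp (a * (norm w)\<^sup>2)
    = (1 / (1 - 2 * v * a)) powr (real DIM('a) / 2) * gauss_density 0 (v / (1 - 2 * v * a)) w"
proof -
  define c where "c = 1 - 2 * v * a"
  have c_pos: "0 < c" using a_less by (simp add: c_def)
  have coeff_eq: "(1 / c) powr (real DIM('a) / 2) * (1 / (2 * pi * (v / c))) powr (real DIM('a) / 2)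
      = (1 / (2 * pi * v)) powr (real DIM('a) / 2)"
    using v_pos c_pos by (subst powr_mult[symmetric]) auto
  have "- (norm w)\<^sup>2 / (2 * v) + a * (norm w)\<^sup>2 = - (norm w)\<^sup>2 / (2 * (v / c))"
    using v_pos c_pos by (simp add: field_simps) (simp add: c_def algebra_simps)
  hence exponent_eq:
      "exp (- (norm w)\<^sup>2 / (2 * v)) * exp (a * (norm w)\<^sup>2) = exp (- (norm w)\<^sup>2 / (2 * (v / c)))"
    by (simp only: exp_add[symmetric])
  show ?thesis
    unfolding c_def[symmetric] unfolding gauss_density_def diff_zero mult.assoc exponent_eq
    by (simp only: mult.assoc[symmetric] coeff_eq)
qed

lemma nn_integral_gauss_density_mult_exp:
  assumes v_pos: "0 < v" and a_less: "2 * v * a < 1"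
  shows "(\<integral>\<^sup>+w. ennreal (gauss_density (0::'a::euclidean_space) v w * exp (a * (norm w)\<^sup>2)) \<partial>lborel)
    = ennreal ((1 / (1 - 2 * v * a)) powr (real DIM('a) / 2))"
proof -
  have "0 < v / (1 - 2 * v * a)" using assms by simp
  from nn_integral_gauss_density[OF this, of "0::'a"] show ?thesis
    by (simp add: gauss_density_mult_exp[OF assms] ennreal_mult gauss_density_nonneg nn_integral_cmult)
qed

lemma integrable_exp_neg_norm_sq:
  assumes a_pos: "0 < a"
  shows "integrable lborel (\<lambda>y::'a::euclidean_space. exp (- a * (norm y)\<^sup>2))"
proof -
  have "integrable lborel (\<lambda>y::'a. (a / pi) powr (- real DIM('a) / 2) * gauss_density 0 (1 / (2 * a)) y)"
    using a_pos by (intro integrable_mult_right integral_gauss_density) simp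
  thus ?thesis
    using a_pos by (simp add: gauss_density_def powr_minus field_simps)
qed

lemma gauss_density_shift_le:
  assumes v_pos: "0 < v"
  shows "gauss_density (m + u) v y \<le> gauss_density m v y * exp (norm u * norm (y - m) / v)"
proof -
  have "(norm (y - (m + u)))\<^sup>2 = (norm (y - m))\<^sup>2 - 2 * (u \<bullet> (y - m)) + (norm u)\<^sup>2"
    unfolding power2_norm_eq_inner
    by (simp add: inner_diff_left inner_diff_right inner_add_left inner_add_right inner_commute)
  hence "(norm (y - m))\<^sup>2 - 2 * (norm u * norm (y - m)) \<le> (norm (y - (m + u)))\<^sup>2"
    using norm_cauchy_schwarz[of u "y - m"] zero_le_power2[of "norm u"] by linarith
  hence "- (norm (y - (m + u)))\<^sup>2 / (2 * v) \<le> - ((norm (y - m))\<^sup>2 - 2 * (norm u * norm (y - m))) / (2 * v)"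
    using v_pos by (intro divide_right_mono) auto
  also have "\<dots> = - (norm (y - m))\<^sup>2 / (2 * v) + norm u * norm (y - m) / v"
    using v_pos by (simp add: field_simps)
  finally have "exp (- (norm (y - (m + u)))\<^sup>2 / (2 * v))
      \<le> exp (- (norm (y - m))\<^sup>2 / (2 * v)) * exp (norm u * norm (y - m) / v)"
    unfolding exp_add[symmetric] by simp
  thus ?thesis
    unfolding gauss_density_def mult.assoc by (rule mult_left_mono) simp
qed

lemma gauss_density_le:
  fixes m :: "'a::euclidean_space"
  assumes m_le: "norm m \<le> R" and v_range: "0 < v\<^sub>0" "v\<^sub>0 \<le> v" "v \<le> v\<^sub>1"
  shows "gauss_density m v y
    \<le> (1 / (2 * pi * v\<^sub>0)) powr (real DIM('a) / 2) * exp (R\<^sup>2 / (2 * v\<^sub>0)) * exp (- (norm y)\<^sup>2 / (4 * v\<^sub>1))"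
proof -
  have "(norm y)\<^sup>2 \<le> 2 * (norm (y - m))\<^sup>2 + 2 * (norm m)\<^sup>2"
    using norm_add_power2_le[of "y - m" m] by simp
  hence norm_diff_ge: "(norm y)\<^sup>2 / 2 - R\<^sup>2 \<le> (norm (y - m))\<^sup>2"
    using power_mono[OF m_le norm_ge_zero, of 2] by linarith
  have "- (norm (y - m))\<^sup>2 / (2 * v) \<le> - ((norm y)\<^sup>2 / 2 - R\<^sup>2) / (2 * v)"
    using norm_diff_ge v_range by (intro divide_right_mono) auto
  also have "\<dots> = R\<^sup>2 / (2 * v) + - ((norm y)\<^sup>2 / (4 * v))"
    using v_range by (simp add: field_simps)
  also have "\<dots> \<le> R\<^sup>2 / (2 * v\<^sub>0) + - ((norm y)\<^sup>2 / (4 * v\<^sub>1))"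
    using v_range by (intro add_mono le_imp_neg_le divide_left_mono) auto
  finally have "exp (- (norm (y - m))\<^sup>2 / (2 * v)) \<le> exp (R\<^sup>2 / (2 * v\<^sub>0)) * exp (- (norm y)\<^sup>2 / (4 * v\<^sub>1))"
    unfolding exp_add[symmetric] by simp
  moreover have "(1 / (2 * pi * v)) powr (real DIM('a) / 2) \<le> (1 / (2 * pi * v\<^sub>0)) powr (real DIM('a) / 2)"
    using v_range by (intro powr_mono2 divide_left_mono) auto
  ultimately show ?thesis
    unfolding gauss_density_def mult.assoc by (intro mult_mono) auto
qed

lemma GDERIV_gauss_density:
  "GDERIV (gauss_density m v) y :> - (gauss_density m v y / v) *\<^sub>R (y - m)"
proof -
  have "((\<lambda>y. (- 1 / (2 * v)) * ((y - m) \<bullet> (y - m))) has_derivative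
      (\<lambda>h. (- 1 / (2 * v)) * ((y - m) \<bullet> h + h \<bullet> (y - m)))) (at y)"
    by (intro has_derivative_mult_right) (rule derivative_eq_intros | simp)+
  hence "((\<lambda>y. - (norm (y - m))\<^sup>2 / (2 * v)) has_derivative (\<lambda>h. - (2 * (h \<bullet> (y - m))) / (2 * v))) (at y)"
    by (simp add: power2_norm_eq_inner inner_commute)
  hence "((\<lambda>y. (1 / (2 * pi * v)) powr (real DIM('a) / 2) * exp (- (norm (y - m))\<^sup>2 / (2 * v)))
      has_derivative (\<lambda>h. h \<bullet> (- (gauss_density m v y / v) *\<^sub>R (y - m)))) (at y)"
    by (rule has_derivative_eq_rhs[OF has_derivative_mult_right[OF has_derivative_exp]])
       (simp add: gauss_density_def fun_eq_iff)
  thus ?thesis unfolding gderiv_def by (simp add: gauss_density_def[abs_def])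
qed

lemma gauss_density_path_eq_exp:
  fixes x w y :: "'a::euclidean_space"
  assumes t_pos: "0 < t"
  shows "gauss_density (x + t *\<^sub>R w) (2 * t) y
    = exp (- (real DIM('a) / 2) * ln (4 * pi * t) - (norm (y - x))\<^sup>2 / (4 * t)
      + (y - x) \<bullet> w / 2 - t * (norm w)\<^sup>2 / 4)"
proof -
  have "(norm (y - (x + t *\<^sub>R w)))\<^sup>2 = (norm (y - x))\<^sup>2 - 2 * t * ((y - x) \<bullet> w) + t\<^sup>2 * (norm w)\<^sup>2"
    unfolding power2_norm_eq_inner power2_eq_square[of t]
    by (simp add: inner_diff_left inner_diff_right inner_add_left inner_add_right inner_commute
        algebra_simps)
  hence "- (norm (y - (x + t *\<^sub>R w)))\<^sup>2 / (2 * (2 * t))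
      = - (norm (y - x))\<^sup>2 / (4 * t) + (y - x) \<bullet> w / 2 - t * (norm w)\<^sup>2 / 4"
    using t_pos by (simp add: field_simps power2_eq_square)
  moreover have "(1 / (2 * pi * (2 * t))) powr (real DIM('a) / 2)
      = exp (- (real DIM('a) / 2) * ln (4 * pi * t))"
    using t_pos by (simp add: powr_def ln_div mult.assoc[symmetric])
  ultimately show ?thesis
    by (simp add: gauss_density_def exp_add[symmetric])
qed

lemma DERIV_gauss_density_path:
  fixes x w y :: "'a::euclidean_space"
  assumes t_pos: "0 < t"
  shows "((\<lambda>t. gauss_density (x + t *\<^sub>R w) (2 * t) y) has_real_derivative
     gauss_density (x + t *\<^sub>R w) (2 * t) y / (2 * t) *
       ((y - (x + t *\<^sub>R w)) \<bullet> (y - (x - t *\<^sub>R w)) / (2 * t) - DIM('a))) (at t)"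
    (is "(?f has_real_derivative ?f t / (2 * t) * ?c) (at t)")
proof -
  define g where "g t = - (real DIM('a) / 2) * ln (4 * pi * t) - (norm (y - x))\<^sup>2 / (4 * t)
    + (y - x) \<bullet> w / 2 - t * (norm w)\<^sup>2 / 4" for t
  have inner_eq: "(y - (x + t *\<^sub>R w)) \<bullet> (y - (x - t *\<^sub>R w)) = (norm (y - x))\<^sup>2 - t\<^sup>2 * (norm w)\<^sup>2"
    unfolding power2_norm_eq_inner
    by (simp add: inner_diff_left inner_diff_right inner_add_left inner_add_right inner_commute
        algebra_simps power2_eq_square)
  have "(g has_real_derivative 1 / (2 * t) * ?c) (at t)"
    unfolding g_def inner_eq
    by - ((rule derivative_eq_intros refl | use t_pos in \<open>simp; fail\<close>)+,
      use t_pos in \<open>simp add: field_simps power2_eq_square\<close>)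
  hence "((\<lambda>t. exp (g t)) has_real_derivative exp (g t) * (1 / (2 * t) * ?c)) (at t)"
    by (rule DERIV_fun_exp)
  moreover have "\<forall>\<^sub>F u in nhds t. exp (g u) = ?f u"
  proof -
    have "\<forall>\<^sub>F u in nhds t. 0 < u" by (rule order_tendstoD(1)[OF filterlim_ident t_pos])
    thus ?thesis by eventually_elim (simp add: g_def gauss_density_path_eq_exp)
  qed
  ultimately show ?thesis
    using t_pos by (subst (asm) DERIV_cong_ev) (auto simp: g_def gauss_density_path_eq_exp)
qed

subsection \<open>Gaussian growth and tempered families\<close>

definition gauss_growth ::
    "real \<Rightarrow> 'i set \<Rightarrow> ('i \<Rightarrow> 'a::euclidean_space \<Rightarrow> 'c::real_normed_vector) \<Rightarrow> bool" where
  "gauss_growth a I g \<longleftrightarrow> (\<exists>c. \<forall>i\<in>I. \<forall>y. norm (g i y) \<le> c * exp (a * (norm y)\<^sup>2))"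

definition tempered ::
    "'i set \<Rightarrow> ('i \<Rightarrow> 'a::euclidean_space \<Rightarrow> 'c::real_normed_vector) \<Rightarrow> bool" where
  "tempered I g \<longleftrightarrow> (\<forall>a>0. gauss_growth a I g)"

lemma gauss_growthI:
  "(\<And>i y. i \<in> I \<Longrightarrow> norm (g i y) \<le> c * exp (a * (norm y)\<^sup>2)) \<Longrightarrow> gauss_growth a I g"
  unfolding gauss_growth_def by blast

lemma gauss_growthE:
  fixes g :: "'i \<Rightarrow> 'a::euclidean_space \<Rightarrow> 'c::real_normed_vector"
  assumes "gauss_growth a I g"
  obtains c where "0 \<le> c" "\<And>i y. i \<in> I \<Longrightarrow> norm (g i y) \<le> c * exp (a * (norm y)\<^sup>2)"
proof -
  from assms obtain c where g_le: "\<And>i y. i \<in> I \<Longrightarrow> norm (g i y) \<le> c * exp (a * (norm y)\<^sup>2)"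
    unfolding gauss_growth_def by blast
  have "norm (g i y) \<le> \<bar>c\<bar> * exp (a * (norm y)\<^sup>2)" if "i \<in> I" for i y
    by (rule order_trans[OF g_le[OF that]]) (simp add: mult_right_mono)
  thus thesis by (intro that[of "\<bar>c\<bar>"]) auto
qed

lemma gauss_growth_dominated:
  assumes "gauss_growth a I f" "\<And>i y. i \<in> I \<Longrightarrow> norm (g i y) \<le> norm (f i y)"
  shows "gauss_growth a I g"
  using assms unfolding gauss_growth_def by (meson order_trans)

lemma gauss_growth_reindex:
  assumes "gauss_growth a I f" "\<And>j. j \<in> J \<Longrightarrow> \<phi> j \<in> I"
  shows "gauss_growth a J (\<lambda>j. f (\<phi> j))"
  using assms unfolding gauss_growth_def by meson

lemma gauss_growth_add:
  assumes "gauss_growth a I f" "gauss_growth a I g"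
  shows "gauss_growth a I (\<lambda>i y. f i y + g i y)"
proof -
  obtain c where f_le: "\<And>i y. i \<in> I \<Longrightarrow> norm (f i y) \<le> c * exp (a * (norm y)\<^sup>2)"
    using assms(1) unfolding gauss_growth_def by blast
  obtain d where g_le: "\<And>i y. i \<in> I \<Longrightarrow> norm (g i y) \<le> d * exp (a * (norm y)\<^sup>2)"
    using assms(2) unfolding gauss_growth_def by blast
  show ?thesis
    by (rule gauss_growthI[where c="c + d"])
       (metis add_mono f_le g_le distrib_right norm_triangle_le)
qed

lemma gauss_growth_prod:
  assumes "gauss_growth a I f" "gauss_growth b I g"
    and norm_k_le: "\<And>i y. i \<in> I \<Longrightarrow> norm (k i y) \<le> norm (f i y) * norm (g i y)"
  shows "gauss_growth (a + b) I k"
proof -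
  obtain c where f_le: "0 \<le> c" "\<And>i y. i \<in> I \<Longrightarrow> norm (f i y) \<le> c * exp (a * (norm y)\<^sup>2)"
    using gauss_growthE[OF assms(1)] by metis
  obtain d where g_le: "\<And>i y. i \<in> I \<Longrightarrow> norm (g i y) \<le> d * exp (b * (norm y)\<^sup>2)"
    using assms(2) unfolding gauss_growth_def by blast
  show ?thesis
  proof (rule gauss_growthI)
    fix i y assume i_in: "i \<in> I"
    have "norm (k i y) \<le> norm (f i y) * norm (g i y)" by (rule norm_k_le[OF i_in])
    also have "\<dots> \<le> (c * exp (a * (norm y)\<^sup>2)) * (d * exp (b * (norm y)\<^sup>2))"
      using f_le g_le i_in by (intro mult_mono) auto
    also have "\<dots> = (c * d) * exp ((a + b) * (norm y)\<^sup>2)"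
      by (simp add: exp_add[symmetric] algebra_simps)
    finally show "norm (k i y) \<le> (c * d) * exp ((a + b) * (norm y)\<^sup>2)" .
  qed
qed

lemma gauss_growth_mult:
  fixes f g :: "'i \<Rightarrow> 'a::euclidean_space \<Rightarrow> 'c::real_normed_algebra"
  shows "gauss_growth a I f \<Longrightarrow> gauss_growth b I g \<Longrightarrow> gauss_growth (a + b) I (\<lambda>i y. f i y * g i y)"
  by (rule gauss_growth_prod) (auto simp: norm_mult_ineq)

lemma gauss_growth_cmult:
  fixes f :: "'i \<Rightarrow> 'a::euclidean_space \<Rightarrow> 'c::real_normed_algebra"
  assumes "gauss_growth a I f"
  shows "gauss_growth a I (\<lambda>i y. c * f i y)"
proof -
  have "gauss_growth 0 I (\<lambda>_ (_::'a). c)" by (rule gauss_growthI[where c="norm c"]) simp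
  from gauss_growth_mult[OF this assms] show ?thesis by simp
qed

lemma gauss_growth_tempered_prod:
  assumes "gauss_growth a I f" "tempered I g" "a < b"
    and "\<And>i y. i \<in> I \<Longrightarrow> norm (k i y) \<le> norm (f i y) * norm (g i y)"
  shows "gauss_growth b I k"
  using gauss_growth_prod[OF assms(1) _ assms(4), of "b - a"] assms(2,3) by (simp add: tempered_def)

lemma tempered_dominated:
  "tempered I f \<Longrightarrow> (\<And>i y. i \<in> I \<Longrightarrow> norm (g i y) \<le> norm (f i y)) \<Longrightarrow> tempered I g"
  unfolding tempered_def by (blast intro: gauss_growth_dominated)

lemma tempered_reindex: "tempered I f \<Longrightarrow> (\<And>j. j \<in> J \<Longrightarrow> \<phi> j \<in> I) \<Longrightarrow> tempered J (\<lambda>j. f (\<phi> j))"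
  unfolding tempered_def by (blast intro: gauss_growth_reindex)

lemma tempered_bounded:
  fixes f :: "'i \<Rightarrow> 'a::euclidean_space \<Rightarrow> 'c::real_normed_vector"
  assumes "\<And>i y. i \<in> I \<Longrightarrow> norm (f i y) \<le> c"
  shows "tempered I f"
  unfolding tempered_def
proof (intro allI impI gauss_growthI)
  fix a :: real and i and y :: 'a assume a_pos: "0 < a" and i_in: "i \<in> I"
  have "norm (f i y) \<le> c * 1" using assms[OF i_in] by simp
  also have "\<dots> \<le> c * exp (a * (norm y)\<^sup>2)"
    using a_pos order_trans[OF norm_ge_zero assms[OF i_in]] by (intro mult_left_mono) auto
  finally show "norm (f i y) \<le> c * exp (a * (norm y)\<^sup>2)" .
qed

lemma tempered_const: "tempered I (\<lambda>_ _. c)"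
  by (rule tempered_bounded[OF order_refl])

lemma tempered_norm: "tempered I f \<Longrightarrow> tempered I (\<lambda>i y. norm (f i y))"
  by (erule tempered_dominated) simp

lemma tempered_ident: "tempered I (\<lambda>_ y. y)"
  unfolding tempered_def
proof (intro allI impI gauss_growthI)
  fix a :: real and y :: 'b assume a_pos: "0 < a"
  have "2 * (sqrt a * norm y) \<le> 1 + a * (norm y)\<^sup>2"
    using sum_squares_bound[of "sqrt a * norm y" 1] a_pos by (simp add: power_mult_distrib)
  also have "\<dots> \<le> exp (a * (norm y)\<^sup>2)" by (rule exp_ge_add_one_self)
  finally show "norm y \<le> 1 / (2 * sqrt a) * exp (a * (norm y)\<^sup>2)"
    using a_pos by (simp add: field_simps)
qed

lemma tempered_add: "tempered I f \<Longrightarrow> tempered I g \<Longrightarrow> tempered I (\<lambda>i y. f i y + g i y)"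
  unfolding tempered_def by (blast intro: gauss_growth_add)

lemma tempered_diff:
  assumes "tempered I f" "tempered I g"
  shows "tempered I (\<lambda>i y. f i y - g i y)"
  using tempered_add[OF assms(1) tempered_dominated[OF assms(2), of "\<lambda>i y. - g i y"]] by simp

lemma tempered_prod:
  assumes "tempered I f" "tempered I g"
    and "\<And>i y. i \<in> I \<Longrightarrow> norm (k i y) \<le> norm (f i y) * norm (g i y)"
  shows "tempered I k"
  unfolding tempered_def
proof (intro allI impI)
  fix a :: real assume "0 < a"
  thus "gauss_growth a I k"
    using assms gauss_growth_tempered_prod[of "a / 2" I f g a k] by (simp add: tempered_def)
qed

lemma tempered_scaleR: "tempered I f \<Longrightarrow> tempered I g \<Longrightarrow> tempered I (\<lambda>i y. f i y *\<^sub>R g i y)"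
  by (rule tempered_prod[of I f g]) auto

lemma tempered_inner: "tempered I f \<Longrightarrow> tempered I g \<Longrightarrow> tempered I (\<lambda>i y. f i y \<bullet> g i y)"
  by (rule tempered_prod[of I f g]) (auto simp: Cauchy_Schwarz_ineq2)

lemma gauss_growth_integrable:
  fixes f :: "'i \<Rightarrow> 'a::euclidean_space \<Rightarrow> 'c::{banach, second_countable_topology}"
  assumes growth: "gauss_growth a I f" and a_neg: "a < 0" and i_in: "i \<in> I"
    and f_meas: "f i \<in> borel_measurable borel"
  shows "integrable lborel (f i)"
proof -
  obtain c where f_le: "0 \<le> c" "\<And>y. norm (f i y) \<le> c * exp (a * (norm y)\<^sup>2)"
    using gauss_growthE[OF growth] i_in by metis
  have "integrable lborel (\<lambda>y::'a. c * exp (- (- a) * (norm y)\<^sup>2))"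
    using a_neg by (intro integrable_mult_right integrable_exp_neg_norm_sq) simp
  thus ?thesis
    by (rule Bochner_Integration.integrable_bound) (use f_le f_meas in auto)
qed

lemma gauss_growth_bounded:
  assumes "gauss_growth a I f" "a \<le> 0"
  obtains c where "\<And>i y. i \<in> I \<Longrightarrow> norm (f i y) \<le> c"
proof -
  obtain c where f_le: "0 \<le> c" "\<And>i y. i \<in> I \<Longrightarrow> norm (f i y) \<le> c * exp (a * (norm y)\<^sup>2)"
    using gauss_growthE[OF assms(1)] by metis
  have "c * exp (a * (norm y)\<^sup>2) \<le> c * 1" for y :: 'b
    using f_le(1) assms(2) by (intro mult_left_mono) (auto intro: mult_nonpos_nonneg)
  thus thesis using f_le(2) by (intro that[of c]) (auto intro: order_trans)
qed

lemma (in finite_measure) gauss_growth_integrable_pair: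
  fixes f :: "'a \<Rightarrow> 'b::euclidean_space \<Rightarrow> 'c::{banach, second_countable_topology}"
  assumes growth: "gauss_growth a (space M) f" and a_neg: "a < 0"
    and f_meas: "case_prod f \<in> borel_measurable (M \<Otimes>\<^sub>M lborel)"
  shows "integrable (M \<Otimes>\<^sub>M lborel) (case_prod f)"
proof -
  interpret pair_sigma_finite M "lborel :: 'b measure" ..
  obtain c where f_le: "0 \<le> c" "\<And>x y. x \<in> space M \<Longrightarrow> norm (f x y) \<le> c * exp (a * (norm y)\<^sup>2)"
    using gauss_growthE[OF growth] by metis
  have "integrable lborel (\<lambda>y::'b. c * exp (- (- a) * (norm y)\<^sup>2))"
    using a_neg by (intro integrable_mult_right integrable_exp_neg_norm_sq) simp
  hence "integrable (M \<Otimes>\<^sub>M lborel) (\<lambda>(x::'a, y::'b). c * exp (a * (norm y)\<^sup>2))"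
    using f_le(1) by (intro Fubini_integrable) auto
  thus ?thesis
    by (rule Bochner_Integration.integrable_bound[OF _ f_meas])
       (use f_le in \<open>auto simp: space_pair_measure split_beta intro!: AE_I2
         intro: order_trans[OF _ abs_ge_self]\<close>)
qed

lemma (in finite_measure) gauss_growth_integrable_slice:
  fixes f :: "'a \<Rightarrow> 'b::euclidean_space \<Rightarrow> 'c::{banach, second_countable_topology}"
  assumes growth: "gauss_growth a (space M) f" and f_meas: "(\<lambda>x. f x y) \<in> borel_measurable M"
  shows "integrable M (\<lambda>x. f x y)"
proof -
  obtain c where "\<And>x. x \<in> space M \<Longrightarrow> norm (f x y) \<le> c * exp (a * (norm y)\<^sup>2)"
    using growth unfolding gauss_growth_def by fastforce
  thus ?thesis by (intro integrable_const_bound[OF _ f_meas]) auto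
qed

lemma (in finite_measure) gauss_growth_integral:
  fixes f :: "'i \<Rightarrow> 'a \<Rightarrow> 'b::euclidean_space \<Rightarrow> 'c::{banach, second_countable_topology}"
  assumes growth: "gauss_growth a (I \<times> space M) (case_prod f)"
    and f_meas: "\<And>i y. i \<in> I \<Longrightarrow> (\<lambda>x. f i x y) \<in> borel_measurable M"
  shows "gauss_growth a I (\<lambda>i y. \<integral>x. f i x y \<partial>M)"
proof -
  obtain c where f_le: "\<And>i x y. i \<in> I \<Longrightarrow> x \<in> space M \<Longrightarrow> norm (f i x y) \<le> c * exp (a * (norm y)\<^sup>2)"
    using growth unfolding gauss_growth_def by fastforce
  show ?thesis
  proof (rule gauss_growthI)
    fix i y assume i_in: "i \<in> I"
    have "norm (\<integral>x. f i x y \<partial>M) \<le> (\<integral>x. norm (f i x y) \<partial>M)" by (rule integral_norm_bound)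
    also have "\<dots> \<le> (\<integral>x. c * exp (a * (norm y)\<^sup>2) \<partial>M)"
      using f_le[OF i_in]
      by (intro integral_mono integrable_norm integrable_const_bound[OF _ f_meas[OF i_in]]) auto
    also have "\<dots> = measure M (space M) * c * exp (a * (norm y)\<^sup>2)" by simp
    finally show "norm (\<integral>x. f i x y \<partial>M) \<le> measure M (space M) * c * exp (a * (norm y)\<^sup>2)" .
  qed
qed

subsection \<open>Integration by parts against a radial field\<close>

lemma norm_dilation_ge:
  fixes y c :: "'a::euclidean_space"
  assumes "r \<in> ball 1 (1/2)"
  shows "(norm y)\<^sup>2 / 8 - (norm c)\<^sup>2 \<le> (norm (c + r *\<^sub>R (y - c)))\<^sup>2"
proof -
  have r_range: "1/2 \<le> r" "\<bar>r - 1\<bar> \<le> 1/2" using assms unfolding mem_ball dist_real_def by linarith+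
  have "r *\<^sub>R y = (c + r *\<^sub>R (y - c)) + (r - 1) *\<^sub>R c" by (simp add: algebra_simps)
  hence "(norm (r *\<^sub>R y))\<^sup>2 \<le> 2 * (norm (c + r *\<^sub>R (y - c)))\<^sup>2 + 2 * (norm ((r - 1) *\<^sub>R c))\<^sup>2"
    by (metis norm_add_power2_le)
  moreover have "(1/2 * norm y)\<^sup>2 \<le> (norm (r *\<^sub>R y))\<^sup>2"
    using r_range mult_right_mono[OF r_range(1) norm_ge_zero[of y]] by (intro power_mono) auto
  moreover have "(norm ((r - 1) *\<^sub>R c))\<^sup>2 \<le> (1/2 * norm c)\<^sup>2"
    using mult_right_mono[OF r_range(2) norm_ge_zero[of c]] by (intro power_mono) auto
  ultimately have "(norm y)\<^sup>2 / 4 \<le> 2 * (norm (c + r *\<^sub>R (y - c)))\<^sup>2 + (norm c)\<^sup>2 / 2"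
    by (simp add: power_mult_distrib power_divide)
  thus ?thesis using zero_le_power2[of "norm c"] by linarith
qed

lemma inner_dilation_dominated:
  fixes f :: "'a::euclidean_space \<Rightarrow> 'a"
  assumes a_pos: "0 < a" and f_le: "\<And>y. norm (f y) \<le> K * exp (- a * (norm y)\<^sup>2)"
  obtains w where "integrable lborel w"
    and "\<And>r y. r \<in> ball 1 (1/2) \<Longrightarrow> norm (f (c + r *\<^sub>R (y - c)) \<bullet> (y - c)) \<le> w y"
proof
  have K_nonneg: "0 \<le> K" using order_trans[OF norm_ge_zero f_le[of 0]] by simp
  define g where "g y = K * exp (a * (norm c)\<^sup>2) * exp (- (a / 8) * (norm y)\<^sup>2)" for y :: 'a
  have "gauss_growth (- (a / 8)) UNIV (\<lambda>_::unit. g)"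
    by (rule gauss_growthI[where c="K * exp (a * (norm c)\<^sup>2)"]) (simp add: g_def K_nonneg)
  hence "gauss_growth (- (a / 16)) UNIV (\<lambda>(_::unit) y. g y * norm (y - c))"
    by (rule gauss_growth_tempered_prod[OF _ tempered_diff[OF tempered_ident tempered_const]])
       (use a_pos in \<open>auto simp: abs_mult\<close>)
  thus "integrable lborel (\<lambda>y. g y * norm (y - c))"
    by (rule gauss_growth_integrable) (use a_pos in \<open>auto simp: g_def\<close>)
  fix r :: real and y assume r_in: "r \<in> ball 1 (1/2)"
  have "norm (f (c + r *\<^sub>R (y - c))) \<le> K * exp (- a * (norm (c + r *\<^sub>R (y - c)))\<^sup>2)" by (rule f_le)
  also have "\<dots> \<le> K * exp (- a * ((norm y)\<^sup>2 / 8 - (norm c)\<^sup>2))"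
    using norm_dilation_ge[OF r_in, of y c] K_nonneg a_pos by (intro mult_left_mono) auto
  also have "\<dots> = g y"
    by (simp add: g_def mult.assoc exp_add[symmetric] algebra_simps)
  finally have "norm (f (c + r *\<^sub>R (y - c))) * norm (y - c) \<le> g y * norm (y - c)"
    by (rule mult_right_mono) simp
  thus "norm (f (c + r *\<^sub>R (y - c)) \<bullet> (y - c)) \<le> g y * norm (y - c)"
    using Cauchy_Schwarz_ineq2[of "f (c + r *\<^sub>R (y - c))" "y - c"] by simp
qed

lemma GDERIV_dilation:
  fixes v :: "'a::euclidean_space \<Rightarrow> real"
  assumes "GDERIV v (c + r *\<^sub>R (y - c)) :> d"
  shows "GDERIV (\<lambda>r. v (c + r *\<^sub>R (y - c))) r :> d \<bullet> (y - c)"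
proof -
  have "((\<lambda>r. c + r *\<^sub>R (y - c)) has_derivative (\<lambda>h. h *\<^sub>R (y - c))) (at r)"
    by (rule derivative_eq_intros | simp)+
  from has_derivative_compose[OF this assms[unfolded gderiv_def]] show ?thesis
    unfolding gderiv_def by (rule has_derivative_eq_rhs) (simp add: fun_eq_iff inner_commute)
qed

text \<open>Differentiate the scaling identity for the Lebesgue integral at the ratio one.\<close>
lemma integral_radial_derivative:
  fixes v :: "'a::euclidean_space \<Rightarrow> real"
  assumes der: "\<And>y. GDERIV v y :> dv y" and v_int: "integrable lborel v"
    and a_pos: "0 < a" and dv_le: "\<And>y. norm (dv y) \<le> K * exp (- a * (norm y)\<^sup>2)"
    and dv_meas [measurable]: "dv \<in> borel_measurable borel"
  shows "(\<integral>y. dv y \<bullet> (y - c) + DIM('a) * v y \<partial>lborel) = 0"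
proof -
  obtain w where w_int: "integrable lborel w"
    and w_ge: "\<And>r y. r \<in> ball 1 (1/2) \<Longrightarrow> norm (dv (c + r *\<^sub>R (y - c)) \<bullet> (y - c)) \<le> w y"
    using inner_dilation_dominated[OF a_pos dv_le] by blast
  define S where "S r = (\<integral>y. v (c + r *\<^sub>R (y - c)) \<partial>lborel)" for r
  have dilation_eq: "c + r *\<^sub>R (y - c) = (c - r *\<^sub>R c) + r *\<^sub>R y" for r and y :: 'a
    by (simp add: algebra_simps)
  have "GDERIV S 1 :> (\<integral>y. dv (c + 1 *\<^sub>R (y - c)) \<bullet> (y - c) \<partial>lborel)"
    unfolding S_def
  proof (rule GDERIV_integral[where e="1/2" and w=w and g="\<lambda>r y. dv (c + r *\<^sub>R (y - c)) \<bullet> (y - c)"])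
    fix r :: real assume "r \<in> ball 1 (1/2)"
    hence "r \<noteq> 0" by (auto simp: dist_real_def)
    thus "integrable lborel (\<lambda>y. v (c + r *\<^sub>R (y - c)))"
      unfolding dilation_eq by (rule integrable_lborel_affine[OF v_int])
  qed (use w_int w_ge GDERIV_dilation[OF der] in auto)
  hence S_der: "(S has_real_derivative (\<integral>y. dv y \<bullet> (y - c) \<partial>lborel)) (at 1)" by simp
  have scaled_der: "((\<lambda>r. r ^ DIM('a) * S r) has_real_derivative
      (DIM('a) * S 1 + (\<integral>y. dv y \<bullet> (y - c) \<partial>lborel))) (at 1)"
    by (rule derivative_eq_intros S_der refl | simp)+
  have "\<forall>\<^sub>F r::real in nhds 1. 0 < r" by (rule order_tendstoD(1)[OF filterlim_ident]) simp
  hence scaled_eq: "\<forall>\<^sub>F r in nhds 1. r ^ DIM('a) * S r = (\<integral>y. v y \<partial>lborel)"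
  proof eventually_elim
    case (elim r)
    thus ?case
      using integral_lborel_affine[of v r "c - r *\<^sub>R c"] v_int by (simp add: S_def dilation_eq)
  qed
  have "DIM('a) * S 1 + (\<integral>y. dv y \<bullet> (y - c) \<partial>lborel) = 0"
    using scaled_der
    by (subst (asm) DERIV_cong_ev[OF refl scaled_eq refl]) (blast intro: DERIV_unique DERIV_const)
  moreover have "integrable lborel (\<lambda>y. dv y \<bullet> (y - c))"
    by (rule Bochner_Integration.integrable_bound[OF w_int])
       (use w_ge[of 1] in \<open>auto intro: order_trans[OF _ abs_ge_self]\<close>)
  ultimately show ?thesis
    using v_int by (simp add: S_def add.commute)
qed

subsection \<open>The log-Sobolev inequality implies the Poincare inequality\<close>

locale log_smooth_density =
  fixes p :: "'a::euclidean_space \<Rightarrow> real" and gp :: "'a \<Rightarrow> 'a"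
  assumes p_dens: "prob_density p"
    and p_pos: "\<And>x. 0 < p x"
    and score: "\<And>x. GDERIV (\<lambda>y. ln (p y)) x :> gp x"
begin

lemma p_measurable [measurable]: "p \<in> borel_measurable borel"
  using p_dens by (simp add: prob_density_def)

lemma integrable_p: "integrable lborel p" and integral_p: "(\<integral>y. p y \<partial>lborel) = 1"
  using p_dens by (auto simp: prob_density_def)

lemma GDERIV_p: "GDERIV p x :> p x *\<^sub>R gp x"
  using GDERIV_DERIV_compose[OF score[of x] DERIV_exp] p_pos by simp

end

locale log_smooth_density_pair = log_smooth_density p gp + q: log_smooth_density q gq
  for p q :: "'a::euclidean_space \<Rightarrow> real" and gp gq :: "'a \<Rightarrow> 'a" +
  assumes integrable_square: "integrable lborel (\<lambda>y. (q y)\<^sup>2 / p y)"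
begin

lemma has_bochner_integral_centered_square:
  "has_bochner_integral lborel (\<lambda>y. p y * (q y / p y - 1)\<^sup>2) ((\<integral>y. (q y)\<^sup>2 / p y \<partial>lborel) - 1)"
proof -
  have "has_bochner_integral lborel (\<lambda>y. (q y)\<^sup>2 / p y - 2 * q y + p y)
      ((\<integral>y. (q y)\<^sup>2 / p y \<partial>lborel) - 2 * 1 + 1)"
    using integrable_square integrable_p integral_p q.integrable_p q.integral_p
    by (intro has_bochner_integral_add has_bochner_integral_diff has_bochner_integral_mult_right)
       (simp_all add: has_bochner_integral_iff)
  moreover have "(q y)\<^sup>2 / p y - 2 * q y + p y = p y * (q y / p y - 1)\<^sup>2" for y
    using p_pos[of y] by (simp add: field_simps power2_eq_square)
  ultimately show ?thesis by simp
qed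

lemma one_le_integral_square: "1 \<le> (\<integral>y. (q y)\<^sup>2 / p y \<partial>lborel)"
proof -
  have "0 \<le> (\<integral>y. p y * (q y / p y - 1)\<^sup>2 \<partial>lborel)"
    using p_pos by (intro integral_nonneg_AE AE_I2) (simp add: less_imp_le)
  thus ?thesis using has_bochner_integral_centered_square by (simp add: has_bochner_integral_iff)
qed

definition mix :: "real \<Rightarrow> 'a \<Rightarrow> real" where
  "mix \<delta> y = (1 - \<delta>) * p y + \<delta> * q y"

definition mix_score :: "real \<Rightarrow> 'a \<Rightarrow> 'a" where
  "mix_score \<delta> y = gp y + (\<delta> * q y / mix \<delta> y) *\<^sub>R (gq y - gp y)"

lemma mix_eq: "mix \<delta> y = p y * (1 + \<delta> * (q y / p y - 1))"
  unfolding mix_def using p_pos[of y] by (simp add: field_simps)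

lemma mix_ge: "0 < \<delta> \<Longrightarrow> (1 - \<delta>) * p y \<le> mix \<delta> y"
  unfolding mix_def using q.p_pos[of y] by simp

context
  fixes \<delta> :: real
  assumes \<delta>_range: "0 < \<delta>" "\<delta> < 1"
begin

lemma mix_pos: "0 < mix \<delta> y"
  unfolding mix_def using \<delta>_range p_pos[of y] q.p_pos[of y] by (simp add: add_pos_pos)

lemma integrable_mix: "integrable lborel (mix \<delta>)" and integral_mix: "(\<integral>y. mix \<delta> y \<partial>lborel) = 1"
  unfolding mix_def[abs_def] using integrable_p q.integrable_p integral_p q.integral_p by auto

lemma prob_density_mix: "prob_density (mix \<delta>)"
  unfolding prob_density_def using integrable_mix integral_mix mix_pos
  by (auto simp: less_imp_le mix_def[abs_def])

lemma GDERIV_ln_mix: "GDERIV (\<lambda>y. ln (mix \<delta> y)) y :> mix_score \<delta> y"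
proof -
  have "GDERIV (mix \<delta>) y :> (1 - \<delta>) *\<^sub>R (p y *\<^sub>R gp y) + \<delta> *\<^sub>R (q y *\<^sub>R gq y)"
    unfolding mix_def[abs_def]
    using GDERIV_add[OF GDERIV_mult[OF GDERIV_const GDERIV_p] GDERIV_mult[OF GDERIV_const q.GDERIV_p]]
    by simp
  also have "(1 - \<delta>) *\<^sub>R (p y *\<^sub>R gp y) + \<delta> *\<^sub>R (q y *\<^sub>R gq y)
      = mix \<delta> y *\<^sub>R gp y + (\<delta> * q y) *\<^sub>R (gq y - gp y)"
    by (simp add: mix_def algebra_simps)
  also have "\<dots> = mix \<delta> y *\<^sub>R mix_score \<delta> y"
    using mix_pos[of y] by (simp add: mix_score_def scaleR_add_right)
  finally have "GDERIV (mix \<delta>) y :> mix \<delta> y *\<^sub>R mix_score \<delta> y" .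
  from GDERIV_DERIV_compose[OF this DERIV_ln[OF mix_pos]] show ?thesis
    using mix_pos[of y] by simp
qed

lemma mix_fisher_le:
  "mix \<delta> y * (norm (mix_score \<delta> y - gp y))\<^sup>2
    \<le> \<delta>\<^sup>2 / (1 - \<delta>) * ((q y)\<^sup>2 / p y * (norm (gq y - gp y))\<^sup>2)"
proof -
  have "mix \<delta> y * (norm (mix_score \<delta> y - gp y))\<^sup>2
      = (\<delta>\<^sup>2 * (q y)\<^sup>2 * (norm (gq y - gp y))\<^sup>2) * (1 / mix \<delta> y)"
    unfolding mix_score_def using mix_pos[of y]
    by (simp add: power_mult_distrib power_divide power2_eq_square)
  also have "\<dots> \<le> (\<delta>\<^sup>2 * (q y)\<^sup>2 * (norm (gq y - gp y))\<^sup>2) * (1 / ((1 - \<delta>) * p y))"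
    using \<delta>_range mix_ge[of \<delta> y] mix_pos[of y] p_pos[of y]
    by (intro mult_left_mono divide_left_mono) auto
  finally show ?thesis by (simp add: mult_ac)
qed

lemma mix_entropy_ge:
  "\<delta>\<^sup>2 / 2 * (p y * (q y / p y - 1)\<^sup>2) - \<delta> ^ 3 / 6 * (p y * (q y / p y - 1) ^ 3)
    \<le> mix \<delta> y * ln (mix \<delta> y / p y) - mix \<delta> y + p y"
proof -
  define \<psi> where "\<psi> = q y / p y - 1"
  define u where "u = 1 + \<delta> * \<psi>"
  have mix_factor: "mix \<delta> y = p y * u" by (simp add: mix_eq u_def \<psi>_def)
  hence mix_ratio: "mix \<delta> y / p y = u" using p_pos[of y] by simp
  have "0 < u" using mix_factor mix_pos[of y] p_pos[of y] by (simp add: zero_less_mult_iff)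
  from entropy_ge_cubic[OF this]
  have "p y * ((u - 1)\<^sup>2 / 2 - (u - 1) ^ 3 / 6) \<le> p y * (u * ln u - u + 1)"
    using p_pos[of y] by (intro mult_left_mono) auto
  moreover have "u - 1 = \<delta> * \<psi>" by (simp add: u_def)
  ultimately show ?thesis
    unfolding mix_ratio unfolding mix_factor \<psi>_def[symmetric]
    by (simp add: power_mult_distrib algebra_simps)
qed

end

context
  fixes C :: real
  assumes LSI: "log_sobolev C p gp" and C_nonneg: "0 \<le> C"
    and integrable_cube: "integrable lborel (\<lambda>y. (q y) ^ 3 / (p y)\<^sup>2)"
    and integrable_fisher: "integrable lborel (\<lambda>y. (q y)\<^sup>2 / p y * (norm (gq y - gp y))\<^sup>2)"
begin

lemma integrable_centered_cube: "integrable lborel (\<lambda>y. p y * (q y / p y - 1) ^ 3)"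
proof -
  have "integrable lborel (\<lambda>y. (q y) ^ 3 / (p y)\<^sup>2 - 3 * ((q y)\<^sup>2 / p y) + 3 * q y - p y)"
    by (intro Bochner_Integration.integrable_add Bochner_Integration.integrable_diff integrable_mult_right
        integrable_cube integrable_square integrable_p q.integrable_p)
  moreover have "(q y) ^ 3 / (p y)\<^sup>2 - 3 * ((q y)\<^sup>2 / p y) + 3 * q y - p y
      = p y * (q y / p y - 1) ^ 3" for y
    using p_pos[of y] by (simp add: field_simps power2_eq_square power3_eq_cube)
  ultimately show ?thesis by simp
qed

lemma integrable_mix_fisher:
  assumes \<delta>_range: "0 < \<delta>" "\<delta> < 1"
  shows "integrable lborel (\<lambda>y. mix \<delta> y * (norm (mix_score \<delta> y - gp y))\<^sup>2)"
proof (rule Bochner_Integration.integrable_bound[OF integrable_mult_right[OF integrable_fisher]])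
  have fisher_eq: "mix \<delta> y * (norm (mix_score \<delta> y - gp y))\<^sup>2
      = \<delta>\<^sup>2 * (p y / mix \<delta> y) * ((q y)\<^sup>2 / p y * (norm (gq y - gp y))\<^sup>2)" for y
    unfolding mix_score_def using mix_pos[OF \<delta>_range, of y] p_pos[of y]
    by (simp add: power_mult_distrib power_divide power2_eq_square)
  have [measurable]: "mix \<delta> \<in> borel_measurable borel"
      "(\<lambda>y. (q y)\<^sup>2 / p y * (norm (gq y - gp y))\<^sup>2) \<in> borel_measurable borel"
    using integrable_mix[OF \<delta>_range] integrable_fisher by (auto simp del: times_divide_eq_left)
  show "(\<lambda>y. mix \<delta> y * (norm (mix_score \<delta> y - gp y))\<^sup>2) \<in> borel_measurable lborel"
    unfolding fisher_eq by measurable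
  show "AE y in lborel. norm (mix \<delta> y * (norm (mix_score \<delta> y - gp y))\<^sup>2)
      \<le> norm (\<delta>\<^sup>2 / (1 - \<delta>) * ((q y)\<^sup>2 / p y * (norm (gq y - gp y))\<^sup>2))"
  proof (rule AE_I2)
    fix y
    have "0 \<le> mix \<delta> y * (norm (mix_score \<delta> y - gp y))\<^sup>2" using mix_pos[OF \<delta>_range, of y] by simp
    with mix_fisher_le[OF \<delta>_range, of y] show "norm (mix \<delta> y * (norm (mix_score \<delta> y - gp y))\<^sup>2)
        \<le> norm (\<delta>\<^sup>2 / (1 - \<delta>) * ((q y)\<^sup>2 / p y * (norm (gq y - gp y))\<^sup>2))"
      unfolding real_norm_def by linarith
  qed
qed

lemma log_sobolev_mix:
  assumes \<delta>_range: "0 < \<delta>" "\<delta> < 1"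
  shows "integrable lborel (\<lambda>y. mix \<delta> y * ln (mix \<delta> y / p y))"
    and "(\<integral>y. mix \<delta> y * ln (mix \<delta> y / p y) \<partial>lborel)
      \<le> C / 2 * (\<integral>y. mix \<delta> y * (norm (mix_score \<delta> y - gp y))\<^sup>2 \<partial>lborel)"
proof -
  have "(\<integral>\<^sup>+y. ennreal (mix \<delta> y * (norm (mix_score \<delta> y - gp y))\<^sup>2) \<partial>lborel) < \<infinity>"
    using integrable_mix_fisher[OF \<delta>_range] mix_pos[OF \<delta>_range]
    by (subst nn_integral_eq_integral) (auto simp: less_imp_le)
  thus "integrable lborel (\<lambda>y. mix \<delta> y * ln (mix \<delta> y / p y))"
    and "(\<integral>y. mix \<delta> y * ln (mix \<delta> y / p y) \<partial>lborel)
      \<le> C / 2 * (\<integral>y. mix \<delta> y * (norm (mix_score \<delta> y - gp y))\<^sup>2 \<partial>lborel)"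
    using LSI prob_density_mix[OF \<delta>_range] mix_pos[OF \<delta>_range] GDERIV_ln_mix[OF \<delta>_range]
    unfolding log_sobolev_def by blast+
qed

lemma log_sobolev_mix_second_order:
  assumes \<delta>_range: "0 < \<delta>" "\<delta> < 1"
  shows "((\<integral>y. (q y)\<^sup>2 / p y \<partial>lborel) - 1) / 2 - \<delta> * (\<integral>y. p y * (q y / p y - 1) ^ 3 \<partial>lborel) / 6
    \<le> C / 2 * (\<integral>y. (q y)\<^sup>2 / p y * (norm (gq y - gp y))\<^sup>2 \<partial>lborel) / (1 - \<delta>)"
    (is "?F / 2 - \<delta> * ?B / 6 \<le> C / 2 * ?D / (1 - \<delta>)")
proof -
  note log_sobolev = log_sobolev_mix[OF \<delta>_range]
  note square = has_bochner_integral_centered_square[unfolded has_bochner_integral_iff]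
  have "\<delta>\<^sup>2 / 2 * ?F - \<delta> ^ 3 / 6 * ?B
      = (\<integral>y. \<delta>\<^sup>2 / 2 * (p y * (q y / p y - 1)\<^sup>2) - \<delta> ^ 3 / 6 * (p y * (q y / p y - 1) ^ 3) \<partial>lborel)"
    using square integrable_centered_cube by simp
  also have "\<dots> \<le> (\<integral>y. mix \<delta> y * ln (mix \<delta> y / p y) - mix \<delta> y + p y \<partial>lborel)"
    using square integrable_centered_cube log_sobolev(1) integrable_mix[OF \<delta>_range] integrable_p
    by (intro integral_mono mix_entropy_ge[OF \<delta>_range]) auto
  also have "\<dots> = (\<integral>y. mix \<delta> y * ln (mix \<delta> y / p y) \<partial>lborel)"
    using log_sobolev(1) integrable_mix[OF \<delta>_range] integral_mix[OF \<delta>_range] integrable_p integral_p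
    by simp
  also note log_sobolev(2)
  also have "C / 2 * (\<integral>y. mix \<delta> y * (norm (mix_score \<delta> y - gp y))\<^sup>2 \<partial>lborel)
      \<le> C / 2 * (\<integral>y. \<delta>\<^sup>2 / (1 - \<delta>) * ((q y)\<^sup>2 / p y * (norm (gq y - gp y))\<^sup>2) \<partial>lborel)"
    using C_nonneg
    by (intro mult_left_mono integral_mono integrable_mix_fisher[OF \<delta>_range] mix_fisher_le[OF \<delta>_range]
      integrable_mult_right integrable_fisher) auto
  also have "\<dots> = C / 2 * (\<delta>\<^sup>2 / (1 - \<delta>) * ?D)" by (simp only: integral_mult_right_zero)
  finally have "\<delta>\<^sup>2 * (?F / 2 - \<delta> * ?B / 6) \<le> \<delta>\<^sup>2 * (C / 2 * ?D / (1 - \<delta>))"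
    by (simp add: algebra_simps power2_eq_square power3_eq_cube)
  thus ?thesis using \<delta>_range by (simp only: mult_le_cancel_left_pos zero_less_power)
qed

text \<open>The Poincare inequality is the linearisation of the log-Sobolev inequality at \<open>p\<close>, along the
  densities \<open>mix \<delta>\<close> as \<open>\<delta>\<close> tends to zero.\<close>
lemma log_sobolev_imp_poincare:
  "(\<integral>y. (q y)\<^sup>2 / p y \<partial>lborel) - 1 \<le> C * (\<integral>y. (q y)\<^sup>2 / p y * (norm (gq y - gp y))\<^sup>2 \<partial>lborel)"
    (is "?F \<le> C * ?D")
proof -
  define B where "B = (\<integral>y. p y * (q y / p y - 1) ^ 3 \<partial>lborel)"
  have "?F / 2 - 0 * B / 6 \<le> C / 2 * ?D / (1 - 0)"
  proof (rule tendsto_le)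
    show "((\<lambda>\<delta>. ?F / 2 - \<delta> * B / 6) \<longlongrightarrow> ?F / 2 - 0 * B / 6) (at_right 0)"
      by (intro tendsto_intros) auto
    show "((\<lambda>\<delta>. C / 2 * ?D / (1 - \<delta>)) \<longlongrightarrow> C / 2 * ?D / (1 - 0)) (at_right 0)"
      by (intro tendsto_intros) auto
    have "\<forall>\<^sub>F \<delta> in at_right 0. \<delta> \<in> {0<..<1::real}" by (rule eventually_at_right_real) simp
    thus "\<forall>\<^sub>F \<delta> in at_right 0. ?F / 2 - \<delta> * B / 6 \<le> C / 2 * ?D / (1 - \<delta>)"
      unfolding B_def by eventually_elim (use log_sobolev_mix_second_order in auto)
  qed simp
  thus ?thesis by simp
qed

end

end

subsection \<open>Densities with a Lipschitz score\<close>

locale lip_score = log_smooth_density p gp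
  for p :: "'a::euclidean_space \<Rightarrow> real" and gp :: "'a \<Rightarrow> 'a" +
  fixes L :: real
  assumes lip: "\<And>x y. norm (gp x - gp y) \<le> L * norm (x - y)"
    and L_pos: "0 < L"
begin

lemma gp_measurable [measurable]: "gp \<in> borel_measurable borel"
proof -
  have "L-lipschitz_on UNIV gp"
    using lip L_pos by (intro lipschitz_onI) (auto simp: dist_norm)
  hence "continuous_on UNIV gp" by (rule lipschitz_on_continuous_on)
  thus ?thesis by (rule borel_measurable_continuous_onI)
qed

lemma ln_p_diff: "\<bar>ln (p y) - ln (p x) - (y - x) \<bullet> gp x\<bar> \<le> L * (norm (y - x))\<^sup>2"
proof -
  have "\<bar>(ln (p y) - y \<bullet> gp x) - (ln (p x) - x \<bullet> gp x)\<bar> \<le> (L * norm (y - x)) * norm (y - x)"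
  proof (rule GDERIV_bounded_imp_lipschitz[where S="cball x (norm (y - x))"])
    show "GDERIV (\<lambda>u. ln (p u) - u \<bullet> gp x) u :> gp u - gp x" for u
      by (rule GDERIV_diff[OF score]) (simp add: gderiv_def has_derivative_inner_left)
    fix u assume u_in: "u \<in> cball x (norm (y - x))"
    have "norm (gp u - gp x) \<le> L * norm (u - x)" by (rule lip)
    also have "\<dots> \<le> L * norm (y - x)"
      using u_in L_pos by (simp add: dist_norm norm_minus_commute)
    finally show "norm (gp u - gp x) \<le> L * norm (y - x)" .
  qed (auto simp: dist_norm norm_minus_commute)
  thus ?thesis by (simp add: inner_diff_left power2_eq_square algebra_simps)
qed

lemma inverse_p_le: "1 / p y \<le> 1 / p x * exp (norm (gp x) * norm (y - x) + L * (norm (y - x))\<^sup>2)"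
proof -
  have "- ((y - x) \<bullet> gp x) \<le> norm (gp x) * norm (y - x)"
    using Cauchy_Schwarz_ineq2[of "y - x" "gp x"] by (simp add: mult.commute)
  hence "ln (p x) - ln (p y) \<le> norm (gp x) * norm (y - x) + L * (norm (y - x))\<^sup>2"
    using ln_p_diff[of y x] by linarith
  hence "exp (ln (p x) - ln (p y)) \<le> exp (norm (gp x) * norm (y - x) + L * (norm (y - x))\<^sup>2)" by simp
  moreover have "exp (ln (p x) - ln (p y)) = p x / p y" by (simp add: exp_diff p_pos)
  ultimately show ?thesis using p_pos[of x] p_pos[of y] by (simp add: field_simps)
qed

lemma inverse_p_growth: "gauss_growth (2 * L) I (\<lambda>_ y. 1 / p y)"
proof (rule gauss_growthI[where c="1 / p 0 * exp ((norm (gp 0))\<^sup>2 / (4 * L))"])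
  fix y :: 'a
  have "norm (gp 0) * norm y \<le> (norm (gp 0))\<^sup>2 / (4 * L) + L * (norm y)\<^sup>2"
    using zero_le_power2[of "norm (gp 0) - 2 * L * norm y"] L_pos
    by (simp add: power2_eq_square field_simps)
  hence "1 / p 0 * exp (norm (gp 0) * norm y + L * (norm y)\<^sup>2)
      \<le> 1 / p 0 * exp ((norm (gp 0))\<^sup>2 / (4 * L) + 2 * L * (norm y)\<^sup>2)"
    using p_pos[of 0] by (intro mult_left_mono) auto
  with inverse_p_le[of y 0]
  show "norm (1 / p y) \<le> 1 / p 0 * exp ((norm (gp 0))\<^sup>2 / (4 * L)) * exp (2 * L * (norm y)\<^sup>2)"
    using p_pos[of y] by (simp add: exp_add)
qed

lemma gp_tempered: "tempered I (\<lambda>_. gp)"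
proof -
  have "tempered I (\<lambda>_ y::'a. L *\<^sub>R norm y + norm (gp 0))"
    by (intro tempered_const tempered_add tempered_scaleR tempered_norm tempered_ident)
  thus ?thesis
  proof (rule tempered_dominated)
    show "norm (gp y) \<le> norm (L *\<^sub>R norm y + norm (gp 0))" for y
      using lip[of y 0] norm_triangle_ineq[of "gp y - gp 0" "gp 0"] by simp
  qed
qed

end

subsection \<open>The interpolated law\<close>

text \<open>\<open>X\<close> is the position at the start of a step and \<open>V\<close> the drift frozen there; they are bounded because
  the initial law will be truncated. For times up to \<open>T\<close> the Gaussian kernels decay fast enough to beat
  the growth of \<open>1 / p\<close> and \<open>1 / p\<^sup>2\<close>, which is at most \<open>exp (4 * L * (norm y)\<^sup>2)\<close> up to a constant.\<close>
locale lmc_interp = lip_score p gp L + prob_space M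
  for p :: "'a::euclidean_space \<Rightarrow> real" and gp L and M :: "'b measure" +
  fixes X V :: "'b \<Rightarrow> 'a" and R T :: real
  assumes X_meas [measurable]: "X \<in> borel_measurable M"
    and V_meas [measurable]: "V \<in> borel_measurable M"
    and X_bound: "\<And>x. norm (X x) \<le> R"
    and V_bound: "\<And>x. norm (V x) \<le> R"
    and T_pos: "0 < T" and L_T_le: "64 * L * T \<le> 1"
begin

sublocale pair: pair_sigma_finite M "lborel :: 'a measure" ..

definition noise :: "real \<Rightarrow> 'b \<Rightarrow> 'a \<Rightarrow> 'a" where
  "noise t x y = y - (X x + t *\<^sub>R V x)"

definition kern :: "real \<Rightarrow> 'b \<Rightarrow> 'a \<Rightarrow> real" where
  "kern t x y = gauss_density (X x + t *\<^sub>R V x) (2 * t) y"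

definition grad_kern :: "real \<Rightarrow> 'b \<Rightarrow> 'a \<Rightarrow> 'a" where
  "grad_kern t x y = - (kern t x y / (2 * t)) *\<^sub>R noise t x y"

definition dens :: "real \<Rightarrow> 'a \<Rightarrow> real" where
  "dens t y = (\<integral>x. kern t x y \<partial>M)"

definition grad_dens :: "real \<Rightarrow> 'a \<Rightarrow> 'a" where
  "grad_dens t y = (\<integral>x. grad_kern t x y \<partial>M)"

definition dens_score :: "real \<Rightarrow> 'a \<Rightarrow> 'a" where
  "dens_score t y = (1 / dens t y) *\<^sub>R grad_dens t y"

definition rel_score :: "real \<Rightarrow> 'a \<Rightarrow> 'a" where
  "rel_score t y = dens_score t y - gp y"

definition \<psi> :: "real \<Rightarrow> 'a \<Rightarrow> real" where
  "\<psi> t y = dens t y / p y"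

lemma noise_measurable [measurable (raw)]:
  assumes [measurable]: "f \<in> N \<rightarrow>\<^sub>M M" "g \<in> borel_measurable N"
  shows "(\<lambda>w. noise t (f w) (g w)) \<in> borel_measurable N"
  unfolding noise_def by measurable

lemma kern_measurable [measurable (raw)]:
  assumes [measurable]: "f \<in> N \<rightarrow>\<^sub>M M" "g \<in> borel_measurable N"
  shows "(\<lambda>w. kern t (f w) (g w)) \<in> borel_measurable N"
  unfolding kern_def by measurable

lemma grad_kern_measurable [measurable (raw)]:
  assumes [measurable]: "f \<in> N \<rightarrow>\<^sub>M M" "g \<in> borel_measurable N"
  shows "(\<lambda>w. grad_kern t (f w) (g w)) \<in> borel_measurable N"
  unfolding grad_kern_def by measurable

lemma dens_measurable [measurable]: "dens t \<in> borel_measurable borel"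
  unfolding dens_def[abs_def] by measurable

lemma rel_score_measurable [measurable]: "rel_score t \<in> borel_measurable borel"
  unfolding rel_score_def[abs_def] dens_score_def grad_dens_def by measurable

lemma \<psi>_measurable [measurable]: "\<psi> t \<in> borel_measurable borel"
  unfolding \<psi>_def[abs_def] by measurable

lemma norm_mean_le: "norm (X x + t *\<^sub>R V x) \<le> (1 + T) * R" if "\<bar>t\<bar> \<le> T"
proof -
  have "norm (t *\<^sub>R V x) \<le> T * R"
    using that V_bound[of x] T_pos unfolding norm_scaleR by (intro mult_mono) auto
  thus ?thesis
    using norm_triangle_ineq[of "X x" "t *\<^sub>R V x"] X_bound[of x] by (simp add: distrib_right)
qed

lemma noise_tempered: "tempered ({0..T} \<times> UNIV) (case_prod noise)"
proof -
  have "tempered ({0..T} \<times> UNIV) (\<lambda>i y. y - (X (snd i) + fst i *\<^sub>R V (snd i)))"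
    by (intro tempered_diff tempered_ident tempered_bounded[where c="(1 + T) * R"])
       (auto intro: norm_mean_le)
  thus ?thesis by (simp add: split_beta' noise_def[abs_def])
qed

lemma noise_tempered_slice: "t \<in> {0<..T} \<Longrightarrow> tempered A (noise t)"
  using tempered_reindex[OF noise_tempered, of A "\<lambda>x. (t, x)"] by simp

lemma kern_nonneg: "0 \<le> kern t x y"
  by (simp add: kern_def gauss_density_nonneg)

lemma kern_pos: "0 < t \<Longrightarrow> 0 < kern t x y"
  by (simp add: kern_def gauss_density_pos)

lemma kern_growth:
  assumes t0_pos: "0 < t0"
  shows "gauss_growth (- 4 * L) ({t0..T} \<times> UNIV) (case_prod kern)"
proof -
  define K where
    "K = (1 / (2 * pi * (2 * t0))) powr (real DIM('a) / 2) * exp (((1 + T) * R)\<^sup>2 / (2 * (2 * t0)))"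
  have "4 * L \<le> 1 / (4 * (2 * T))"
    using L_T_le T_pos mult_pos_pos[OF L_pos T_pos] by (simp add: field_simps)
  hence rate_le: "exp (- (norm y)\<^sup>2 / (4 * (2 * T))) \<le> exp (- 4 * L * (norm y)\<^sup>2)" for y :: 'a
    using mult_right_mono[of "4 * L" "1 / (4 * (2 * T))" "(norm y)\<^sup>2"] by simp
  have "kern t x y \<le> K * exp (- 4 * L * (norm y)\<^sup>2)" if t_in: "t \<in> {t0..T}" for t x y
  proof -
    have "norm (X x + t *\<^sub>R V x) \<le> (1 + T) * R" using t_in t0_pos by (intro norm_mean_le) auto
    hence "kern t x y \<le> K * exp (- (norm y)\<^sup>2 / (4 * (2 * T)))"
      unfolding kern_def K_def by (rule gauss_density_le) (use t_in t0_pos in auto)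
    also have "\<dots> \<le> K * exp (- 4 * L * (norm y)\<^sup>2)"
      using rate_le by (intro mult_left_mono) (simp_all add: K_def)
    finally show ?thesis .
  qed
  thus ?thesis by (intro gauss_growthI[where c=K]) (auto simp: kern_nonneg)
qed

lemma kern_growth_slice: "t \<in> {0<..T} \<Longrightarrow> gauss_growth (- 4 * L) A (kern t)"
  using gauss_growth_reindex[OF kern_growth, of t A "\<lambda>x. (t, x)"] by simp

lemma grad_kern_growth:
  assumes t_in: "t \<in> {0<..T}"
  shows "gauss_growth (- 3 * L) A (grad_kern t)"
proof -
  have "tempered A (\<lambda>x y. (1 / (2 * t)) *\<^sub>R noise t x y)"
    by (intro tempered_const tempered_scaleR noise_tempered_slice t_in)
  thus ?thesis
    by (rule gauss_growth_tempered_prod[OF kern_growth_slice[OF t_in]])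
       (use L_pos in \<open>auto simp: grad_kern_def abs_mult\<close>)
qed

lemma kern_integrable: "t \<in> {0<..T} \<Longrightarrow> integrable M (\<lambda>x. kern t x y)"
  by (rule gauss_growth_integrable_slice[OF kern_growth_slice]) auto

lemma grad_kern_integrable: "t \<in> {0<..T} \<Longrightarrow> integrable M (\<lambda>x. grad_kern t x y)"
  by (rule gauss_growth_integrable_slice[OF grad_kern_growth]) auto

lemma dens_growth: "0 < t0 \<Longrightarrow> gauss_growth (- 4 * L) {t0..T} dens"
  unfolding dens_def[abs_def]
  by (rule gauss_growth_integral[OF gauss_growth_reindex[OF kern_growth, where \<phi>="\<lambda>i. i"]]) auto

lemma dens_growth_slice: "t \<in> {0<..T} \<Longrightarrow> gauss_growth (- 4 * L) A (\<lambda>_. dens t)"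
  using gauss_growth_reindex[OF dens_growth, of t A "\<lambda>_. t"] by simp

lemma dens_pos:
  assumes t_in: "t \<in> {0<..T}"
  shows "0 < dens t y"
proof -
  have "dens t y \<noteq> 0"
  proof
    assume "dens t y = 0"
    hence "AE x in M. kern t x y = 0"
      unfolding dens_def using integral_nonneg_eq_0_iff_AE[OF kern_integrable[OF t_in]] kern_nonneg by auto
    hence "AE x in M. False"
      by eventually_elim (use t_in in \<open>simp add: kern_pos less_imp_neq[symmetric]\<close>)
    thus False by simp
  qed
  moreover have "0 \<le> dens t y" unfolding dens_def by (simp add: kern_nonneg)
  ultimately show ?thesis by simp
qed

lemma integral_dens:
  assumes t_in: "t \<in> {0<..T}"
  shows "(\<integral>y. dens t y \<partial>lborel) = 1"
proof -
  have kern_int: "integrable (M \<Otimes>\<^sub>M lborel) (case_prod (kern t))"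
    by (rule gauss_growth_integrable_pair[OF kern_growth_slice[OF t_in]])
       (use L_pos in \<open>auto simp: split_beta\<close>)
  have "(\<integral>y. kern t x y \<partial>lborel) = 1" for x
    unfolding kern_def using t_in by (intro integral_gauss_density) simp
  thus ?thesis
    unfolding dens_def using pair.integral_fst[OF kern_int] pair.integral_snd[OF kern_int]
    by (simp add: prob_space)
qed

lemma integrable_dens: "t \<in> {0<..T} \<Longrightarrow> integrable lborel (dens t)"
  by (rule gauss_growth_integrable[OF dens_growth_slice, where I="UNIV :: unit set"]) (use L_pos in auto)

lemma GDERIV_kern: "GDERIV (kern t x) y :> grad_kern t x y"
  unfolding kern_def[abs_def] grad_kern_def kern_def noise_def by (rule GDERIV_gauss_density)

lemma GDERIV_dens:
  assumes t_in: "t \<in> {0<..T}"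
  shows "GDERIV (dens t) y :> grad_dens t y"
proof -
  obtain c where grad_kern_le: "\<And>x y. norm (grad_kern t x y) \<le> c"
    using gauss_growth_bounded[OF grad_kern_growth[OF t_in, of UNIV]] L_pos by auto
  show ?thesis
    unfolding dens_def[abs_def] grad_dens_def
    by (rule GDERIV_integral[where e=1 and w="\<lambda>_. c"])
       (use grad_kern_le GDERIV_kern kern_integrable[OF t_in] in auto)
qed

lemma log_smooth_density_dens:
  assumes t_in: "t \<in> {0<..T}"
  shows "log_smooth_density (dens t) (dens_score t)"
proof
  show "prob_density (dens t)"
    using integrable_dens[OF t_in] integral_dens[OF t_in] dens_pos[OF t_in]
    by (auto simp: prob_density_def less_imp_le)
  show "GDERIV (\<lambda>y. ln (dens t y)) x :> dens_score t x" for x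
    using GDERIV_DERIV_compose[OF GDERIV_dens[OF t_in] DERIV_ln[OF dens_pos[OF t_in]]]
    by (simp add: dens_score_def inverse_eq_divide)
qed (rule dens_pos[OF t_in])

lemma norm_grad_dens_le:
  assumes t_in: "t \<in> {0<..T}"
  shows "norm (grad_dens t y) \<le> (norm y + (1 + T) * R) / (2 * t) * dens t y"
proof -
  have "norm (grad_dens t y) \<le> (\<integral>x. norm (grad_kern t x y) \<partial>M)"
    unfolding grad_dens_def by (rule integral_norm_bound)
  also have "\<dots> \<le> (\<integral>x. (norm y + (1 + T) * R) / (2 * t) * kern t x y \<partial>M)"
  proof (rule integral_mono)
    fix x
    have "norm (noise t x y) \<le> norm y + (1 + T) * R"
      unfolding noise_def using norm_triangle_ineq4[of y "X x + t *\<^sub>R V x"] norm_mean_le[of t x] t_in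
      by simp
    from mult_left_mono[OF this, of "kern t x y / (2 * t)"] t_in kern_nonneg[of t x y]
    show "norm (grad_kern t x y) \<le> (norm y + (1 + T) * R) / (2 * t) * kern t x y"
      by (simp add: grad_kern_def mult.commute)
  qed (use t_in grad_kern_integrable kern_integrable in auto)
  also have "\<dots> = (norm y + (1 + T) * R) / (2 * t) * dens t y"
    unfolding dens_def using kern_integrable[OF t_in] by simp
  finally show ?thesis .
qed

lemma rel_score_tempered:
  assumes t_in: "t \<in> {0<..T}"
  shows "tempered A (\<lambda>_. rel_score t)"
proof -
  have "tempered A (\<lambda>_ (y::'a). (1 / (2 * t)) *\<^sub>R (norm y + (1 + T) * R))"
    by (intro tempered_const tempered_scaleR tempered_add tempered_norm tempered_ident)
  hence "tempered A (\<lambda>_. dens_score t)"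
  proof (rule tempered_dominated)
    fix y
    have "norm (dens_score t y) = norm (grad_dens t y) / dens t y"
      using dens_pos[OF t_in, of y] by (simp add: dens_score_def divide_inverse)
    also have "\<dots> \<le> (norm y + (1 + T) * R) / (2 * t)"
      using norm_grad_dens_le[OF t_in, of y] dens_pos[OF t_in, of y] by (simp add: pos_divide_le_eq)
    also have "\<dots> = (1 / (2 * t)) *\<^sub>R (norm y + (1 + T) * R)" by simp
    finally show "norm (dens_score t y) \<le> norm ((1 / (2 * t)) *\<^sub>R (norm y + (1 + T) * R))"
      unfolding real_norm_def by (rule order_trans[OF _ abs_ge_self])
  qed
  thus ?thesis unfolding rel_score_def[abs_def] by (intro tempered_diff gp_tempered)
qed

lemma \<psi>_pos: "t \<in> {0<..T} \<Longrightarrow> 0 < \<psi> t y"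
  using dens_pos p_pos by (simp add: \<psi>_def)

lemma \<psi>_growth: "t \<in> {0<..T} \<Longrightarrow> gauss_growth (- 2 * L) A (\<lambda>_. \<psi> t)"
  using gauss_growth_mult[OF dens_growth_slice inverse_p_growth, where I=A] by (simp add: \<psi>_def[abs_def])

lemma GDERIV_\<psi>:
  assumes t_in: "t \<in> {0<..T}"
  shows "GDERIV (\<psi> t) y :> \<psi> t y *\<^sub>R rel_score t y"
proof -
  interpret dens: log_smooth_density "dens t" "dens_score t" by (rule log_smooth_density_dens[OF t_in])
  have "exp (ln (dens t y) - ln (p y)) = \<psi> t y" for y
    by (simp add: exp_diff dens.p_pos p_pos \<psi>_def)
  with GDERIV_DERIV_compose[OF GDERIV_diff[OF dens.score score] DERIV_exp, of y] show ?thesis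
    by (simp add: rel_score_def)
qed

subsection \<open>Expectations weighted by the density ratio\<close>

definition weight :: "real \<Rightarrow> 'b \<Rightarrow> 'a \<Rightarrow> real" where
  "weight t x y = \<psi> t y * kern t x y"

lemma weight_measurable [measurable (raw)]:
  assumes [measurable]: "f \<in> N \<rightarrow>\<^sub>M M" "g \<in> borel_measurable N"
  shows "(\<lambda>w. weight t (f w) (g w)) \<in> borel_measurable N"
  unfolding weight_def by measurable

lemma weight_nonneg: "t \<in> {0<..T} \<Longrightarrow> 0 \<le> weight t x y"
  unfolding weight_def using \<psi>_pos kern_nonneg by (simp add: less_imp_le)

lemma weight_growth: "t \<in> {0<..T} \<Longrightarrow> gauss_growth (- 6 * L) A (weight t)"
  using gauss_growth_mult[OF \<psi>_growth kern_growth_slice, where I=A] by (simp add: weight_def[abs_def])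

lemma GDERIV_weight:
  assumes t_in: "t \<in> {0<..T}"
  shows "GDERIV (weight t x) y :> weight t x y *\<^sub>R (rel_score t y - (1 / (2 * t)) *\<^sub>R noise t x y)"
  using GDERIV_mult[OF GDERIV_\<psi>[OF t_in] GDERIV_kern]
  by (simp add: weight_def[abs_def] grad_kern_def algebra_simps)

lemma weight_by_parts:
  assumes t_in: "t \<in> {0<..T}"
  shows "(\<integral>y. weight t x y
    * (rel_score t y \<bullet> (y - c) - (1 / (2 * t)) * (noise t x y \<bullet> (y - c)) + DIM('a)) \<partial>lborel) = 0"
proof -
  define dw where "dw y = weight t x y *\<^sub>R (rel_score t y - (1 / (2 * t)) *\<^sub>R noise t x y)" for y
  have [measurable]: "weight t x \<in> borel_measurable borel" "noise t x \<in> borel_measurable borel"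
    unfolding weight_def[abs_def] kern_def[abs_def] noise_def[abs_def] by measurable
  have "tempered UNIV (\<lambda>x y. rel_score t y - (1 / (2 * t)) *\<^sub>R noise t x y)"
    by (intro tempered_const tempered_diff tempered_scaleR rel_score_tempered noise_tempered_slice t_in)
  hence "gauss_growth (- 5 * L) UNIV
      (\<lambda>x y. weight t x y *\<^sub>R (rel_score t y - (1 / (2 * t)) *\<^sub>R noise t x y))"
    by (rule gauss_growth_tempered_prod[OF weight_growth[OF t_in]]) (use L_pos in auto)
  then obtain K where dw_le: "\<And>y. norm (dw y) \<le> K * exp (- 5 * L * (norm y)\<^sup>2)"
    unfolding gauss_growth_def dw_def by blast
  have "(\<integral>y. dw y \<bullet> (y - c) + DIM('a) * weight t x y \<partial>lborel) = 0"
  proof (rule integral_radial_derivative[where a="5 * L" and K=K])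
    show "GDERIV (weight t x) y :> dw y" for y unfolding dw_def by (rule GDERIV_weight[OF t_in])
    show "integrable lborel (weight t x)"
      by (rule gauss_growth_integrable[OF weight_growth[OF t_in, of UNIV]]) (use L_pos in auto)
    show "dw \<in> borel_measurable borel" unfolding dw_def[abs_def] by measurable
  qed (use L_pos dw_le in auto)
  thus ?thesis
    by (simp add: dw_def inner_diff_left distrib_left right_diff_distrib mult.commute[of "real DIM('a)"])
qed

definition observable :: "('b \<Rightarrow> 'a \<Rightarrow> 'c::real_normed_vector) \<Rightarrow> bool" where
  "observable f \<longleftrightarrow> case_prod f \<in> borel_measurable (M \<Otimes>\<^sub>M lborel) \<and> tempered UNIV f"

lemma observable_add:
  fixes f g :: "'b \<Rightarrow> 'a \<Rightarrow> 'c::{second_countable_topology, real_normed_vector}"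
  shows "observable f \<Longrightarrow> observable g \<Longrightarrow> observable (\<lambda>x y. f x y + g x y)"
  unfolding observable_def by (auto intro: tempered_add simp: split_beta')

lemma observable_diff:
  fixes f g :: "'b \<Rightarrow> 'a \<Rightarrow> 'c::{second_countable_topology, real_normed_vector}"
  shows "observable f \<Longrightarrow> observable g \<Longrightarrow> observable (\<lambda>x y. f x y - g x y)"
  unfolding observable_def by (auto intro: tempered_diff simp: split_beta')

lemma observable_scaleR:
  fixes g :: "'b \<Rightarrow> 'a \<Rightarrow> 'c::{second_countable_topology, real_normed_vector}"
  shows "observable f \<Longrightarrow> observable g \<Longrightarrow> observable (\<lambda>x y. f x y *\<^sub>R g x y)"
  unfolding observable_def by (auto intro: tempered_scaleR simp: split_beta')

lemma observable_mult:
  fixes f g :: "'b \<Rightarrow> 'a \<Rightarrow> real"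
  shows "observable f \<Longrightarrow> observable g \<Longrightarrow> observable (\<lambda>x y. f x y * g x y)"
  using observable_scaleR[of f g] by simp

lemma observable_inner:
  fixes f g :: "'b \<Rightarrow> 'a \<Rightarrow> 'c::{second_countable_topology, real_inner}"
  shows "observable f \<Longrightarrow> observable g \<Longrightarrow> observable (\<lambda>x y. f x y \<bullet> g x y)"
  unfolding observable_def by (auto intro: tempered_inner simp: split_beta')

lemma observable_norm_sq:
  fixes f :: "'b \<Rightarrow> 'a \<Rightarrow> 'c::{second_countable_topology, real_inner}"
  shows "observable f \<Longrightarrow> observable (\<lambda>x y. (norm (f x y))\<^sup>2)"
  unfolding power2_norm_eq_inner by (rule observable_inner)

lemma observable_fst:
  assumes "f \<in> borel_measurable M" "\<And>x. norm (f x) \<le> c"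
  shows "observable (\<lambda>x _. f x)"
  using assms unfolding observable_def by (auto intro: tempered_bounded)

lemma observable_const: "observable (\<lambda>_ _. c)"
  by (rule observable_fst[where c="norm c"]) auto

lemma observable_ident: "observable (\<lambda>_ y. y)"
  unfolding observable_def using tempered_ident by auto

lemma observable_gp: "observable (\<lambda>_ y. gp y)"
  unfolding observable_def using gp_tempered by (simp add: split_beta')

lemma observable_rel_score: "t \<in> {0<..T} \<Longrightarrow> observable (\<lambda>_ y. rel_score t y)"
  unfolding observable_def using rel_score_tempered by (simp add: split_beta')

lemmas observable_X = observable_fst[OF X_meas X_bound]
lemmas observable_V = observable_fst[OF V_meas V_bound]

lemma observable_noise: "observable (\<lambda>x y. noise t x y)"
  unfolding noise_def
  by (intro observable_diff observable_add observable_scaleR observable_const observable_X observable_V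
      observable_ident)

lemmas observable_intros = observable_const observable_X observable_V observable_ident observable_gp
  observable_rel_score observable_noise observable_norm_sq observable_inner observable_add observable_diff
  observable_mult observable_scaleR

definition wexp :: "real \<Rightarrow> ('b \<Rightarrow> 'a \<Rightarrow> real) \<Rightarrow> real" where
  "wexp t f = (\<integral>(x, y). weight t x y * f x y \<partial>(M \<Otimes>\<^sub>M lborel))"

context
  fixes t :: real
  assumes t_in: "t \<in> {0<..T}"
begin

lemma integrable_weight:
  assumes f_obs: "observable f"
  shows "integrable (M \<Otimes>\<^sub>M lborel) (\<lambda>(x, y). weight t x y * f x y)"
proof -
  have [measurable]: "case_prod f \<in> borel_measurable (M \<Otimes>\<^sub>M lborel)" and "tempered UNIV f"
    using f_obs by (auto simp: observable_def)
  hence "gauss_growth (- 5 * L) (space M) (\<lambda>x y. weight t x y * f x y)"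
    using L_pos tempered_reindex[of UNIV f "space M" "\<lambda>x. x"]
    by (intro gauss_growth_tempered_prod[OF weight_growth[OF t_in], of _ f]) (auto simp: abs_mult)
  thus ?thesis
    by (rule gauss_growth_integrable_pair) (use L_pos in \<open>auto simp: split_beta'\<close>)
qed

lemma wexp_fst: "observable f \<Longrightarrow> wexp t f = (\<integral>x. \<integral>y. weight t x y * f x y \<partial>lborel \<partial>M)"
  unfolding wexp_def by (rule pair.integral_fst[symmetric, OF integrable_weight])

lemma wexp_snd: "observable f \<Longrightarrow> wexp t f = (\<integral>y. \<integral>x. weight t x y * f x y \<partial>M \<partial>lborel)"
  unfolding wexp_def by (rule pair.integral_snd[symmetric, OF integrable_weight])

lemma wexp_add: "observable f \<Longrightarrow> observable g \<Longrightarrow> wexp t (\<lambda>x y. f x y + g x y) = wexp t f + wexp t g"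
  using Bochner_Integration.integral_add[OF integrable_weight[of f] integrable_weight[of g]]
  by (simp add: wexp_def case_prod_beta' distrib_left)

lemma wexp_diff: "observable f \<Longrightarrow> observable g \<Longrightarrow> wexp t (\<lambda>x y. f x y - g x y) = wexp t f - wexp t g"
  using Bochner_Integration.integral_diff[OF integrable_weight[of f] integrable_weight[of g]]
  by (simp add: wexp_def case_prod_beta' right_diff_distrib)

lemma wexp_cmult: "wexp t (\<lambda>x y. c * f x y) = c * wexp t f"
  unfolding wexp_def integral_mult_right_zero[symmetric]
  by (rule Bochner_Integration.integral_cong) auto

lemma wexp_mono:
  assumes "observable f" "observable g" "\<And>x y. f x y \<le> g x y"
  shows "wexp t f \<le> wexp t g"
  unfolding wexp_def
  by (rule integral_mono[OF integrable_weight integrable_weight])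
     (use assms weight_nonneg[OF t_in] in \<open>auto intro!: mult_left_mono\<close>)

lemma wexp_snd_only:
  assumes "observable (\<lambda>_ y. f y)"
  shows "wexp t (\<lambda>_ y. f y) = (\<integral>y. (dens t y)\<^sup>2 / p y * f y \<partial>lborel)"
proof -
  have "(\<integral>x. weight t x y * f y \<partial>M) = (dens t y)\<^sup>2 / p y * f y" for y
    unfolding weight_def by (simp add: \<psi>_def dens_def power2_eq_square)
  thus ?thesis by (simp add: wexp_snd[OF assms])
qed

lemma wexp_by_parts:
  assumes c_obs: "observable (\<lambda>x _. c x)"
  shows "wexp t (\<lambda>x y. rel_score t y \<bullet> (y - c x))
    = wexp t (\<lambda>x y. (1 / (2 * t)) * (noise t x y \<bullet> (y - c x)) - DIM('a))"
proof -
  have "wexp t (\<lambda>x y. rel_score t y \<bullet> (y - c x))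
        - wexp t (\<lambda>x y. (1 / (2 * t)) * (noise t x y \<bullet> (y - c x)) - DIM('a))
      = wexp t (\<lambda>x y. rel_score t y \<bullet> (y - c x) - ((1 / (2 * t)) * (noise t x y \<bullet> (y - c x)) - DIM('a)))"
    by (rule wexp_diff[symmetric]) (intro observable_intros t_in c_obs)+
  also have "\<dots> = (\<integral>x. \<integral>y. weight t x y
      * (rel_score t y \<bullet> (y - c x) - ((1 / (2 * t)) * (noise t x y \<bullet> (y - c x)) - DIM('a))) \<partial>lborel \<partial>M)"
    by (rule wexp_fst) (intro observable_intros t_in c_obs)
  also have "\<dots> = 0"
    using weight_by_parts[OF t_in] by (simp add: diff_diff_eq2 diff_add_eq)
  finally show ?thesis by simp
qed

text \<open>Tweedie's formula: given the current position, \<open>noise\<close> has mean \<open>- 2 * t\<close> times the score of the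
  current law, and that score is \<open>gp + rel_score\<close>.\<close>
lemma wexp_tweedie:
  assumes \<phi>_obs: "observable (\<lambda>_ y. \<phi> y)"
  shows "wexp t (\<lambda>x y. \<phi> y \<bullet> ((1 / (2 * t)) *\<^sub>R noise t x y + (gp y + rel_score t y))) = 0"
proof -
  have "(\<integral>x. weight t x y * (\<phi> y \<bullet> ((1 / (2 * t)) *\<^sub>R noise t x y + (gp y + rel_score t y))) \<partial>M) = 0" for y
  proof -
    have "(\<integral>x. kern t x y *\<^sub>R dens_score t y - grad_kern t x y \<partial>M)
        = dens t y *\<^sub>R dens_score t y - grad_dens t y"
      using kern_integrable[OF t_in] grad_kern_integrable[OF t_in]
      by (simp add: dens_def grad_dens_def)
    hence mean_zero: "(\<integral>x. kern t x y *\<^sub>R dens_score t y - grad_kern t x y \<partial>M) = 0"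
      using dens_pos[OF t_in, of y] by (simp add: dens_score_def)
    have "(\<integral>x. weight t x y * (\<phi> y \<bullet> ((1 / (2 * t)) *\<^sub>R noise t x y + (gp y + rel_score t y))) \<partial>M)
        = (\<integral>x. \<psi> t y * (\<phi> y \<bullet> (kern t x y *\<^sub>R dens_score t y - grad_kern t x y)) \<partial>M)"
      by (simp add: weight_def grad_kern_def rel_score_def inner_add_right algebra_simps)
    also have "\<dots> = \<psi> t y * (\<phi> y \<bullet> (\<integral>x. kern t x y *\<^sub>R dens_score t y - grad_kern t x y \<partial>M))"
      using kern_integrable[OF t_in] grad_kern_integrable[OF t_in] by simp
    finally show ?thesis by (simp add: mean_zero)
  qed
  moreover have "observable (\<lambda>x y. \<phi> y \<bullet> ((1 / (2 * t)) *\<^sub>R noise t x y + (gp y + rel_score t y)))"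
    by (intro observable_intros t_in \<phi>_obs)
  ultimately show ?thesis by (simp add: wexp_snd)
qed

end

subsection \<open>Energy and dissipation\<close>

definition energy :: "real \<Rightarrow> real" where
  "energy t = (\<integral>y. (dens t y)\<^sup>2 / p y \<partial>lborel)"

definition dissipation :: "real \<Rightarrow> real" where
  "dissipation t = wexp t (\<lambda>_ y. (norm (rel_score t y))\<^sup>2)"

lemma dens_square_growth: "0 < t0 \<Longrightarrow> gauss_growth (- 6 * L) {t0..T} (\<lambda>t y. (dens t y)\<^sup>2 / p y)"
  using gauss_growth_mult[OF gauss_growth_mult[OF dens_growth dens_growth] inverse_p_growth]
  by (simp add: power2_eq_square)

lemma integrable_dens_square: "t \<in> {0<..T} \<Longrightarrow> integrable lborel (\<lambda>y. (dens t y)\<^sup>2 / p y)"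
  by (rule gauss_growth_integrable[OF dens_square_growth, of t]) (use L_pos in auto)

lemma log_smooth_density_pair_dens:
  assumes t_in: "t \<in> {0<..T}"
  shows "log_smooth_density_pair p (dens t) gp (dens_score t)"
  by (intro log_smooth_density_pair.intro log_smooth_density_axioms log_smooth_density_dens[OF t_in]
      log_smooth_density_pair_axioms.intro integrable_dens_square[OF t_in])

lemma one_le_energy: "t \<in> {0<..T} \<Longrightarrow> 1 \<le> energy t"
  unfolding energy_def
  by (rule log_smooth_density_pair.one_le_integral_square[OF log_smooth_density_pair_dens])

context
  fixes t :: real
  assumes t_in: "t \<in> {0<..T}"
begin

lemma energy_eq_wexp: "energy t = wexp t (\<lambda>_ _. 1)"
  using wexp_snd_only[OF t_in observable_const[of 1]] by (simp add: energy_def)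

lemma dissipation_eq_integral:
  "dissipation t = (\<integral>y. (dens t y)\<^sup>2 / p y * (norm (dens_score t y - gp y))\<^sup>2 \<partial>lborel)"
  unfolding dissipation_def rel_score_def[symmetric]
  by (rule wexp_snd_only[OF t_in]) (intro observable_intros t_in)

lemma dissipation_nonneg: "0 \<le> dissipation t"
  unfolding dissipation_def wexp_def
  using weight_nonneg[OF t_in] by (intro integral_nonneg_AE AE_I2) auto

lemma poincare:
  assumes "log_sobolev C p gp" "0 \<le> C"
  shows "energy t - 1 \<le> C * dissipation t"
  unfolding energy_def dissipation_eq_integral
proof (rule log_smooth_density_pair.log_sobolev_imp_poincare[
    OF log_smooth_density_pair_dens[OF t_in] assms])
  have "gauss_growth (- 8 * L) UNIV (\<lambda>(_::unit) y. (dens t y) ^ 3 / (p y)\<^sup>2)"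
    using gauss_growth_mult[OF gauss_growth_mult[OF
        gauss_growth_mult[OF dens_growth_slice[OF t_in] dens_growth_slice[OF t_in]]
        dens_growth_slice[OF t_in]]
      gauss_growth_mult[OF inverse_p_growth inverse_p_growth], where I="UNIV :: unit set"]
    by (simp add: power2_eq_square power3_eq_cube)
  thus "integrable lborel (\<lambda>y. (dens t y) ^ 3 / (p y)\<^sup>2)"
    by (rule gauss_growth_integrable) (use L_pos in auto)
  have "gauss_growth (- 5 * L) {t..T} (\<lambda>u y. (dens u y)\<^sup>2 / p y * (norm (rel_score t y))\<^sup>2)"
    unfolding power2_norm_eq_inner
    using t_in L_pos by (intro gauss_growth_tempered_prod[OF dens_square_growth
      tempered_inner[OF rel_score_tempered[OF t_in] rel_score_tempered[OF t_in]]]) (auto simp: abs_mult)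
  hence "integrable lborel (\<lambda>y. (dens t y)\<^sup>2 / p y * (norm (rel_score t y))\<^sup>2)"
    by (rule gauss_growth_integrable) (use L_pos t_in in auto)
  thus "integrable lborel (\<lambda>y. (dens t y)\<^sup>2 / p y * (norm (dens_score t y - gp y))\<^sup>2)"
    by (simp add: rel_score_def)
qed

end

subsection \<open>The time derivative of the energy\<close>

definition kern_dt :: "real \<Rightarrow> 'b \<Rightarrow> 'a \<Rightarrow> real" where
  "kern_dt t x y = kern t x y / (2 * t) * ((noise t x y \<bullet> (y - (X x - t *\<^sub>R V x))) / (2 * t) - DIM('a))"

definition dens_dt :: "real \<Rightarrow> 'a \<Rightarrow> real" where
  "dens_dt t y = (\<integral>x. kern_dt t x y \<partial>M)"

lemma kern_dt_measurable [measurable (raw)]: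
  assumes [measurable]: "f \<in> N \<rightarrow>\<^sub>M M" "g \<in> borel_measurable N"
  shows "(\<lambda>w. kern_dt t (f w) (g w)) \<in> borel_measurable N"
  unfolding kern_dt_def by measurable

lemma dens_dt_measurable [measurable]: "dens_dt t \<in> borel_measurable borel"
  unfolding dens_dt_def[abs_def] by measurable

lemma DERIV_kern: "0 < t \<Longrightarrow> ((\<lambda>t. kern t x y) has_real_derivative kern_dt t x y) (at t)"
  unfolding kern_def kern_dt_def noise_def by (rule DERIV_gauss_density_path)

lemma kern_dt_growth:
  assumes t0_pos: "0 < t0"
  shows "gauss_growth (- 3 * L) ({t0..T} \<times> UNIV) (case_prod kern_dt)"
proof -
  let ?I = "{t0..T} \<times> (UNIV :: 'b set)"
  have rate_tempered: "tempered ?I (\<lambda>i (_::'a). 1 / (2 * fst i))"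
    by (rule tempered_bounded[where c="1 / (2 * t0)"]) (use t0_pos in \<open>auto simp: field_simps\<close>)
  have "norm (X x - t *\<^sub>R V x) \<le> (1 + T) * R" if "t \<in> {t0..T}" for t x
    using norm_mean_le[of "- t" x] that t0_pos by simp
  hence backward_tempered: "tempered ?I (\<lambda>i y. y - (X (snd i) - fst i *\<^sub>R V (snd i)))"
    by (intro tempered_diff tempered_ident tempered_bounded[where c="(1 + T) * R"]) auto
  have "tempered ?I (\<lambda>i y. case_prod noise i y)"
    using tempered_reindex[OF noise_tempered, of ?I "\<lambda>i. i"] t0_pos by auto
  hence "tempered ?I (\<lambda>i y. (1 / (2 * fst i)) *\<^sub>R
      ((1 / (2 * fst i)) *\<^sub>R (case_prod noise i y \<bullet> (y - (X (snd i) - fst i *\<^sub>R V (snd i))))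
        - real DIM('a)))"
    by (intro tempered_const tempered_scaleR tempered_diff tempered_inner rate_tempered backward_tempered)
  thus ?thesis
    by (rule gauss_growth_tempered_prod[OF kern_growth[OF t0_pos]])
       (use L_pos in \<open>auto simp: kern_dt_def abs_mult\<close>)
qed

lemma dens_dt_growth: "0 < t0 \<Longrightarrow> gauss_growth (- 3 * L) {t0..T} dens_dt"
  unfolding dens_dt_def[abs_def]
  by (rule gauss_growth_integral[OF gauss_growth_reindex[OF kern_dt_growth, where \<phi>="\<lambda>i. i"]]) auto

lemma interior_timeE:
  assumes "t \<in> {0<..<T}"
  obtains t0 e where "0 < t0" "0 < e" "ball t e \<subseteq> {t0..T}" "ball t e \<subseteq> {0<..<T}"
proof
  show "ball t (min (t / 2) (T - t)) \<subseteq> {t / 2..T}" "ball t (min (t / 2) (T - t)) \<subseteq> {0<..<T}"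
    by (auto simp: dist_real_def abs_if split: if_splits)
qed (use assms in auto)

lemma DERIV_dens:
  assumes t_in: "t \<in> {0<..<T}"
  shows "((\<lambda>u. dens u y) has_real_derivative dens_dt t y) (at t)"
proof -
  obtain t0 e where t0_pos: "0 < t0" and e_pos: "0 < e"
    and ball_subset: "ball t e \<subseteq> {t0..T}" "ball t e \<subseteq> {0<..<T}"
    using interior_timeE[OF t_in] by blast
  obtain c where kern_dt_le: "\<And>i y. i \<in> {t0..T} \<times> UNIV \<Longrightarrow> norm (case_prod kern_dt i y) \<le> c"
    using gauss_growth_bounded[OF kern_dt_growth[OF t0_pos]] L_pos by auto
  have "GDERIV (\<lambda>u. \<integral>x. kern u x y \<partial>M) t :> (\<integral>x. kern_dt t x y \<partial>M)"
  proof (rule GDERIV_integral[where w="\<lambda>_. c", OF e_pos])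
    fix u assume u_in: "u \<in> ball t e"
    show "integrable M (\<lambda>x. kern u x y)"
      using u_in ball_subset by (intro kern_integrable) auto
    show "GDERIV (\<lambda>u. kern u x y) u :> kern_dt u x y" for x
      using u_in ball_subset DERIV_kern[of u x y] by auto
    show "norm (kern_dt u x y) \<le> c" for x
      using u_in ball_subset kern_dt_le[of "(u, x)" y] by auto
  qed auto
  thus ?thesis by (simp add: dens_def dens_dt_def)
qed

lemma DERIV_energy_integral:
  assumes t_in: "t \<in> {0<..<T}"
  shows "(energy has_real_derivative (\<integral>y. 2 * (\<psi> t y * dens_dt t y) \<partial>lborel)) (at t)"
proof -
  obtain t0 e where t0_pos: "0 < t0" and e_pos: "0 < e"
    and ball_subset: "ball t e \<subseteq> {t0..T}" "ball t e \<subseteq> {0<..<T}"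
    using interior_timeE[OF t_in] by blast
  have "gauss_growth (- (5 * L)) {t0..T} (\<lambda>u y. 2 * (\<psi> u y * dens_dt u y))"
    using gauss_growth_cmult[OF gauss_growth_mult[OF gauss_growth_mult[OF
      dens_growth[OF t0_pos] dens_dt_growth[OF t0_pos]] inverse_p_growth], of 2] by (simp add: \<psi>_def)
  from gauss_growthE[OF this] obtain b where integrand_le: "0 \<le> b" "\<And>u y. u \<in> {t0..T} \<Longrightarrow>
      norm (2 * (\<psi> u y * dens_dt u y)) \<le> b * exp (- (5 * L) * (norm y)\<^sup>2)"
    by metis
  have "GDERIV (\<lambda>u. \<integral>y. (dens u y)\<^sup>2 / p y \<partial>lborel) t :> (\<integral>y. 2 * (\<psi> t y * dens_dt t y) \<partial>lborel)"
  proof (rule GDERIV_integral[where w="\<lambda>y. b * exp (- (5 * L) * (norm y)\<^sup>2)", OF e_pos])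
    fix u assume u_in: "u \<in> ball t e"
    show "integrable lborel (\<lambda>y. (dens u y)\<^sup>2 / p y)"
      using u_in ball_subset by (intro integrable_dens_square) auto
    fix y :: 'a
    have "((\<lambda>u. (dens u y)\<^sup>2 / p y) has_real_derivative 2 * (\<psi> u y * dens_dt u y)) (at u)"
      using u_in ball_subset DERIV_dens[of u y] p_pos[of y]
      by (auto intro!: derivative_eq_intros simp: \<psi>_def)
    thus "GDERIV (\<lambda>u. (dens u y)\<^sup>2 / p y) u :> 2 * (\<psi> u y * dens_dt u y)" by simp
    show "norm (2 * (\<psi> u y * dens_dt u y)) \<le> b * exp (- (5 * L) * (norm y)\<^sup>2)"
      using u_in ball_subset by (intro integrand_le(2)) auto
  next
    show "integrable lborel (\<lambda>y::'a. b * exp (- (5 * L) * (norm y)\<^sup>2))"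
      using L_pos by (intro integrable_mult_right integrable_exp_neg_norm_sq) simp
  qed auto
  thus ?thesis by (simp add: energy_def[abs_def])
qed

lemma integral_\<psi>_dens_dt:
  assumes t_in: "t \<in> {0<..T}"
  shows "(\<integral>y. 2 * (\<psi> t y * dens_dt t y) \<partial>lborel)
    = (1 / t) * wexp t (\<lambda>x y. rel_score t y \<bullet> (y - (X x - t *\<^sub>R V x)))"
proof -
  let ?f = "\<lambda>x y. (1 / (2 * t)) * (noise t x y \<bullet> (y - (X x - t *\<^sub>R V x))) - real DIM('a)"
  have "2 * (\<psi> t y * dens_dt t y) = (1 / t) * (\<integral>x. weight t x y * ?f x y \<partial>M)" for y
  proof -
    have "(\<integral>x. 2 * \<psi> t y * kern_dt t x y \<partial>M) = (\<integral>x. (1 / t) * (weight t x y * ?f x y) \<partial>M)"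
      unfolding weight_def kern_dt_def using t_in by (intro Bochner_Integration.integral_cong) auto
    thus ?thesis by (simp add: dens_dt_def)
  qed
  moreover have "observable ?f" by (intro observable_intros)
  ultimately have "(\<integral>y. 2 * (\<psi> t y * dens_dt t y) \<partial>lborel) = (1 / t) * wexp t ?f"
    by (simp add: wexp_snd[OF t_in])
  also have "wexp t ?f = wexp t (\<lambda>x y. rel_score t y \<bullet> (y - (X x - t *\<^sub>R V x)))"
    by (rule wexp_by_parts[OF t_in, symmetric]) (intro observable_intros)
  finally show ?thesis .
qed

lemma DERIV_energy:
  assumes t_in: "t \<in> {0<..<T}"
  shows "(energy has_real_derivative
    2 * wexp t (\<lambda>x y. rel_score t y \<bullet> (V x - gp y)) - 2 * dissipation t) (at t)"
proof -
  have t_range: "t \<in> {0<..T}" "t \<noteq> 0" using t_in by auto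
  let ?A = "\<lambda>x y. rel_score t y \<bullet> (y - (X x - t *\<^sub>R V x))"
  let ?B = "\<lambda>x y. rel_score t y \<bullet> ((1 / (2 * t)) *\<^sub>R noise t x y + (gp y + rel_score t y))"
  let ?C = "\<lambda>x y. rel_score t y \<bullet> (V x - gp y)"
  have "(1 / t) * wexp t ?A = (1 / t) * wexp t ?A - 2 * wexp t ?B"
    using wexp_tweedie[OF t_range(1) observable_rel_score[OF t_range(1)]] by simp
  also have "\<dots> = wexp t (\<lambda>x y. (1 / t) * ?A x y - 2 * ?B x y)"
    unfolding wexp_cmult[OF t_range(1), symmetric]
    by (rule wexp_diff[OF t_range(1), symmetric]) (intro observable_intros t_range)+
  also have "(\<lambda>x y. (1 / t) * ?A x y - 2 * ?B x y) = (\<lambda>x y. 2 * ?C x y - 2 * (norm (rel_score t y))\<^sup>2)"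
  proof (intro ext)
    fix x y
    have "y - (X x - t *\<^sub>R V x) = noise t x y + (2 * t) *\<^sub>R V x"
      by (simp add: noise_def algebra_simps scaleR_2[symmetric])
    thus "(1 / t) * ?A x y - 2 * ?B x y = 2 * ?C x y - 2 * (norm (rel_score t y))\<^sup>2"
      unfolding power2_norm_eq_inner using t_range(2)
      by (simp add: inner_add_right inner_diff_right algebra_simps)
  qed
  also have "wexp t \<dots> = 2 * wexp t ?C - 2 * dissipation t"
    unfolding dissipation_def wexp_cmult[OF t_range(1), symmetric]
    by (rule wexp_diff[OF t_range(1)]) (intro observable_intros t_range)+
  finally show ?thesis
    using DERIV_energy_integral[OF t_in] unfolding integral_\<psi>_dens_dt[OF t_range(1)] by simp
qed

subsection \<open>Decay of the energy\<close>

context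
  fixes t :: real
  assumes t_in: "t \<in> {0<..T}"
begin

lemma L_t_le: "L * t \<le> 1 / 64"
proof -
  have "L * t \<le> L * T" using t_in L_pos by simp
  thus ?thesis using L_T_le by linarith
qed

lemma displacement_le:
  "wexp t (\<lambda>x y. (norm (noise t x y))\<^sup>2) \<le> 4 * t * DIM('a) * energy t + 4 * t\<^sup>2 * dissipation t"
    (is "?A \<le> _")
proof -
  have t_pos: "0 < t" using t_in by simp
  have "wexp t (\<lambda>x y. rel_score t y \<bullet> noise t x y)
      = wexp t (\<lambda>x y. (1 / (2 * t)) * (norm (noise t x y))\<^sup>2 - real DIM('a) * 1)"
    using wexp_by_parts[OF t_in, of "\<lambda>x. X x + t *\<^sub>R V x"]
    by (simp add: noise_def[symmetric] power2_norm_eq_inner observable_intros)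
  also have "\<dots> = (1 / (2 * t)) * ?A - DIM('a) * energy t"
    by (simp only: wexp_diff[OF t_in] wexp_cmult[OF t_in] energy_eq_wexp[OF t_in] observable_intros)
  finally have "2 * ((1 / (2 * t)) * ?A - DIM('a) * energy t)
      = wexp t (\<lambda>x y. 2 * (rel_score t y \<bullet> noise t x y))"
    by (simp only: wexp_cmult[OF t_in])
  also have "\<dots> \<le> wexp t (\<lambda>x y. (2 * t) * (norm (rel_score t y))\<^sup>2 + (1 / (2 * t)) * (norm (noise t x y))\<^sup>2)"
    using t_pos inner_le_weighted_squares[of "2 * t"]
    by (intro wexp_mono[OF t_in] observable_intros t_in) (simp del: times_divide_eq_left)
  also have "\<dots> = (2 * t) * dissipation t + (1 / (2 * t)) * ?A"
    by (simp only: wexp_add[OF t_in] wexp_cmult[OF t_in] dissipation_def observable_intros t_in)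
  finally have "(1 / (2 * t)) * ?A \<le> 2 * (DIM('a) * energy t) + (2 * t) * dissipation t" by argo
  from mult_left_mono[OF this, of "2 * t"] t_pos show ?thesis
    by (simp add: algebra_simps power2_eq_square)
qed

lemma score_le:
  "wexp t (\<lambda>x y. (norm (gp y))\<^sup>2)
    \<le> 1 / (2 * t\<^sup>2) * wexp t (\<lambda>x y. (norm (noise t x y))\<^sup>2) + 2 * dissipation t"
proof -
  define a where "a = 1 / (2 * t)"
  have "(norm (gp y))\<^sup>2 \<le> 2 * (gp y \<bullet> (a *\<^sub>R noise t x y + (gp y + rel_score t y)))
      + (2 * a\<^sup>2 * (norm (noise t x y))\<^sup>2 + 2 * (norm (rel_score t y))\<^sup>2)" for x y
  proof -
    let ?w = "a *\<^sub>R noise t x y + rel_score t y"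
    have "- (2 * (gp y \<bullet> ?w)) \<le> (norm (gp y))\<^sup>2 + (norm ?w)\<^sup>2"
      using inner_le_weighted_squares[of 1 "gp y" "- ?w"] by (simp del: minus_add_distrib)
    moreover have "(norm ?w)\<^sup>2 \<le> 2 * a\<^sup>2 * (norm (noise t x y))\<^sup>2 + 2 * (norm (rel_score t y))\<^sup>2"
      using norm_add_power2_le[of "a *\<^sub>R noise t x y" "rel_score t y"] by (simp add: power_mult_distrib)
    moreover have "gp y \<bullet> (a *\<^sub>R noise t x y + (gp y + rel_score t y)) = gp y \<bullet> ?w + (norm (gp y))\<^sup>2"
      by (simp add: inner_add_right power2_norm_eq_inner)
    ultimately show ?thesis by linarith
  qed
  hence "wexp t (\<lambda>x y. (norm (gp y))\<^sup>2)
      \<le> wexp t (\<lambda>x y. 2 * (gp y \<bullet> (a *\<^sub>R noise t x y + (gp y + rel_score t y)))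
        + (2 * a\<^sup>2 * (norm (noise t x y))\<^sup>2 + 2 * (norm (rel_score t y))\<^sup>2))"
    by (intro wexp_mono[OF t_in] observable_intros t_in)
  also have "\<dots> = 2 * a\<^sup>2 * wexp t (\<lambda>x y. (norm (noise t x y))\<^sup>2) + 2 * dissipation t"
    using wexp_tweedie[OF t_in observable_gp]
    by (simp only: a_def wexp_add[OF t_in] wexp_cmult[OF t_in] dissipation_def observable_intros t_in)
  finally show ?thesis using t_in by (simp add: a_def power_divide power_mult_distrib)
qed

context
  fixes \<epsilon> :: real
  assumes V_err: "\<And>x. norm (gp (X x) - V x) \<le> \<epsilon>"
begin

lemma norm_drift_error_le:
  "norm (V x - gp y) \<le> 64 / 63 * (\<epsilon> + (L * norm (noise t x y) + L * t * norm (gp y)))"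
proof -
  let ?d = "norm (V x - gp y)" and ?n = "norm (noise t x y)"
  have "?d \<le> norm (V x - gp (X x)) + norm (gp (X x) - gp y)"
    using norm_triangle_ineq[of "V x - gp (X x)" "gp (X x) - gp y"] by simp
  also have "\<dots> \<le> \<epsilon> + L * norm (X x - y)"
    using V_err[of x] lip[of "X x" y] by (simp add: norm_minus_commute)
  also have "norm (X x - y) \<le> ?n + t * (?d + norm (gp y))"
  proof -
    have "X x - y = - noise t x y - t *\<^sub>R V x" by (simp add: noise_def)
    hence "norm (X x - y) \<le> ?n + t * norm (V x)"
      using norm_triangle_ineq4[of "- noise t x y" "t *\<^sub>R V x"] t_in by simp
    moreover have "t * norm (V x) \<le> t * (?d + norm (gp y))"
      using norm_triangle_ineq[of "V x - gp y" "gp y"] t_in by (intro mult_left_mono) auto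
    ultimately show ?thesis by linarith
  qed
  finally have "?d \<le> \<epsilon> + (L * ?n + L * t * norm (gp y)) + L * t * ?d"
    using L_pos by (simp add: algebra_simps)
  moreover have "L * t * ?d \<le> 1 / 64 * ?d"
    by (intro mult_right_mono L_t_le) simp
  ultimately show ?thesis by (simp add: field_simps)
qed

lemma drift_error_power2_le:
  "(norm (V x - gp y))\<^sup>2
    \<le> 5 / 2 * \<epsilon>\<^sup>2 * 1 + (5 * L\<^sup>2 * (norm (noise t x y))\<^sup>2 + 5 * L\<^sup>2 * t\<^sup>2 * (norm (gp y))\<^sup>2)"
proof -
  let ?u = "L * norm (noise t x y)" and ?v = "L * t * norm (gp y)"
  have "(norm (V x - gp y))\<^sup>2 \<le> (64 / 63 * (\<epsilon> + (?u + ?v)))\<^sup>2"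
    by (intro power_mono norm_drift_error_le) simp
  also have "\<dots> = (64 / 63)\<^sup>2 * (\<epsilon> + (?u + ?v))\<^sup>2" by (rule power_mult_distrib)
  also have "\<dots> \<le> 5 / 4 * (\<epsilon> + (?u + ?v))\<^sup>2"
    by (intro mult_right_mono) (auto simp: power2_eq_square)
  also have "\<dots> \<le> 5 / 4 * (2 * \<epsilon>\<^sup>2 + 2 * (2 * ?u\<^sup>2 + 2 * ?v\<^sup>2))"
    using power2_add_le[of \<epsilon> "?u + ?v"] power2_add_le[of ?u ?v] by (intro mult_left_mono) auto
  finally show ?thesis by (simp add: power_mult_distrib algebra_simps)
qed

lemma drift_error_le:
  "wexp t (\<lambda>x y. (norm (V x - gp y))\<^sup>2)
    \<le> 5 / 2 * \<epsilon>\<^sup>2 * energy t + 30 * L\<^sup>2 * t * DIM('a) * energy t + 1 / 100 * dissipation t"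
proof -
  let ?A = "wexp t (\<lambda>x y. (norm (noise t x y))\<^sup>2)" and ?G = "wexp t (\<lambda>x y. (norm (gp y))\<^sup>2)"
  have "wexp t (\<lambda>x y. (norm (V x - gp y))\<^sup>2)
      \<le> wexp t (\<lambda>x y. 5 / 2 * \<epsilon>\<^sup>2 * 1
        + (5 * L\<^sup>2 * (norm (noise t x y))\<^sup>2 + 5 * L\<^sup>2 * t\<^sup>2 * (norm (gp y))\<^sup>2))"
    by (intro wexp_mono[OF t_in] drift_error_power2_le observable_intros)
  also have "\<dots> = 5 / 2 * \<epsilon>\<^sup>2 * energy t + (5 * L\<^sup>2 * ?A + 5 * L\<^sup>2 * t\<^sup>2 * ?G)"
    by (simp only: wexp_add[OF t_in] wexp_cmult[OF t_in] energy_eq_wexp[OF t_in] observable_intros)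
  also have "5 * L\<^sup>2 * t\<^sup>2 * ?G \<le> 5 * L\<^sup>2 * t\<^sup>2 * (1 / (2 * t\<^sup>2) * ?A + 2 * dissipation t)"
    by (intro mult_left_mono score_le) auto
  also have "5 * L\<^sup>2 * ?A + \<dots> = 15 / 2 * L\<^sup>2 * ?A + 10 * L\<^sup>2 * t\<^sup>2 * dissipation t"
    using t_in by (simp add: field_simps)
  also have "15 / 2 * L\<^sup>2 * ?A \<le> 15 / 2 * L\<^sup>2 * (4 * t * DIM('a) * energy t + 4 * t\<^sup>2 * dissipation t)"
    by (intro mult_left_mono displacement_le) auto
  finally have "wexp t (\<lambda>x y. (norm (V x - gp y))\<^sup>2)
      \<le> 5 / 2 * \<epsilon>\<^sup>2 * energy t + 30 * L\<^sup>2 * t * DIM('a) * energy t + 40 * (L * t)\<^sup>2 * dissipation t"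
    by (simp add: power_mult_distrib algebra_simps)
  moreover have "40 * (L * t)\<^sup>2 * dissipation t \<le> 1 / 100 * dissipation t"
  proof (rule mult_right_mono[OF _ dissipation_nonneg[OF t_in]])
    have "(L * t)\<^sup>2 \<le> (1 / 64)\<^sup>2"
      using t_in L_pos by (intro power_mono L_t_le) simp
    thus "40 * (L * t)\<^sup>2 \<le> 1 / 100" by (simp add: power2_eq_square)
  qed
  ultimately show ?thesis by linarith
qed

lemma energy_production_le:
  "2 * wexp t (\<lambda>x y. rel_score t y \<bullet> (V x - gp y)) - 2 * dissipation t
    \<le> - (99 / 100) * dissipation t + (5 / 2 * \<epsilon>\<^sup>2 + 30 * L\<^sup>2 * t * DIM('a)) * energy t"
proof -
  have "2 * wexp t (\<lambda>x y. rel_score t y \<bullet> (V x - gp y))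
      = wexp t (\<lambda>x y. 2 * (rel_score t y \<bullet> (V x - gp y)))"
    by (simp only: wexp_cmult[OF t_in])
  also have "\<dots> \<le> wexp t (\<lambda>x y. (norm (rel_score t y))\<^sup>2 + (norm (V x - gp y))\<^sup>2)"
    using inner_le_weighted_squares[of 1] by (intro wexp_mono[OF t_in] observable_intros t_in) simp
  also have "\<dots> = dissipation t + wexp t (\<lambda>x y. (norm (V x - gp y))\<^sup>2)"
    by (simp only: wexp_add[OF t_in] dissipation_def observable_intros t_in)
  finally show ?thesis using drift_error_le by (simp add: algebra_simps)
qed

end

end

context
  fixes C \<epsilon> h :: real
  assumes V_err: "\<And>x. norm (gp (X x) - V x) \<le> \<epsilon>"
    and LSI: "log_sobolev C p gp" and C_pos: "0 < C"
    and h_range: "0 < h" "h < T"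
    and error_rate_le: "C * (5 / 2 * \<epsilon>\<^sup>2 + 30 * L\<^sup>2 * h * DIM('a)) \<le> 6 / 100"
begin

lemma energy_differential_inequality:
  assumes t_in: "t \<in> {0<..h}"
  shows "2 * wexp t (\<lambda>x y. rel_score t y \<bullet> (V x - gp y)) - 2 * dissipation t
    \<le> - (1 / (4 * C)) * (energy t - 1) + (5 / 2 * \<epsilon>\<^sup>2 + 30 * L\<^sup>2 * h * DIM('a))"
    (is "?rate \<le> _ * ?F + ?K")
proof -
  have t_range: "t \<in> {0<..T}" using t_in h_range by simp
  have excess_nonneg: "0 \<le> ?F" using one_le_energy[OF t_range] by simp
  have "30 * L\<^sup>2 * t * DIM('a) \<le> 30 * L\<^sup>2 * h * DIM('a)"
    using t_in by (intro mult_right_mono mult_left_mono) auto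
  hence "(5 / 2 * \<epsilon>\<^sup>2 + 30 * L\<^sup>2 * t * DIM('a)) * energy t \<le> ?K * energy t"
    using excess_nonneg by (intro mult_right_mono) auto
  also have "\<dots> = ?K * ?F + ?K" by (simp only: right_diff_distrib) simp
  also have "?K * ?F \<le> 6 / 100 / C * ?F"
    using error_rate_le C_pos excess_nonneg by (intro mult_right_mono) (simp_all add: field_simps)
  finally have "?rate \<le> - (99 / 100) * dissipation t + 6 / 100 / C * ?F + ?K"
    using energy_production_le[OF t_range V_err] by linarith
  moreover have "?F / C \<le> dissipation t"
    using poincare[OF t_range LSI] C_pos by (simp add: field_simps)
  moreover have "0 \<le> ?F / C" using excess_nonneg C_pos by simp
  moreover have "6 / 100 / C * ?F = 6 / 100 * (?F / C)" "1 / (4 * C) * ?F = 1 / 4 * (?F / C)" by simp_all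
  ultimately show ?thesis by linarith
qed

lemma energy_decay:
  assumes t_in: "t \<in> {0<..h}"
  shows "energy h - 1 \<le> exp (- (1 / (4 * C)) * (h - t)) * (energy t - 1)
    + (5 / 2 * \<epsilon>\<^sup>2 + 30 * L\<^sup>2 * h * DIM('a)) * (h - t)"
proof (rule gronwall_exp_decay[where u="\<lambda>t. energy t - 1"])
  fix u assume u_in: "u \<in> {t..h}"
  show "((\<lambda>t. energy t - 1) has_real_derivative
      2 * wexp u (\<lambda>x y. rel_score u y \<bullet> (V x - gp y)) - 2 * dissipation u) (at u)"
    using DERIV_diff[OF DERIV_energy DERIV_const, of u] u_in t_in h_range by simp
  show "2 * wexp u (\<lambda>x y. rel_score u y \<bullet> (V x - gp y)) - 2 * dissipation u
      \<le> - (1 / (4 * C)) * (energy u - 1) + (5 / 2 * \<epsilon>\<^sup>2 + 30 * L\<^sup>2 * h * DIM('a))"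
    by (rule energy_differential_inequality) (use u_in t_in in auto)
qed (use t_in h_range C_pos in auto)

end

end

subsection \<open>Behaviour at small times\<close>

definition lmc_step_density :: "('a::euclidean_space \<Rightarrow> 'a) \<Rightarrow> real \<Rightarrow> 'a \<Rightarrow> 'a \<Rightarrow> real" where
  "lmc_step_density s h x y = gauss_density (x + h *\<^sub>R s x) (2 * h) y"

definition lmc_density :: "('a::euclidean_space \<Rightarrow> 'a) \<Rightarrow> real \<Rightarrow> ('a \<Rightarrow> ennreal) \<Rightarrow> 'a \<Rightarrow> ennreal" where
  "lmc_density s h f y = (\<integral>\<^sup>+x. f x * ennreal (lmc_step_density s h x y) \<partial>lborel)"

definition ratio_energy :: "('a::euclidean_space \<Rightarrow> real) \<Rightarrow> ('a \<Rightarrow> ennreal) \<Rightarrow> ennreal" where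
  "ratio_energy p f = (\<integral>\<^sup>+x. (f x)\<^sup>2 * ennreal (1 / p x) \<partial>lborel)"

lemma lmc_step_density_measurable [measurable (raw)]:
  assumes [measurable]: "s \<in> borel_measurable borel" "f \<in> borel_measurable N" "g \<in> borel_measurable N"
  shows "(\<lambda>w. lmc_step_density s h (f w) (g w)) \<in> borel_measurable N"
  unfolding lmc_step_density_def by measurable

lemma lmc_density_measurable [measurable]:
  assumes [measurable]: "s \<in> borel_measurable borel" "f \<in> borel_measurable borel"
  shows "lmc_density s h f \<in> borel_measurable borel"
  unfolding lmc_density_def[abs_def] by measurable

context lip_score
begin

definition heavy_gauss :: "real \<Rightarrow> real \<Rightarrow> 'a \<Rightarrow> real" where
  "heavy_gauss S t w = gauss_density 0 (2 * t) w * exp (2 * S * norm w + L * (norm w)\<^sup>2)"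

definition smear :: "real \<Rightarrow> real \<Rightarrow> real" where
  "smear S t = exp (sqrt t) * (1 / (1 - (4 * t * L + 4 * S\<^sup>2 * sqrt t))) powr (real DIM('a) / 2)"

lemma heavy_gauss_measurable [measurable]: "heavy_gauss S t \<in> borel_measurable borel"
  unfolding heavy_gauss_def[abs_def] by measurable

lemma smear_nonneg: "0 \<le> smear S t"
  by (simp add: smear_def)

lemma smear_tendsto: "(smear S \<longlongrightarrow> 1) (at_right 0)"
proof -
  have "(smear S \<longlongrightarrow> smear S 0) (at_right 0)"
    unfolding smear_def by (intro tendsto_intros) auto
  thus ?thesis by (simp add: smear_def)
qed

lemma nn_integral_heavy_gauss_le:
  assumes t_pos: "0 < t" and time_small: "4 * t * L + 4 * S\<^sup>2 * sqrt t < 1"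
  shows "(\<integral>\<^sup>+w. ennreal (heavy_gauss S t w) \<partial>lborel) \<le> ennreal (smear S t)"
proof -
  define a where "a = L + S\<^sup>2 / sqrt t"
  have rate_eq: "2 * (2 * t) * a = 4 * t * L + 4 * S\<^sup>2 * sqrt t"
  proof -
    have "2 * (2 * t) * a = 4 * t * L + 4 * S\<^sup>2 * (t / sqrt t)" by (simp add: a_def distrib_left)
    thus ?thesis using t_pos by (simp only: real_div_sqrt less_imp_le)
  qed
  txt \<open>Trading \<open>2 * S * norm w\<close> for \<open>sqrt t + S\<^sup>2 * (norm w)\<^sup>2 / sqrt t\<close> makes the kernel Gaussian again.\<close>
  have "heavy_gauss S t w \<le> exp (sqrt t) * (gauss_density 0 (2 * t) w * exp (a * (norm w)\<^sup>2))" for w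
  proof -
    have "0 \<le> (sqrt t - S * norm w)\<^sup>2 / sqrt t" using t_pos by simp
    also have "\<dots> = sqrt t - 2 * S * norm w + S\<^sup>2 / sqrt t * (norm w)\<^sup>2"
      using t_pos by (simp add: power2_eq_square field_simps)
    finally have "exp (2 * S * norm w + L * (norm w)\<^sup>2) \<le> exp (sqrt t) * exp (a * (norm w)\<^sup>2)"
      unfolding exp_add[symmetric] by (simp add: a_def algebra_simps)
    from mult_left_mono[OF this gauss_density_nonneg[of 0 "2 * t" w]] show ?thesis
      by (simp add: heavy_gauss_def mult_ac)
  qed
  hence "(\<integral>\<^sup>+w. ennreal (heavy_gauss S t w) \<partial>lborel)
      \<le> (\<integral>\<^sup>+w. ennreal (exp (sqrt t))
        * ennreal (gauss_density (0::'a) (2 * t) w * exp (a * (norm w)\<^sup>2)) \<partial>lborel)"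
    by (intro nn_integral_mono) (simp add: ennreal_mult'[symmetric] ennreal_leI)
  also have "\<dots> = ennreal (exp (sqrt t)) * ennreal ((1 / (1 - 2 * (2 * t) * a)) powr (real DIM('a) / 2))"
    by (subst nn_integral_cmult, measurable, subst nn_integral_gauss_density_mult_exp)
       (use t_pos time_small[folded rate_eq] in simp_all)
  also have "\<dots> = ennreal (smear S t)"
    unfolding smear_def rate_eq by (simp add: ennreal_mult')
  finally show ?thesis .
qed

context
  fixes v x :: 'a and S t :: real
  assumes v_le: "norm v \<le> S" and t_pos: "0 < t"
begin

lemma drift_gauss_le:
  "gauss_density (x + t *\<^sub>R v) (2 * t) y \<le> gauss_density 0 (2 * t) (y - x) * exp (S * norm (y - x))"
proof -
  have "norm (t *\<^sub>R v) * norm (y - x) / (2 * t) = norm v * norm (y - x) / 2" using t_pos by simp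
  also have "\<dots> \<le> S * norm (y - x)"
    using mult_right_mono[OF v_le norm_ge_zero[of "y - x"]]
      mult_nonneg_nonneg[OF norm_ge_zero[of v] norm_ge_zero[of "y - x"]]
    by linarith
  finally have "gauss_density x (2 * t) y * exp (norm (t *\<^sub>R v) * norm (y - x) / (2 * t))
      \<le> gauss_density x (2 * t) y * exp (S * norm (y - x))"
    by (intro mult_left_mono gauss_density_nonneg) simp
  moreover have "gauss_density (x + t *\<^sub>R v) (2 * t) y
      \<le> gauss_density x (2 * t) y * exp (norm (t *\<^sub>R v) * norm (y - x) / (2 * t))"
    by (rule gauss_density_shift_le) (use t_pos in simp)
  ultimately show ?thesis by (simp add: gauss_density_eq_centered[of x])
qed

lemma drift_gauss_le_heavy: "gauss_density (x + t *\<^sub>R v) (2 * t) y \<le> heavy_gauss S t (y - x)"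
proof -
  have "0 \<le> S" using v_le norm_ge_zero order_trans by blast
  hence "exp (S * norm (y - x)) \<le> exp (2 * S * norm (y - x) + L * (norm (y - x))\<^sup>2)"
    using L_pos by simp
  from mult_left_mono[OF this gauss_density_nonneg] show ?thesis
    unfolding heavy_gauss_def using drift_gauss_le by (rule order_trans[rotated])
qed

lemma drift_gauss_div_p_le:
  assumes gp_le: "norm (gp x) \<le> S"
  shows "gauss_density (x + t *\<^sub>R v) (2 * t) y * (1 / p y) \<le> 1 / p x * heavy_gauss S t (y - x)"
proof -
  let ?r = "norm (y - x)"
  have "1 / p y \<le> 1 / p x * exp (norm (gp x) * ?r + L * ?r\<^sup>2)" by (rule inverse_p_le)
  also have "\<dots> \<le> 1 / p x * exp (S * ?r + L * ?r\<^sup>2)"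
    using p_pos[of x] mult_right_mono[OF gp_le norm_ge_zero] by (intro mult_left_mono) auto
  finally have "gauss_density (x + t *\<^sub>R v) (2 * t) y * (1 / p y)
      \<le> (gauss_density 0 (2 * t) (y - x) * exp (S * ?r)) * (1 / p x * exp (S * ?r + L * ?r\<^sup>2))"
    using p_pos[of y] by (intro mult_mono drift_gauss_le) (auto simp: gauss_density_nonneg)
  also have "\<dots> = 1 / p x * (gauss_density 0 (2 * t) (y - x) * (exp (S * ?r) * exp (S * ?r + L * ?r\<^sup>2)))"
    by (simp only: mult_ac)
  also have "exp (S * ?r) * exp (S * ?r + L * ?r\<^sup>2) = exp (2 * S * ?r + L * ?r\<^sup>2)"
    unfolding exp_add[symmetric] by simp
  finally show ?thesis by (simp add: heavy_gauss_def)
qed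

lemma nn_integral_drift_gauss_div_p_le:
  assumes gp_le: "norm (gp x) \<le> S" and time_small: "4 * t * L + 4 * S\<^sup>2 * sqrt t < 1"
  shows "(\<integral>\<^sup>+y. ennreal (gauss_density (x + t *\<^sub>R v) (2 * t) y) * ennreal (1 / p y) \<partial>lborel)
    \<le> ennreal (smear S t) * ennreal (1 / p x)"
proof -
  have "ennreal (gauss_density (x + t *\<^sub>R v) (2 * t) y) * ennreal (1 / p y)
      \<le> ennreal (1 / p x) * ennreal (heavy_gauss S t (y - x))" for y
    using drift_gauss_div_p_le[OF gp_le, of y] p_pos[of x]
    by (simp add: ennreal_mult'[symmetric] gauss_density_nonneg less_imp_le ennreal_leI)
  hence "(\<integral>\<^sup>+y. ennreal (gauss_density (x + t *\<^sub>R v) (2 * t) y) * ennreal (1 / p y) \<partial>lborel)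
      \<le> (\<integral>\<^sup>+y. ennreal (1 / p x) * ennreal (heavy_gauss S t (y - x)) \<partial>lborel)"
    by (rule nn_integral_mono)
  also have "\<dots> = ennreal (1 / p x) * (\<integral>\<^sup>+y. ennreal (heavy_gauss S t y) \<partial>lborel)"
    by (subst nn_integral_cmult, measurable, subst nn_integral_lborel_translation, measurable)
  also have "\<dots> \<le> ennreal (1 / p x) * ennreal (smear S t)"
    by (intro mult_left_mono nn_integral_heavy_gauss_le t_pos time_small) simp
  finally show ?thesis by (simp only: mult.commute)
qed

end

lemma heavy_gauss_minus_commute: "heavy_gauss S t (x - y) = heavy_gauss S t (y - x)"
  by (simp add: heavy_gauss_def gauss_density_def norm_minus_commute)

text \<open>The drift is only measurable, so the densities need not converge pointwise at time zero, but the
  Schur test still controls the second moment there.\<close>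
lemma ratio_energy_lmc_density_short_time:
  assumes [measurable]: "f \<in> borel_measurable borel" "s \<in> borel_measurable borel"
    and supp: "\<And>x. R < norm x \<Longrightarrow> f x = 0"
    and s_le: "\<And>x. norm x \<le> R \<Longrightarrow> norm (s x) \<le> S" and gp_le: "\<And>x. norm x \<le> R \<Longrightarrow> norm (gp x) \<le> S"
    and t_pos: "0 < t" and time_small: "4 * t * L + 4 * S\<^sup>2 * sqrt t < 1"
  shows "ratio_energy p (lmc_density s t f) \<le> ennreal ((smear S t)\<^sup>2) * ratio_energy p f"
proof -
  define k where "k x y = ennreal (lmc_step_density s t x y) * indicator {x. norm x \<le> R} x" for x y
  have density_eq: "lmc_density s t f y = (\<integral>\<^sup>+x. f x * k x y \<partial>lborel)" for y
    unfolding lmc_density_def k_def using supp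
    by (intro nn_integral_cong) (auto simp: indicator_def not_le)
  have [measurable]: "case_prod k \<in> borel_measurable (lborel \<Otimes>\<^sub>M lborel)"
    unfolding k_def by measurable
  have row_le: "(\<integral>\<^sup>+x. k x y \<partial>lborel) \<le> ennreal (smear S t)" for y
  proof -
    have "k x y \<le> ennreal (heavy_gauss S t (x - y))" for x
      using drift_gauss_le_heavy[OF s_le t_pos, of x x y]
      by (auto simp: k_def lmc_step_density_def indicator_def heavy_gauss_minus_commute[of S t x]
          intro: ennreal_leI)
    hence "(\<integral>\<^sup>+x. k x y \<partial>lborel) \<le> (\<integral>\<^sup>+x. ennreal (heavy_gauss S t (x - y)) \<partial>lborel)"
      by (rule nn_integral_mono)
    also have "\<dots> = (\<integral>\<^sup>+x. ennreal (heavy_gauss S t x) \<partial>lborel)"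
      by (rule nn_integral_lborel_translation) measurable
    also note nn_integral_heavy_gauss_le[OF t_pos time_small]
    finally show ?thesis .
  qed
  have column_le: "(\<integral>\<^sup>+y. k x y * ennreal (1 / p y) \<partial>lborel)
      \<le> ennreal (smear S t) * ennreal (1 / p x)" for x
    using nn_integral_drift_gauss_div_p_le[OF s_le t_pos gp_le time_small, of x x]
    by (simp add: k_def lmc_step_density_def indicator_def)
  have "(\<integral>\<^sup>+y. (\<integral>\<^sup>+x. f x * k x y \<partial>lborel)\<^sup>2 * ennreal (1 / p y) \<partial>lborel)
      \<le> ennreal (smear S t) * ennreal (smear S t) * (\<integral>\<^sup>+x. (f x)\<^sup>2 * ennreal (1 / p x) \<partial>lborel)"
    by (rule nn_integral_Schur_test[OF sigma_finite_lborel sigma_finite_lborel])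
       (use row_le column_le in auto)
  thus ?thesis
    by (simp add: ratio_energy_def density_eq power2_eq_square ennreal_mult smear_nonneg)
qed

end

subsection \<open>One step from an arbitrary initial law\<close>

lemma ratio_energy_mono:
  "(\<And>x. f x \<le> g x) \<Longrightarrow> ratio_energy p f \<le> ratio_energy p g"
  unfolding ratio_energy_def by (intro nn_integral_mono mult_right_mono power_mono) auto

lemma ratio_energy_cmult:
  assumes [measurable]: "f \<in> borel_measurable borel" "p \<in> borel_measurable borel"
  shows "ratio_energy p (\<lambda>x. c * f x) = c\<^sup>2 * ratio_energy p f"
  unfolding ratio_energy_def
  by (subst nn_integral_cmult[symmetric]) (auto simp: power_mult_distrib mult.assoc)

lemma lmc_density_cmult:
  assumes [measurable]: "f \<in> borel_measurable borel" "s \<in> borel_measurable borel"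
  shows "lmc_density s h (\<lambda>x. c * f x) = (\<lambda>y. c * lmc_density s h f y)"
  unfolding lmc_density_def[abs_def] by (subst nn_integral_cmult[symmetric]) (auto simp: mult.assoc)

lemma ratio_energy_le_of_tendsto:
  assumes [measurable]: "\<And>n::nat. f n \<in> borel_measurable borel" "p \<in> borel_measurable borel"
    and p_pos: "\<And>x. 0 < p x"
    and f_lim: "\<And>x. (\<lambda>n. f n x) \<longlonglongrightarrow> g x"
    and f_le: "\<And>n. ratio_energy p (f n) \<le> K"
  shows "ratio_energy p g \<le> K"
proof -
  have "liminf (\<lambda>n. (f n x)\<^sup>2 * ennreal (1 / p x)) = (g x)\<^sup>2 * ennreal (1 / p x)" for x
    unfolding power2_eq_square
    by (intro lim_imp_Liminf tendsto_mult_ennreal f_lim tendsto_const)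
       (use p_pos[of x] in \<open>auto simp: ennreal_eq_0_iff not_le\<close>)
  hence "ratio_energy p g = (\<integral>\<^sup>+x. liminf (\<lambda>n. (f n x)\<^sup>2 * ennreal (1 / p x)) \<partial>lborel)"
    by (simp add: ratio_energy_def)
  also have "\<dots> \<le> liminf (\<lambda>n. ratio_energy p (f n))"
    unfolding ratio_energy_def by (rule nn_integral_liminf) measurable
  also have "\<dots> \<le> K"
    using f_le by (intro Liminf_le always_eventually) auto
  finally show ?thesis .
qed

locale lmc = lip_score p gp L
  for p :: "'a::euclidean_space \<Rightarrow> real" and gp :: "'a \<Rightarrow> 'a" and L :: real +
  fixes s :: "'a \<Rightarrow> 'a" and C \<epsilon> h :: real
  assumes s_meas [measurable]: "s \<in> borel_measurable borel"
    and s_err: "\<And>x. norm (gp x - s x) \<le> \<epsilon>"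
    and LSI: "log_sobolev C p gp"
    and L_ge: "1 \<le> L" and C_ge: "1 \<le> C"
    and \<epsilon>_le: "\<epsilon> \<le> sqrt (1 / (48 * C))"
    and h_pos: "0 < h" and h_le: "h \<le> 1 / (4392 * real DIM('a) * C * L\<^sup>2)"
begin

lemma \<epsilon>_nonneg: "0 \<le> \<epsilon>"
  using s_err norm_ge_zero order_trans by blast

lemma C_\<epsilon>_power2_le: "48 * C * \<epsilon>\<^sup>2 \<le> 1"
proof -
  have "\<epsilon>\<^sup>2 \<le> (sqrt (1 / (48 * C)))\<^sup>2" using \<epsilon>_le \<epsilon>_nonneg by (rule power_mono)
  thus ?thesis using C_ge by (simp add: field_simps)
qed

lemma DIM_ge: "1 \<le> real DIM('a)"
  using DIM_positive[where 'a='a] by linarith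

lemma C_h_le: "4392 * real DIM('a) * C * L\<^sup>2 * h \<le> 1"
proof -
  have "0 < 4392 * real DIM('a) * C * L\<^sup>2" using DIM_ge C_ge L_ge by simp
  thus ?thesis using h_le by (simp add: field_simps)
qed

lemma L_h_le: "4392 * (L * h) \<le> 1"
proof -
  have "1 * 1 * L \<le> real DIM('a) * C * L\<^sup>2"
    using DIM_ge C_ge L_ge by (intro mult_mono) (auto simp: power2_eq_square)
  from mult_right_mono[OF this, of "4392 * h"]
  have "4392 * (L * h) \<le> 4392 * real DIM('a) * C * L\<^sup>2 * h"
    using h_pos by (simp add: mult_ac)
  thus ?thesis using C_h_le by (rule order_trans)
qed

lemma h_le_one: "h \<le> 1"
  using L_h_le mult_right_mono[OF L_ge less_imp_le[OF h_pos]] by simp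

definition decay :: real where
  "decay = exp (- h / (4 * C))"

definition step_error :: real where
  "step_error = (5 / 2 * \<epsilon>\<^sup>2 + 30 * L\<^sup>2 * h * DIM('a)) * h"

lemma decay_pos: "0 < decay" and decay_le_one: "decay \<le> 1"
  using h_pos C_ge by (simp_all add: decay_def)

lemma step_error_nonneg: "0 \<le> step_error"
  using h_pos by (simp add: step_error_def)

lemma error_rate_le: "C * (5 / 2 * \<epsilon>\<^sup>2 + 30 * L\<^sup>2 * h * DIM('a)) \<le> 6 / 100"
proof -
  have "C * (5 / 2 * \<epsilon>\<^sup>2 + 30 * L\<^sup>2 * h * DIM('a))
      = 5 / 96 * (48 * C * \<epsilon>\<^sup>2) + 30 / 4392 * (4392 * real DIM('a) * C * L\<^sup>2 * h)"
    by (simp add: algebra_simps)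
  thus ?thesis using C_\<epsilon>_power2_le C_h_le by linarith
qed

end

locale lmc_bounded_start = lmc p gp L s C \<epsilon> h
  for p :: "'a::euclidean_space \<Rightarrow> real" and gp L s C \<epsilon> h +
  fixes f :: "'a \<Rightarrow> ennreal" and R :: real
  assumes f_meas [measurable]: "f \<in> borel_measurable borel"
    and f_supp: "\<And>x. R < norm x \<Longrightarrow> f x = 0" and R_nonneg: "0 \<le> R"
    and f_prob: "prob_space (density lborel f)"
begin

definition start :: "'a \<Rightarrow> 'a" where
  "start x = (if norm x \<le> R then x else 0)"

definition drift_bound :: real where
  "drift_bound = \<epsilon> + (norm (gp 0) + L * R) + R"

lemma start_measurable [measurable]: "start \<in> borel_measurable borel"
  unfolding start_def[abs_def] by measurable

lemma norm_start_le: "norm (start x) \<le> R"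
  using R_nonneg by (simp add: start_def)

lemma norm_gp_le:
  assumes "norm x \<le> R"
  shows "norm (gp x) \<le> norm (gp 0) + L * R"
proof -
  have "L * norm x \<le> L * R" using assms L_pos by simp
  thus ?thesis using lip[of x 0] norm_triangle_ineq[of "gp x - gp 0" "gp 0"] by simp
qed

lemma norm_gp_le_drift_bound: "norm x \<le> R \<Longrightarrow> norm (gp x) \<le> drift_bound"
  using norm_gp_le[of x] \<epsilon>_nonneg R_nonneg by (simp add: drift_bound_def)

lemma norm_s_le_drift_bound: "norm x \<le> R \<Longrightarrow> norm (s x) \<le> drift_bound"
  using norm_gp_le[of x] s_err[of x] R_nonneg norm_triangle_ineq4[of "gp x" "gp x - s x"]
  by (simp add: drift_bound_def)

lemma R_le_drift_bound: "R \<le> drift_bound"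
  using \<epsilon>_nonneg R_nonneg L_pos by (simp add: drift_bound_def)

sublocale start: prob_space "density lborel f"
  by (rule f_prob)

sublocale interp: lmc_interp p gp L "density lborel f" start "\<lambda>x. s (start x)" drift_bound "2 * h"
proof unfold_locales
  show "norm (start x) \<le> drift_bound" for x
    using norm_start_le R_le_drift_bound by (rule order_trans)
  show "norm (s (start x)) \<le> drift_bound" for x
    by (rule norm_s_le_drift_bound[OF norm_start_le])
  show "64 * L * (2 * h) \<le> 1"
    using L_h_le mult_pos_pos[OF L_pos h_pos] by simp
qed (use h_pos in auto)

lemma dens_eq_lmc_density:
  assumes t_in: "t \<in> {0<..2 * h}"
  shows "ennreal (interp.dens t y) = lmc_density s t f y"
proof -
  have "ennreal (interp.dens t y) = (\<integral>\<^sup>+x. ennreal (interp.kern t x y) \<partial>density lborel f)"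
    unfolding interp.dens_def
    by (rule nn_integral_eq_integral[symmetric, OF interp.kern_integrable[OF t_in]])
       (simp add: interp.kern_nonneg)
  also have "\<dots> = (\<integral>\<^sup>+x. f x * ennreal (interp.kern t x y) \<partial>lborel)"
    by (rule nn_integral_density) (auto simp: interp.kern_def)
  also have "\<dots> = lmc_density s t f y"
    unfolding lmc_density_def interp.kern_def lmc_step_density_def
    using f_supp by (intro nn_integral_cong) (auto simp: start_def not_le)
  finally show ?thesis .
qed

lemma energy_eq_ratio_energy:
  assumes t_in: "t \<in> {0<..2 * h}"
  shows "ennreal (interp.energy t) = ratio_energy p (lmc_density s t f)"
proof -
  have "ennreal (interp.energy t) = (\<integral>\<^sup>+y. ennreal ((interp.dens t y)\<^sup>2 / p y) \<partial>lborel)"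
    unfolding interp.energy_def
    by (rule nn_integral_eq_integral[symmetric, OF interp.integrable_dens_square[OF t_in]])
       (simp add: less_imp_le p_pos)
  also have "\<dots> = (\<integral>\<^sup>+y. (ennreal (interp.dens t y))\<^sup>2 * ennreal (1 / p y) \<partial>lborel)"
    using interp.dens_pos[OF t_in] p_pos
    by (intro nn_integral_cong) (simp add: ennreal_power ennreal_mult[symmetric] less_imp_le)
  finally show ?thesis by (simp add: ratio_energy_def dens_eq_lmc_density[OF t_in])
qed

lemma energy_step_from:
  assumes B_eq: "ratio_energy p f = ennreal B" "0 \<le> B"
    and t_range: "0 < t" "t < h" "4 * t * L + 4 * drift_bound\<^sup>2 * sqrt t < 1"
  shows "interp.energy h
    \<le> 1 + exp (- (1 / (4 * C)) * (h - t)) * ((smear drift_bound t)\<^sup>2 * B - 1) + step_error"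
proof -
  have "ennreal (interp.energy t) \<le> ennreal ((smear drift_bound t)\<^sup>2) * ennreal B"
    unfolding B_eq(1)[symmetric] using t_range
    by (subst energy_eq_ratio_energy) (auto intro!: ratio_energy_lmc_density_short_time[where R=R]
      f_supp norm_s_le_drift_bound norm_gp_le_drift_bound)
  hence "interp.energy t \<le> (smear drift_bound t)\<^sup>2 * B"
    using B_eq(2) by (simp add: ennreal_mult'[symmetric])
  hence "exp (- (1 / (4 * C)) * (h - t)) * (interp.energy t - 1)
      \<le> exp (- (1 / (4 * C)) * (h - t)) * ((smear drift_bound t)\<^sup>2 * B - 1)"
    by (intro mult_left_mono) auto
  moreover have "interp.energy h - 1 \<le> exp (- (1 / (4 * C)) * (h - t)) * (interp.energy t - 1)
      + (5 / 2 * \<epsilon>\<^sup>2 + 30 * L\<^sup>2 * h * DIM('a)) * (h - t)"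
    by (rule interp.energy_decay[OF s_err LSI]) (use C_ge h_pos error_rate_le t_range in auto)
  moreover have "(5 / 2 * \<epsilon>\<^sup>2 + 30 * L\<^sup>2 * h * DIM('a)) * (h - t) \<le> step_error"
    unfolding step_error_def using t_range h_pos by (intro mult_left_mono) auto
  ultimately show ?thesis by linarith
qed

lemma energy_step:
  assumes B_eq: "ratio_energy p f = ennreal B" "0 \<le> B"
  shows "interp.energy h \<le> decay * B + (1 - decay + step_error)"
proof -
  let ?bound = "\<lambda>t \<sigma>. 1 + exp (- (1 / (4 * C)) * (h - t)) * (\<sigma>\<^sup>2 * B - 1) + step_error"
  have "interp.energy h \<le> ?bound 0 1"
  proof (rule tendsto_le[OF _ _ tendsto_const])
    show "((\<lambda>t. ?bound t (smear drift_bound t)) \<longlongrightarrow> ?bound 0 1) (at_right 0)"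
      by (intro tendsto_intros smear_tendsto)
    have "((\<lambda>t. 4 * t * L + 4 * drift_bound\<^sup>2 * sqrt t)
        \<longlongrightarrow> 4 * 0 * L + 4 * drift_bound\<^sup>2 * sqrt 0) (at_right 0)"
      by (intro tendsto_intros)
    hence "\<forall>\<^sub>F t in at_right 0. 4 * t * L + 4 * drift_bound\<^sup>2 * sqrt t < 1"
      by (rule order_tendstoD) simp
    moreover have "\<forall>\<^sub>F t in at_right 0. t \<in> {0<..<h}"
      using h_pos by (rule eventually_at_right_real)
    ultimately show "\<forall>\<^sub>F t in at_right 0. interp.energy h \<le> ?bound t (smear drift_bound t)"
      by eventually_elim (rule energy_step_from[OF B_eq], auto)
  qed simp
  thus ?thesis by (simp add: decay_def algebra_simps)
qed

lemma ratio_energy_lmc_density_bounded_start: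
  "ratio_energy p (lmc_density s h f)
    \<le> ennreal decay * ratio_energy p f + ennreal (1 - decay + step_error)"
proof (cases "ratio_energy p f")
  case (real B)
  have "ratio_energy p (lmc_density s h f) = ennreal (interp.energy h)"
    using h_pos by (intro energy_eq_ratio_energy[symmetric]) auto
  also have "\<dots> \<le> ennreal (decay * B + (1 - decay + step_error))"
    using real by (intro ennreal_leI energy_step) auto
  finally show ?thesis
    using real decay_pos decay_le_one step_error_nonneg by (simp add: ennreal_plus ennreal_mult)
next
  case top
  thus ?thesis using decay_pos by (simp add: ennreal_mult_top)
qed

end

context lmc
begin

lemma ratio_energy_lmc_density_bounded_support:
  assumes [measurable]: "f \<in> borel_measurable borel"
    and supp: "\<And>x. R < norm x \<Longrightarrow> f x = 0" and R_nonneg: "0 \<le> R"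
    and mass: "(\<integral>\<^sup>+x. f x \<partial>lborel) \<le> 1"
  shows "ratio_energy p (lmc_density s h f)
    \<le> ennreal decay * ratio_energy p f + ennreal (1 - decay + step_error)"
proof -
  obtain m where m_mass: "(\<integral>\<^sup>+x. f x \<partial>lborel) = ennreal m" "0 \<le> m" "m \<le> 1"
    using mass by (cases "\<integral>\<^sup>+x. f x \<partial>lborel") (auto simp: top_unique)
  show ?thesis
  proof (cases "m = 0")
    case True
    hence "AE x in lborel. f x = 0" using m_mass by (simp add: nn_integral_0_iff_AE)
    hence "AE x in lborel. f x * ennreal (lmc_step_density s h x y) = 0" for y
      by eventually_elim simp
    hence "lmc_density s h f y = 0" for y
      by (simp add: lmc_density_def nn_integral_0_iff_AE)
    thus ?thesis by (simp add: ratio_energy_def)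
  next
    case False
    define g where "g x = ennreal (1 / m) * f x" for x
    have [measurable]: "g \<in> borel_measurable borel" unfolding g_def[abs_def] by measurable
    have f_eq: "f = (\<lambda>x. ennreal m * g x)"
      using m_mass False by (simp add: g_def mult.assoc[symmetric] ennreal_mult'[symmetric])
    have "(\<integral>\<^sup>+x. g x \<partial>lborel) = 1"
      unfolding g_def using m_mass False by (simp add: nn_integral_cmult ennreal_mult'[symmetric])
    hence "prob_space (density lborel g)"
      by (intro prob_spaceI) (simp add: emeasure_density)
    then interpret g: lmc_bounded_start p gp L s C \<epsilon> h g R
      by (intro lmc_bounded_start.intro lmc_bounded_start_axioms.intro lmc_axioms R_nonneg)
         (simp_all add: g_def supp)
    have "ratio_energy p (lmc_density s h f) = (ennreal m)\<^sup>2 * ratio_energy p (lmc_density s h g)"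
      by (simp add: f_eq lmc_density_cmult ratio_energy_cmult)
    also have "\<dots> \<le> (ennreal m)\<^sup>2 * (ennreal decay * ratio_energy p g + ennreal (1 - decay + step_error))"
      by (intro mult_left_mono g.ratio_energy_lmc_density_bounded_start) simp
    also have "\<dots> = ennreal decay * ((ennreal m)\<^sup>2 * ratio_energy p g)
        + (ennreal m)\<^sup>2 * ennreal (1 - decay + step_error)"
      by (simp only: distrib_left mult_ac)
    also have "(ennreal m)\<^sup>2 * ratio_energy p g = ratio_energy p f"
      by (simp add: f_eq ratio_energy_cmult)
    also have "(ennreal m)\<^sup>2 * ennreal (1 - decay + step_error) \<le> 1 * ennreal (1 - decay + step_error)"
      using m_mass by (intro mult_right_mono) (auto simp: ennreal_power power_le_one)
    finally show ?thesis by (simp add: add_left_mono)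
  qed
qed

lemma ratio_energy_lmc_density_le:
  assumes [measurable]: "f \<in> borel_measurable borel" and mass: "(\<integral>\<^sup>+x. f x \<partial>lborel) \<le> 1"
  shows "ratio_energy p (lmc_density s h f)
    \<le> ennreal decay * ratio_energy p f + ennreal (1 - decay + step_error)"
proof (rule ratio_energy_le_of_tendsto)
  define trunc where "trunc n x = f x * indicator {x. norm x \<le> real n} x" for n :: nat and x
  have trunc_meas [measurable]: "trunc n \<in> borel_measurable borel" for n
    unfolding trunc_def[abs_def] by measurable
  have trunc_le: "trunc n x \<le> f x" for n x
    by (simp add: trunc_def indicator_def)
  show "(\<lambda>n. lmc_density s h (trunc n) y) \<longlonglongrightarrow> lmc_density s h f y" for y
    unfolding lmc_density_def
  proof (rule nn_integral_LIMSEQ)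
    show "incseq (\<lambda>n x. trunc n x * ennreal (lmc_step_density s h x y))"
      by (intro incseq_SucI le_funI mult_right_mono) (auto simp: trunc_def indicator_def)
    fix x :: 'a
    obtain n :: nat where "norm x \<le> real n" using real_arch_simple by blast
    hence "\<forall>\<^sub>F m in sequentially. trunc m x = f x"
      by (intro eventually_sequentiallyI[of n]) (simp add: trunc_def)
    thus "(\<lambda>n. trunc n x * ennreal (lmc_step_density s h x y))
        \<longlonglongrightarrow> f x * ennreal (lmc_step_density s h x y)"
      by (intro tendsto_eventually) (auto elim: eventually_mono)
  qed measurable
  fix n
  have "(\<integral>\<^sup>+x. trunc n x \<partial>lborel) \<le> 1"
    using nn_integral_mono[OF trunc_le] mass by (rule order_trans)
  hence "ratio_energy p (lmc_density s h (trunc n))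
      \<le> ennreal decay * ratio_energy p (trunc n) + ennreal (1 - decay + step_error)"
    by (intro ratio_energy_lmc_density_bounded_support[where R="real n"]) (auto simp: trunc_def)
  also have "\<dots> \<le> ennreal decay * ratio_energy p f + ennreal (1 - decay + step_error)"
    by (intro add_right_mono mult_left_mono ratio_energy_mono trunc_le) simp
  finally show "ratio_energy p (lmc_density s h (trunc n))
      \<le> ennreal decay * ratio_energy p f + ennreal (1 - decay + step_error)" .
qed (auto intro: p_pos simp: lmc_density_def)

end

subsection \<open>Iterating the step\<close>

lemma lmc_kernel_eq_density: "lmc_kernel s h x = density lborel (\<lambda>y. ennreal (lmc_step_density s h x y))"
  by (simp add: lmc_kernel_def lmc_step_density_def)

lemma prob_space_lmc_kernel:
  assumes "0 < h" shows "prob_space (lmc_kernel s h x)"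
  using nn_integral_gauss_density[of "2 * h" "x + h *\<^sub>R s x"] assms
  by (intro prob_spaceI) (simp add: lmc_kernel_def emeasure_density)

lemma measurable_lmc_kernel:
  assumes h_pos: "0 < h" and [measurable]: "s \<in> borel_measurable borel" and sets_\<mu>: "sets \<mu> = sets borel"
  shows "lmc_kernel s h \<in> \<mu> \<rightarrow>\<^sub>M subprob_algebra borel"
proof (rule measurable_subprob_algebra)
  note [measurable_cong] = sets_\<mu>
  show "subprob_space (lmc_kernel s h x)" for x
    by (rule prob_space_imp_subprob_space[OF prob_space_lmc_kernel[OF h_pos]])
  fix A :: "'a set" assume [measurable]: "A \<in> sets borel"
  show "(\<lambda>x. emeasure (lmc_kernel s h x) A) \<in> borel_measurable \<mu>"
    unfolding lmc_kernel_def by (subst emeasure_density) (auto simp: measurable_lborel1)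
qed (simp add: lmc_kernel_def)

context
  fixes s :: "'a::euclidean_space \<Rightarrow> 'a" and h :: real and \<mu> :: "'a measure"
  assumes h_pos: "0 < h" and s_meas [measurable]: "s \<in> borel_measurable borel"
    and \<mu>_prob: "sets \<mu> = sets borel" "prob_space \<mu>"
begin

lemma bind_lmc_kernel_eq_density:
  "bind \<mu> (lmc_kernel s h)
    = density lborel (\<lambda>y. \<integral>\<^sup>+x. ennreal (lmc_step_density s h x y) \<partial>\<mu>)"
proof (rule measure_eqI)
  interpret \<mu>: prob_space \<mu> by (rule \<mu>_prob)
  interpret pair: pair_sigma_finite \<mu> "lborel :: 'a measure" ..
  note [measurable_cong] = \<mu>_prob(1)
  have sets_bind: "sets (bind \<mu> (lmc_kernel s h)) = sets borel"
    by (rule sets_bind) (use \<mu>.not_empty in \<open>auto simp: lmc_kernel_def\<close>)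
  thus "sets (bind \<mu> (lmc_kernel s h))
      = sets (density lborel (\<lambda>y. \<integral>\<^sup>+x. ennreal (lmc_step_density s h x y) \<partial>\<mu>))"
    by simp
  fix A assume "A \<in> sets (bind \<mu> (lmc_kernel s h))"
  hence [measurable]: "A \<in> sets borel" by (simp add: sets_bind)
  have "emeasure (bind \<mu> (lmc_kernel s h)) A = (\<integral>\<^sup>+x. emeasure (lmc_kernel s h x) A \<partial>\<mu>)"
    by (rule emeasure_bind[OF \<mu>.not_empty measurable_lmc_kernel[OF h_pos s_meas \<mu>_prob(1)]]) simp
  also have "\<dots> = (\<integral>\<^sup>+x. \<integral>\<^sup>+y. ennreal (lmc_step_density s h x y) * indicator A y \<partial>lborel \<partial>\<mu>)"
    unfolding lmc_kernel_eq_density by (intro nn_integral_cong emeasure_density) auto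
  also have "\<dots> = (\<integral>\<^sup>+y. \<integral>\<^sup>+x. ennreal (lmc_step_density s h x y) * indicator A y \<partial>\<mu> \<partial>lborel)"
    by (rule pair.Fubini'[symmetric]) measurable
  also have "\<dots> = (\<integral>\<^sup>+y. (\<integral>\<^sup>+x. ennreal (lmc_step_density s h x y) \<partial>\<mu>) * indicator A y \<partial>lborel)"
    by (intro nn_integral_cong nn_integral_multc) measurable
  also have "\<dots> = emeasure (density lborel (\<lambda>y. \<integral>\<^sup>+x. ennreal (lmc_step_density s h x y) \<partial>\<mu>)) A"
    by (rule emeasure_density[symmetric]) auto
  finally show "emeasure (bind \<mu> (lmc_kernel s h)) A = \<dots>" .
qed

lemma prob_space_bind_lmc_kernel: "prob_space (bind \<mu> (lmc_kernel s h))"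
  by (rule prob_space.prob_space_bind[OF \<mu>_prob(2) _ measurable_lmc_kernel[OF h_pos s_meas \<mu>_prob(1)]])
     (simp add: prob_space_lmc_kernel[OF h_pos])

lemma sets_bind_lmc_kernel: "sets (bind \<mu> (lmc_kernel s h)) = sets borel"
  by (simp add: bind_lmc_kernel_eq_density)

end

lemma bind_lmc_kernel_density:
  assumes "0 < h" and s_meas [measurable]: "s \<in> borel_measurable borel"
    and f_meas [measurable]: "f \<in> borel_measurable borel" and "prob_space (density lborel f)"
  shows "bind (density lborel f) (lmc_kernel s h) = density lborel (lmc_density s h f)"
proof -
  have "(\<integral>\<^sup>+x. ennreal (lmc_step_density s h x y) \<partial>density lborel f) = lmc_density s h f y" for y
    unfolding lmc_density_def by (rule nn_integral_density) auto
  with assms show ?thesis by (subst bind_lmc_kernel_eq_density) auto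
qed

lemma chi_sq_density:
  assumes p_pos: "\<And>x. 0 < p x" and [measurable]: "f \<in> borel_measurable borel"
  shows "chi_sq (density lborel f) p = ratio_energy p f - 1"
proof -
  have "AE x in lborel. f x = RN_deriv lborel (density lborel f) x"
    by (rule sigma_finite_measure.RN_deriv_unique[OF sigma_finite_lborel]) auto
  hence "(\<integral>\<^sup>+x. (RN_deriv lborel (density lborel f) x)\<^sup>2 / ennreal (p x) \<partial>lborel) = ratio_energy p f"
    unfolding ratio_energy_def
    by (intro nn_integral_cong_AE)
       (auto elim!: eventually_mono simp: divide_ennreal_def inverse_ennreal[OF p_pos] inverse_eq_divide)
  moreover have "absolutely_continuous lborel (density lborel f)"
    by (rule absolutely_continuousI_density) simp
  ultimately show ?thesis by (simp add: chi_sq_def)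
qed

lemma geometric_recursion_ennreal:
  fixes a :: "nat \<Rightarrow> ennreal" and x b :: real
  assumes step: "\<And>k. a (Suc k) \<le> ennreal (exp (- x)) * a k + ennreal b"
    and x_range: "0 < x" "x \<le> 1" and b_nonneg: "0 \<le> b"
  shows "a n \<le> ennreal (exp (- real n * x)) * a 0 + ennreal (2 * b / x)"
proof (induction n)
  case (Suc n)
  have "exp (- x) \<le> 1 / (1 + x)"
    using exp_ge_add_one_self[of x] x_range by (simp add: exp_minus field_simps)
  also have "\<dots> \<le> 1 - x / 2"
    using x_range by (simp add: field_simps power2_eq_square)
  finally have "exp (- x) * (2 * b / x) \<le> (1 - x / 2) * (2 * b / x)"
    using x_range b_nonneg by (intro mult_right_mono) auto
  also have "\<dots> = 2 * b / x - b" using x_range by (simp add: field_simps)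
  finally have fixpoint: "ennreal (exp (- x) * (2 * b / x) + b) \<le> ennreal (2 * b / x)"
    by (intro ennreal_leI) simp
  have "a (Suc n)
      \<le> ennreal (exp (- x)) * (ennreal (exp (- real n * x)) * a 0 + ennreal (2 * b / x)) + ennreal b"
    by (intro order_trans[OF step] add_right_mono mult_left_mono Suc.IH) simp
  also have "\<dots> = ennreal (exp (- x)) * ennreal (exp (- real n * x)) * a 0
      + (ennreal (exp (- x)) * ennreal (2 * b / x) + ennreal b)"
    by (simp only: distrib_left mult.assoc add.assoc)
  also have "ennreal (exp (- x)) * ennreal (exp (- real n * x)) = ennreal (exp (- real (Suc n) * x))"
    by (simp add: ennreal_mult[symmetric] exp_add[symmetric] algebra_simps)
  also have "ennreal (exp (- x)) * ennreal (2 * b / x) + ennreal b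
      = ennreal (exp (- x) * (2 * b / x) + b)"
    using x_range b_nonneg by (simp add: ennreal_mult'[symmetric])
  also note fixpoint
  finally show ?case by (simp add: add_left_mono)
qed simp

context lmc
begin

lemma chi_sq_bind_lmc_kernel_le:
  assumes \<mu>_prob: "sets \<mu> = sets borel" "prob_space \<mu>"
  shows "chi_sq (bind \<mu> (lmc_kernel s h)) p \<le> ennreal decay * chi_sq \<mu> p + ennreal step_error"
proof (cases "chi_sq \<mu> p = \<infinity>")
  case True
  thus ?thesis using decay_pos by (simp add: ennreal_mult_top)
next
  case False
  define f where "f = RN_deriv lborel \<mu>"
  have f_meas [measurable]: "f \<in> borel_measurable borel" unfolding f_def by measurable
  have "absolutely_continuous lborel \<mu>" using False by (auto simp: chi_sq_def split: if_splits)
  hence density_eq: "density lborel f = \<mu>"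
    unfolding f_def
    by (rule sigma_finite_measure.density_RN_deriv[OF sigma_finite_lborel]) (simp add: \<mu>_prob)
  hence chi_eq: "chi_sq \<mu> p = ratio_energy p f - 1"
    using chi_sq_density[OF p_pos f_meas] by simp
  have "(\<integral>\<^sup>+x. f x \<partial>lborel) = 1"
    using prob_space.emeasure_space_1[OF \<mu>_prob(2)] unfolding density_eq[symmetric]
    by (simp add: emeasure_density)
  hence "ratio_energy p (lmc_density s h f)
    \<le> ennreal decay * ratio_energy p f + ennreal (1 - decay + step_error)"
    by (intro ratio_energy_lmc_density_le) auto
  also have "\<dots> \<le> ennreal decay * (chi_sq \<mu> p + 1) + ennreal (1 - decay + step_error)"
    unfolding chi_eq
    by (intro add_right_mono mult_left_mono) (auto simp: add.commute add_diff_self_ennreal)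
  also have "\<dots> = ennreal decay * chi_sq \<mu> p + (ennreal decay + ennreal (1 - decay + step_error))"
    by (simp only: distrib_left mult_1_right add.assoc)
  also have "ennreal decay + ennreal (1 - decay + step_error) = ennreal (1 + step_error)"
    using decay_pos decay_le_one step_error_nonneg by (subst ennreal_plus[symmetric]) auto
  also have "ennreal decay * chi_sq \<mu> p + \<dots> = 1 + (ennreal decay * chi_sq \<mu> p + ennreal step_error)"
    using step_error_nonneg by (simp add: add.left_commute)
  finally have "ratio_energy p (lmc_density s h f) - 1 \<le> ennreal decay * chi_sq \<mu> p + ennreal step_error"
    by (simp add: ennreal_minus_le_iff)
  moreover have "bind \<mu> (lmc_kernel s h) = density lborel (lmc_density s h f)"
    using bind_lmc_kernel_density[OF h_pos s_meas f_meas] \<mu>_prob(2) by (simp add: density_eq)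
  ultimately show ?thesis by (simp add: chi_sq_density p_pos)
qed

lemma step_error_le: "step_error \<le> 170 * real DIM('a) * L\<^sup>2 * h\<^sup>2 + 5 * \<epsilon>\<^sup>2 * h"
proof -
  have "step_error = 30 * (real DIM('a) * L\<^sup>2 * h\<^sup>2) + 5 / 2 * (\<epsilon>\<^sup>2 * h)"
    by (simp add: step_error_def power2_eq_square algebra_simps)
  also have "\<dots> \<le> 170 * (real DIM('a) * L\<^sup>2 * h\<^sup>2) + 5 * (\<epsilon>\<^sup>2 * h)"
    using h_pos by (intro add_mono mult_right_mono) auto
  finally show ?thesis by (simp add: mult.assoc)
qed

lemma accumulated_error_le:
  "2 * step_error / (h / (4 * C)) \<le> 680 * real DIM('a) * L\<^sup>2 * h * C + 20 * \<epsilon>\<^sup>2 * C"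
proof -
  have "2 * step_error / (h / (4 * C)) = 240 * (real DIM('a) * L\<^sup>2 * h * C) + 20 * (\<epsilon>\<^sup>2 * C)"
    using h_pos C_ge by (simp add: step_error_def field_simps)
  also have "\<dots> \<le> 680 * (real DIM('a) * L\<^sup>2 * h * C) + 20 * (\<epsilon>\<^sup>2 * C)"
    using h_pos C_ge by (intro add_mono mult_right_mono) auto
  finally show ?thesis by (simp add: mult.assoc)
qed

lemma accumulated_error_bound_le_one: "680 * real DIM('a) * L\<^sup>2 * h * C + 20 * \<epsilon>\<^sup>2 * C \<le> 1"
proof -
  have "680 * real DIM('a) * L\<^sup>2 * h * C + 20 * \<epsilon>\<^sup>2 * C
      = 680 / 4392 * (4392 * real DIM('a) * C * L\<^sup>2 * h) + 20 / 48 * (48 * C * \<epsilon>\<^sup>2)"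
    by (simp add: algebra_simps)
  thus ?thesis using C_\<epsilon>_power2_le C_h_le by linarith
qed

context
  fixes q0 :: "'a measure"
  assumes q0_prob: "prob_space q0" "sets q0 = sets borel"
begin

lemma lmc_law_prob_space_borel: "prob_space (lmc_law q0 s h n) \<and> sets (lmc_law q0 s h n) = sets borel"
  using q0_prob by (induction n) (auto simp: prob_space_bind_lmc_kernel sets_bind_lmc_kernel h_pos)

lemma chi_sq_lmc_law_Suc_le:
  "chi_sq (lmc_law q0 s h (Suc k)) p \<le> ennreal decay * chi_sq (lmc_law q0 s h k) p + ennreal step_error"
  using chi_sq_bind_lmc_kernel_le lmc_law_prob_space_borel by simp

lemma chi_sq_lmc_law_le:
  "chi_sq (lmc_law q0 s h n) p
    \<le> ennreal (exp (- real n * (h / (4 * C)))) * chi_sq q0 p + ennreal (2 * step_error / (h / (4 * C)))"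
proof -
  have "h / (4 * C) \<le> 1" using h_le_one C_ge by (simp add: field_simps)
  thus ?thesis
    using geometric_recursion_ennreal[of "\<lambda>k. chi_sq (lmc_law q0 s h k) p" "h / (4 * C)" step_error n]
      chi_sq_lmc_law_Suc_le h_pos C_ge step_error_nonneg by (simp add: decay_def)
qed

end

end

theorem theorem6:
  fixes p :: "'a::euclidean_space \<Rightarrow> real"
    and gp s :: "'a \<Rightarrow> 'a"
    and q0 :: "'a measure"
    and L C\<^sub>L\<^sub>S \<epsilon>\<^sub>1 h :: real
    and N :: nat
  assumes p_dens: "prob_density p"
    and p_pos: "\<forall>x. 0 < p x"
    and score: "\<forall>x. GDERIV (\<lambda>y. ln (p y)) x :> gp x"
    and score_cont: "continuous_on UNIV gp"
    and lip: "\<forall>x y. norm (gp x - gp y) \<le> L * norm (x - y)"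
    and L_ge: "1 \<le> L"
    and LSI: "log_sobolev C\<^sub>L\<^sub>S p gp"
    and C_ge: "1 \<le> C\<^sub>L\<^sub>S"
    and eps_le: "\<epsilon>\<^sub>1 \<le> sqrt (1 / (48 * C\<^sub>L\<^sub>S))"
    and s_meas: "s \<in> borel_measurable borel"
    and s_err: "\<forall>x. norm (gp x - s x) \<le> \<epsilon>\<^sub>1"
    and h_pos: "0 < h"
    and h_le: "h \<le> 1 / (4392 * real DIM('a) * C\<^sub>L\<^sub>S * L\<^sup>2)"
    and q0_prob: "prob_space q0"
    and q0_sets: "sets q0 = sets borel"
  shows "(\<forall>k. chi_sq (lmc_law q0 s h (Suc k)) p
              \<le> ennreal (exp (- h / (4 * C\<^sub>L\<^sub>S))) * chi_sq (lmc_law q0 s h k) p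
                 + ennreal (170 * real DIM('a) * L\<^sup>2 * h\<^sup>2 + 5 * \<epsilon>\<^sub>1\<^sup>2 * h))
       \<and> chi_sq (lmc_law q0 s h N) p
           \<le> ennreal (exp (- real N * h / (4 * C\<^sub>L\<^sub>S))) * chi_sq q0 p
              + ennreal (680 * real DIM('a) * L\<^sup>2 * h * C\<^sub>L\<^sub>S + 20 * \<epsilon>\<^sub>1\<^sup>2 * C\<^sub>L\<^sub>S)
       \<and> ennreal (exp (- real N * h / (4 * C\<^sub>L\<^sub>S))) * chi_sq q0 p
              + ennreal (680 * real DIM('a) * L\<^sup>2 * h * C\<^sub>L\<^sub>S + 20 * \<epsilon>\<^sub>1\<^sup>2 * C\<^sub>L\<^sub>S)
           \<le> ennreal (exp (- real N * h / (4 * C\<^sub>L\<^sub>S))) * chi_sq q0 p + 1"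
proof (intro conjI allI)
  interpret lmc p gp L s C\<^sub>L\<^sub>S \<epsilon>\<^sub>1 h
    using assms by unfold_locales auto
  show "chi_sq (lmc_law q0 s h (Suc k)) p
      \<le> ennreal (exp (- h / (4 * C\<^sub>L\<^sub>S))) * chi_sq (lmc_law q0 s h k) p
        + ennreal (170 * real DIM('a) * L\<^sup>2 * h\<^sup>2 + 5 * \<epsilon>\<^sub>1\<^sup>2 * h)" for k
    using chi_sq_lmc_law_Suc_le[OF q0_prob q0_sets] unfolding decay_def
    by (rule order_trans) (intro add_left_mono ennreal_leI step_error_le)
  show "chi_sq (lmc_law q0 s h N) p
      \<le> ennreal (exp (- real N * h / (4 * C\<^sub>L\<^sub>S))) * chi_sq q0 p
        + ennreal (680 * real DIM('a) * L\<^sup>2 * h * C\<^sub>L\<^sub>S + 20 * \<epsilon>\<^sub>1\<^sup>2 * C\<^sub>L\<^sub>S)"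
    using chi_sq_lmc_law_le[OF q0_prob q0_sets] unfolding times_divide_eq_right
    by (rule order_trans) (intro add_left_mono ennreal_leI accumulated_error_le)
  show "ennreal (exp (- real N * h / (4 * C\<^sub>L\<^sub>S))) * chi_sq q0 p
        + ennreal (680 * real DIM('a) * L\<^sup>2 * h * C\<^sub>L\<^sub>S + 20 * \<epsilon>\<^sub>1\<^sup>2 * C\<^sub>L\<^sub>S)
      \<le> ennreal (exp (- real N * h / (4 * C\<^sub>L\<^sub>S))) * chi_sq q0 p + 1"
    using ennreal_leI[OF accumulated_error_bound_le_one] by (intro add_left_mono) simp
qed

end
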